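(* Let $D$ be a positive integer, $a>0$, let $q$ be a real $D\times D$ matrix with $q(i,j)\ge0$ for $i\ne j$, $q(i,i)=-\sum_{j\neq i}q(i,j)$, and $\mathrm{Id}+q$ irreducible, and let $\nu$ be the unique probability vector with $\nu^\top q=0$. Let $\pi$ be the unique stationary distribution of the exponential zig-zag process with parameters $(a,q)$ on $E=\triangle\times\{1,\dots,D\}$. Then $\pi$ admits the decomposition $$\pi=\sum_{i=1}^D\nu_i\,\pi_i\otimes\delta_i,\qquad \pi_i(dx)=\varphi(x,i)\,dx,$$ where $dx$ is the Lebesgue measure on the simplex $\triangle$, and the function $\varphi$ satisfies, for any $(x,i)\in E$, $$(D-1)\varphi(x,i)+\sum_{k=1}^D x_k\,\partial_k\varphi(x,i)-\partial_i\varphi(x,i)+\sum_{j=1}^D\frac{\nu_j}{\nu_i}\,a\,q(j,i)\,\varphi(x,j)=0 .$$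
   Context: $\triangle=\{x\in[0,1]^D:\sum_{i=1}^D x_i=1\}$ and $(e_1,\dots,e_D)$ is the canonical basis of $\mathbb{R}^D$. Integrals over $\triangle$ are taken in the coordinates $(x_2,\dots,x_D)$ with $x_1=1-\sum_{i\ge2}x_i$. In the last sum of the equation, the term $j=i$ is included. Exponential zig-zag process with parameters $(a,q)$: the Markov process $(\mathbf X_t,\mathbf I_t)_{t\ge0}$ on $E$ with generator $$\mathcal L_Z f(x,i)=(e_i-x)\cdot\nabla_x f(x,i)+\sum_{j\ne i}a\,q(i,j)\,[f(x,j)-f(x,i)].$$ That is, $\mathbf I$ jumps from $i$ to $j\ne i$ at rate $a\,q(i,j)$, and $\mathbf X$ is continuous and solves $\dot{\mathbf X}_t=e_{\mathbf I_t}-\mathbf X_t$ between jumps. It has a unique stationary distribution.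
   Formalization: The equation for φ is asserted only at points x of the simplex with all x_k > 0, not for every (x,i) in E: on the boundary φ can be infinite or not differentiable, e.g. for D = 2, φ(x,1) = c x_1^{a q(2,1)} x_2^{a q(1,2)-1} with a q(1,2) < 1. *)

theory Defs
  imports "HOL-Probability.Probability"
begin

text \<open>
  The index set $\{1,\dots,D\}$ is the finite type \<open>'n\<close>, so that $D$ is \<open>CARD('n)\<close>
  and $e_i$ is \<open>axis i 1\<close>.
\<close>

definition std_simplex :: "(real ^ 'n) set" where
  "std_simplex = {x. (\<forall>i. 0 \<le> x $ i \<and> x $ i \<le> 1) \<and> (\<Sum>i\<in>UNIV. x $ i) = 1}"

text \<open>
  Lebesgue measure on the simplex in the coordinates \<open>x $ i\<close>, \<open>i \<noteq> r\<close>, the remaining coordinate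
  being \<open>x $ r = 1 - (\<Sum>i\<in>UNIV - {r}. x $ i)\<close>. The measure does not depend on \<open>r\<close>.
  If \<open>'n\<close> has one element, it is the unit mass at the only point of the simplex.
\<close>

definition simplex_chart :: "'n \<Rightarrow> ('n \<Rightarrow> real) \<Rightarrow> real ^ 'n" where
  "simplex_chart r y = (\<chi> i. if i = r then 1 - (\<Sum>j\<in>UNIV - {r}. y j) else y i)"

definition simplex_lebesgue :: "'n::finite \<Rightarrow> (real ^ 'n) measure" where
  "simplex_lebesgue r =
     density (distr (Pi\<^sub>M (UNIV - {r}) (\<lambda>_. lborel)) borel (simplex_chart r))
             (indicator std_simplex)"

text \<open>
  Functions on the simplex are differentiated through an extension to $\mathbb R^D$. Only
  directions \<open>x - axis i 1\<close>, tangent to the simplex, occur in the generator and in the equation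
  for the density, so the choice of the extension does not matter.
\<close>

definition partial_deriv :: "'n \<Rightarrow> (real ^ 'n \<Rightarrow> real) \<Rightarrow> real ^ 'n \<Rightarrow> real" where
  "partial_deriv k g x = deriv (\<lambda>t. g (x + t *\<^sub>R axis k 1)) 0"

definition grad :: "(real ^ 'n \<Rightarrow> real) \<Rightarrow> real ^ 'n \<Rightarrow> real ^ 'n" where
  "grad g x = (\<chi> k. partial_deriv k g x)"

definition C1 :: "(real ^ 'n::finite \<Rightarrow> real) \<Rightarrow> bool" where
  "C1 g \<longleftrightarrow> (\<forall>x. g differentiable (at x)) \<and> continuous_on UNIV (grad g)"

text \<open>Irreducibility: the directed graph of the nonzero entries is strongly connected.\<close>

definition irreducible_matrix :: "real ^ 'n ^ 'n \<Rightarrow> bool" where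
  "irreducible_matrix A \<longleftrightarrow> (\<forall>i j. (i, j) \<in> {(k, l). A $ k $ l \<noteq> 0}\<^sup>*)"

definition zz_space :: "((real ^ 'n) \<times> 'n::finite) measure" where
  "zz_space = restrict_space (borel \<Otimes>\<^sub>M count_space UNIV) (std_simplex \<times> UNIV)"

definition zz_generator ::
    "real \<Rightarrow> real ^ 'n ^ 'n \<Rightarrow> ((real ^ 'n) \<times> 'n \<Rightarrow> real) \<Rightarrow> (real ^ 'n) \<times> 'n::finite \<Rightarrow> real" where
  "zz_generator a q f = (\<lambda>(x, i).
     (axis i 1 - x) \<bullet> grad (\<lambda>y. f (y, i)) x
     + (\<Sum>j\<in>UNIV - {i}. a * q $ i $ j * (f (x, j) - f (x, i))))"

definition markov_semigroup :: "'s measure \<Rightarrow> (real \<Rightarrow> 's \<Rightarrow> 's measure) \<Rightarrow> bool" where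
  "markov_semigroup S K \<longleftrightarrow>
     (\<forall>t\<ge>0. K t \<in> S \<rightarrow>\<^sub>M prob_algebra S) \<and>
     (\<forall>z\<in>space S. K 0 z = return S z) \<and>
     (\<forall>s\<ge>0. \<forall>t\<ge>0. \<forall>z\<in>space S. K (s + t) z = K s z \<bind> K t)"

definition stationary_distribution ::
    "'s measure \<Rightarrow> (real \<Rightarrow> 's \<Rightarrow> 's measure) \<Rightarrow> 's measure \<Rightarrow> bool" where
  "stationary_distribution S K \<mu> \<longleftrightarrow>
     \<mu> \<in> space (prob_algebra S) \<and> (\<forall>t\<ge>0. \<mu> \<bind> K t = \<mu>)"

text \<open>
  The exponential zig-zag process enters through its transition kernels \<open>K t z\<close>, the law of
  $(\mathbf X_t, \mathbf I_t)$ started at \<open>z\<close>. Its generator is the derivative at $t = 0$, in the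
  supremum norm, of the semigroup $f \mapsto \int f \, dK_t$. It is prescribed on the functions
  which are continuously differentiable in $x$. These form a core, so it determines \<open>K\<close>.
\<close>

definition exp_zigzag ::
    "real \<Rightarrow> real ^ 'n ^ 'n \<Rightarrow>
     (real \<Rightarrow> (real ^ 'n) \<times> 'n \<Rightarrow> ((real ^ 'n) \<times> 'n::finite) measure) \<Rightarrow> bool" where
  "exp_zigzag a q K \<longleftrightarrow>
     markov_semigroup zz_space K \<and>
     (\<forall>f. (\<forall>i. C1 (\<lambda>x. f (x, i))) \<longrightarrow>
        uniform_limit (space zz_space)
          (\<lambda>t z. ((\<integral>w. f w \<partial>K t z) - f z) / t) (zz_generator a q f) (at_right 0))"

end

theory Submission
  imports Defs
begin

text \<open>
  Let \<open>\<mu>\<^sub>i\<close> be the restriction of \<open>\<pi>\<close> to the state \<open>i\<close>. Stationarity gives the equation for the density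
  in weak form, and the point is the regularity. Let \<open>X\<close> be distributed according to \<open>\<pi>\<close>. Run the
  process backwards until the total weight of the past is \<open>\<delta>\<close> and rescale: \<open>X / \<delta>\<close> is a point of the
  simplex plus the vector of the times spent in the states by an inhomogeneous Markov chain, which
  jumps at total weight \<open>s\<close> with rates \<open>a q / s\<close>. If all coordinates of \<open>X / \<delta>\<close> exceed 1, then
  the chain has visited every state, and the law of the occupation times restricted to this event has
  a continuously differentiable density: for a given number of jumps it is obtained by iterated
  integrations along the coordinate axes, and each integration in the direction of the current state
  solves the differential equation in that direction. The contributions of the numbers of jumps form
  a series which converges together with its gradient.

  Homogeneity turns the resulting density on the cone into a density on the simplex, and Euler's
  identity produces the term \<open>(D - 1) \<phi>\<close>. The boundary of the simplex has no mass, because the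
  masses of a face form a null vector of \<open>q\<close> with a zero entry.
\<close>

section \<open>Functions with a continuous gradient\<close>

text \<open>The generator differentiates only along \<open>axis i 1 - x\<close>, so the weak
  equation for state \<open>i\<close> controls a single direction per state and does not give a
  density by itself. On the cone the motion in state \<open>i\<close> is a translation along the
  \<open>i\<close>-th axis, so the iterated integrations separate into coordinates; on the simplex
  the flow lines would converge to the vertices. The diagonal of \<open>a q\<close> is not positive.
  Adding \<open>(m + 1) Id\<close> makes every term of the expansion over jumps nonnegative, so that
  Tonelli and monotone convergence apply throughout. The price is the weight \<sigma>^(m+1) on the
  cone, and with it the degree \<open>m + 2 - CARD('n)\<close> of homogeneity. A path that has not
  visited every state has its occupation vector on a proper face, and such paths have no density in
  full dimension. The expansion is therefore indexed by the set of visited states as well, and its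
  singular part is discarded by looking only at points with all coordinates above 1. To avoid
  questions at the boundary, every density is extended from the orthant to a C1 function on the
  whole space.\<close>

definition has_gradient :: "('a::euclidean_space \<Rightarrow> real) \<Rightarrow> ('a \<Rightarrow> 'a) \<Rightarrow> bool" where
  "has_gradient u g \<longleftrightarrow>
     (\<forall>x. (u has_derivative (\<lambda>h. g x \<bullet> h)) (at x)) \<and> continuous_on UNIV g"

lemma has_gradientD:
  assumes "has_gradient u g"
  shows "(u has_derivative (\<lambda>h. g x \<bullet> h)) (at x)" "continuous_on UNIV g" "continuous_on UNIV u"
  using assms unfolding has_gradient_def
  by (auto intro!: has_derivative_continuous_on intro: has_derivative_at_withinI)

lemma has_gradient_measurable:
  assumes "has_gradient u g"
  shows "u \<in> borel_measurable borel" "g \<in> borel_measurable borel"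
  using has_gradientD[OF assms] by (auto intro: borel_measurable_continuous_onI)

lemma has_gradient_const: "has_gradient (\<lambda>_. c) (\<lambda>_. 0)"
  by (auto simp: has_gradient_def)

lemma has_gradient_add:
  assumes "has_gradient u g" "has_gradient v h"
  shows "has_gradient (\<lambda>x. u x + v x) (\<lambda>x. g x + h x)"
  using assms unfolding has_gradient_def
  by (auto intro!: derivative_eq_intros continuous_intros simp: inner_add_left)

lemma has_gradient_sum:
  assumes "\<And>i. i \<in> I \<Longrightarrow> has_gradient (u i) (g i)"
  shows "has_gradient (\<lambda>x. \<Sum>i\<in>I. u i x) (\<lambda>x. \<Sum>i\<in>I. g i x)"
  using assms
  by (induction I rule: infinite_finite_induct) (auto intro!: has_gradient_const has_gradient_add)

lemma has_gradient_mult: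
  assumes "has_gradient u g" "has_gradient v h"
  shows "has_gradient (\<lambda>x. u x * v x) (\<lambda>x. u x *\<^sub>R h x + v x *\<^sub>R g x)"
proof -
  note 1 = has_gradientD[OF assms(1)] and 2 = has_gradientD[OF assms(2)]
  have "((\<lambda>x. u x * v x) has_derivative (\<lambda>k. (u x *\<^sub>R h x + v x *\<^sub>R g x) \<bullet> k)) (at x)" for x
    by (rule has_derivative_eq_rhs[OF has_derivative_mult[OF 1(1) 2(1)]])
       (auto simp: inner_add_left algebra_simps)
  moreover have "continuous_on UNIV (\<lambda>x. u x *\<^sub>R h x + v x *\<^sub>R g x)"
    using 1 2 by (intro continuous_intros) auto
  ultimately show ?thesis
    by (simp add: has_gradient_def)
qed

lemma has_gradient_cmult:
  assumes "has_gradient u g"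
  shows "has_gradient (\<lambda>x. c * u x) (\<lambda>x. c *\<^sub>R g x)"
  using has_gradient_mult[OF has_gradient_const[of c] assms] by simp

lemma has_gradient_affine:
  assumes "has_gradient u g"
  shows "has_gradient (\<lambda>x. u (s *\<^sub>R x + v)) (\<lambda>x. s *\<^sub>R g (s *\<^sub>R x + v))"
proof -
  note 1 = has_gradientD[OF assms]
  have "((\<lambda>x. u (s *\<^sub>R x + v)) has_derivative (\<lambda>h. g (s *\<^sub>R x + v) \<bullet> (s *\<^sub>R h))) (at x)" for x
    by (rule has_derivative_compose[of "\<lambda>x. s *\<^sub>R x + v", OF _ 1(1)])
       (auto intro!: derivative_eq_intros)
  moreover have "continuous_on UNIV (\<lambda>x. s *\<^sub>R g (s *\<^sub>R x + v))"
    by (intro continuous_intros continuous_on_compose2[OF 1(2)]) auto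
  ultimately show ?thesis
    by (simp add: has_gradient_def)
qed

text \<open>The mean value inequality on a ball, which is convex. It dominates the difference
  quotients when limits are taken under the integral sign.\<close>

lemma has_gradient_lipschitz:
  fixes u :: "'a::euclidean_space \<Rightarrow> real"
  assumes der: "\<And>x. (u has_derivative (\<lambda>h. g x \<bullet> h)) (at x)"
    and bnd: "\<And>x. norm x \<le> R \<Longrightarrow> norm (g x) \<le> C" and x: "norm x \<le> R" and y: "norm y \<le> R"
  shows "\<bar>u y - u x\<bar> \<le> C * norm (y - x)"
proof -
  have "norm (u y - u x) \<le> C * norm (y - x)"
  proof (rule differentiable_bound[where S = "cball 0 R" and f' = "\<lambda>x h. g x \<bullet> h"])
    fix z :: 'a assume z: "z \<in> cball 0 R"
    show "onorm (\<lambda>h. g z \<bullet> h) \<le> C"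
      using z bnd[of z]
      by (intro onorm_le) (auto intro!: order_trans[OF Cauchy_Schwarz_ineq2] mult_right_mono)
  qed (use assms in \<open>auto intro: has_derivative_at_withinI\<close>)
  then show ?thesis by simp
qed

text \<open>Dominated convergence along sequences that tend to \<open>x\<close>, applied to the
  normalised first-order remainder; the gradient itself is treated in the same way. The bounds are
  asked for on a set \<open>S\<close> of full measure, because later they hold on the simplex and
  not on the whole space.\<close>

lemma has_gradient_integral:
  fixes u :: "'a::euclidean_space \<Rightarrow> 'b \<Rightarrow> real"
  assumes fin: "finite_measure M" and S: "AE t in M. t \<in> S"
    and grad: "\<And>t. t \<in> S \<Longrightarrow> has_gradient (\<lambda>x. u x t) (\<lambda>x. g x t)"
    and meas: "\<And>x. u x \<in> borel_measurable M" "\<And>x. g x \<in> borel_measurable M"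
    and bnd: "\<And>R. \<exists>C. \<forall>x t. norm x \<le> R \<longrightarrow> t \<in> S \<longrightarrow> \<bar>u x t\<bar> \<le> C \<and> norm (g x t) \<le> C"
  shows "has_gradient (\<lambda>x. \<integral>t. u x t \<partial>M) (\<lambda>x. \<integral>t. g x t \<partial>M)"
proof -
  interpret finite_measure M by fact
  have iu: "integrable M (u x)" for x
  proof -
    obtain C where "\<forall>t\<in>S. \<bar>u x t\<bar> \<le> C" using bnd[of "norm x"] by auto
    then show ?thesis
      using S by (intro integrable_const_bound[of _ C] meas) (auto elim!: eventually_mono)
  qed
  have ig: "integrable M (g x)" for x
  proof -
    obtain C where "\<forall>t\<in>S. norm (g x t) \<le> C" using bnd[of "norm x"] by auto
    then show ?thesis
      using S by (intro integrable_const_bound[of _ C] meas) (auto elim!: eventually_mono)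
  qed
  have cont: "(\<lambda>n. \<integral>t. g (X n) t \<partial>M) \<longlonglongrightarrow> (\<integral>t. g x t \<partial>M)" if X: "X \<longlonglongrightarrow> x" for X x
  proof -
    obtain R where R: "\<And>n. norm (X n) \<le> R"
      using X by (meson Bseq_def convergent_imp_Bseq convergentI)
    obtain C where C: "\<forall>x t. norm x \<le> R \<longrightarrow> t \<in> S \<longrightarrow> norm (g x t) \<le> C"
      using bnd[of R] by blast
    show ?thesis
    proof (rule integral_dominated_convergence[where w = "\<lambda>_. C"])
      show "AE t in M. (\<lambda>n. g (X n) t) \<longlonglongrightarrow> g x t"
        using S
      proof eventually_elim
        case (elim t)
        have "isCont (\<lambda>x. g x t) x"
          using has_gradientD(2)[OF grad[OF elim]] by (simp add: continuous_on_eq_continuous_at)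
        then show ?case
          using X by (rule isCont_tendsto_compose)
      qed
      show "AE t in M. norm (g (X n) t) \<le> C" for n
        using S by eventually_elim (use C R in auto)
    qed (use meas in auto)
  qed
  have "((\<lambda>x. \<integral>t. u x t \<partial>M) has_derivative (\<lambda>h. (\<integral>t. g x t \<partial>M) \<bullet> h)) (at x)" for x
    unfolding has_derivative_iff_norm
  proof (intro conjI)
    show "bounded_linear (\<lambda>h. (\<integral>t. g x t \<partial>M) \<bullet> h)" by (rule bounded_linear_inner_right)
    show "((\<lambda>y. norm ((\<integral>t. u y t \<partial>M) - (\<integral>t. u x t \<partial>M) - (\<integral>t. g x t \<partial>M) \<bullet> (y - x)) / norm (y - x))
            \<longlongrightarrow> 0) (at x)"
      unfolding tendsto_at_iff_sequentially comp_def
    proof (intro allI impI)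
      fix X assume X1: "\<forall>i. X i \<in> UNIV - {x}" and X: "X \<longlonglongrightarrow> x"
      obtain R0 where R0: "\<And>n. norm (X n) \<le> R0"
        using X by (meson Bseq_def convergent_imp_Bseq convergentI)
      define R where "R = max R0 (norm x)"
      have R: "\<And>n. norm (X n) \<le> R" "norm x \<le> R" using R0 by (auto simp: R_def le_max_iff_disj)
      obtain C where C: "\<forall>x t. norm x \<le> R \<longrightarrow> t \<in> S \<longrightarrow> norm (g x t) \<le> C"
        using bnd[of R] by blast
      \<comment> \<open>The bound \<open>2 * C\<close> below consists of one \<open>C\<close> for
        the increment, by the mean value inequality, and one for the linear term.\<close>
      define d where "d n t = (u (X n) t - u x t - g x t \<bullet> (X n - x)) / norm (X n - x)" for n t
      have "(\<lambda>n. \<integral>t. d n t \<partial>M) \<longlonglongrightarrow> (\<integral>t. 0 \<partial>M)"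
      proof (rule integral_dominated_convergence[where w = "\<lambda>_. 2 * C"])
        show "d n \<in> borel_measurable M" for n
          unfolding d_def using meas by measurable
        show "AE t in M. (\<lambda>n. d n t) \<longlonglongrightarrow> 0"
          using S
        proof eventually_elim
          case (elim t)
          have "((\<lambda>y. norm (u y t - u x t - g x t \<bullet> (y - x)) / norm (y - x)) \<longlongrightarrow> 0) (at x)"
            using has_gradientD(1)[OF grad[OF elim]] unfolding has_derivative_iff_norm by blast
          then have "(\<lambda>n. norm (d n t)) \<longlonglongrightarrow> 0"
            using X1 X unfolding tendsto_at_iff_sequentially d_def by (auto simp: comp_def)
          then show ?case by (rule tendsto_norm_zero_cancel)
        qed
        show "AE t in M. norm (d n t) \<le> 2 * C" for n
          using S
        proof eventually_elim
          case (elim t)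
          have "\<bar>u (X n) t - u x t\<bar> \<le> C * norm (X n - x)"
            by (rule has_gradient_lipschitz[where R = R and g = "\<lambda>x. g x t"])
               (use has_gradientD(1)[OF grad[OF elim]] C elim R in auto)
          moreover have "\<bar>g x t \<bullet> (X n - x)\<bar> \<le> C * norm (X n - x)"
            using C elim R by (intro order_trans[OF Cauchy_Schwarz_ineq2] mult_right_mono) auto
          ultimately have "\<bar>u (X n) t - u x t - g x t \<bullet> (X n - x)\<bar> \<le> 2 * C * norm (X n - x)"
            by linarith
          then show ?case
            using X1 by (simp add: d_def divide_simps)
        qed
      qed auto
      moreover have "(\<integral>t. d n t \<partial>M) = ((\<integral>t. u (X n) t \<partial>M) - (\<integral>t. u x t \<partial>M)
          - (\<integral>t. g x t \<partial>M) \<bullet> (X n - x)) / norm (X n - x)" for n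
        unfolding d_def using iu ig
        by simp
      ultimately show "(\<lambda>n. norm ((\<integral>t. u (X n) t \<partial>M) - (\<integral>t. u x t \<partial>M) - (\<integral>t. g x t \<partial>M) \<bullet> (X n - x))
          / norm (X n - x)) \<longlonglongrightarrow> 0"
        using tendsto_norm_zero by fastforce
    qed
  qed
  moreover have "continuous_on UNIV (\<lambda>x. \<integral>t. g x t \<partial>M)"
    unfolding continuous_on_sequentially comp_def using cont by auto
  ultimately show ?thesis
    by (simp add: has_gradient_def)
qed

text \<open>Differentiability and continuity at \<open>x\<close> are local, so summable majorants on
  each ball suffice. The ball of radius \<open>norm x + 1\<close> about the origin is convex and
  contains \<open>x\<close>, and the M-test makes the gradients converge uniformly on it.\<close>

lemma has_gradient_suminf:
  fixes u :: "nat \<Rightarrow> 'a::euclidean_space \<Rightarrow> real"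
  assumes grad: "\<And>n. has_gradient (u n) (g n)"
    and bnd: "\<And>R. \<exists>M. summable M \<and> (\<forall>n x. norm x \<le> R \<longrightarrow> \<bar>u n x\<bar> \<le> M n \<and> norm (g n x) \<le> M n)"
  shows "has_gradient (\<lambda>x. \<Sum>n. u n x) (\<lambda>x. \<Sum>n. g n x)"
proof -
  have "((\<lambda>x. \<Sum>n. u n x) has_derivative (\<lambda>h. (\<Sum>n. g n x) \<bullet> h)) (at x) \<and>
        isCont (\<lambda>x. \<Sum>n. g n x) x" for x
  proof -
    define S where "S = ball (0::'a) (norm x + 1)"
    obtain M where M: "summable M"
      "\<And>n y. y \<in> S \<Longrightarrow> \<bar>u n y\<bar> \<le> M n" "\<And>n y. y \<in> S \<Longrightarrow> norm (g n y) \<le> M n"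
      using bnd[of "norm x + 1"] unfolding S_def by (auto simp: less_imp_le)
    have x: "x \<in> S" and S: "open S" "convex S" by (auto simp: S_def)
    have unif: "uniform_limit S (\<lambda>n y. \<Sum>i<n. g i y) (\<lambda>y. \<Sum>i. g i y) sequentially"
      by (rule Weierstrass_m_test[OF M(3,1)])
    have su: "summable (\<lambda>n. u n y)" if "y \<in> S" for y
      by (rule summable_comparison_test'[OF M(1)]) (use M(2) that in auto)
    have "\<exists>f. \<forall>y\<in>S. (\<lambda>n. u n y) sums (f y) \<and>
        (f has_derivative (\<lambda>h. (\<Sum>n. g n y) \<bullet> h)) (at y within S)"
    proof (rule has_derivative_series[where x = x and l = "\<Sum>n. u n x" and f' = "\<lambda>n y h. g n y \<bullet> h"])
      show "convex S" "x \<in> S" "(\<lambda>n. u n x) sums (\<Sum>n. u n x)"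
        using S x su by (auto intro: summable_sums)
      show "(u n has_derivative (\<lambda>h. g n y \<bullet> h)) (at y within S)" for n y
        using has_gradientD(1)[OF grad] by (rule has_derivative_at_withinI)
      fix e :: real assume "e > 0"
      from uniform_limitD[OF unif this]
      show "\<forall>\<^sub>F n in sequentially. \<forall>y\<in>S. \<forall>h. norm ((\<Sum>i<n. g i y \<bullet> h) - (\<Sum>n. g n y) \<bullet> h) \<le> e * norm h"
      proof eventually_elim
        case (elim n)
        show ?case
        proof (intro ballI allI)
          fix y h assume "y \<in> S"
          then have "norm ((\<Sum>i<n. g i y) - (\<Sum>n. g n y)) \<le> e"
            using elim by (auto simp: dist_norm intro: less_imp_le)
          then have "\<bar>((\<Sum>i<n. g i y) - (\<Sum>n. g n y)) \<bullet> h\<bar> \<le> e * norm h"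
            by (intro order_trans[OF Cauchy_Schwarz_ineq2] mult_right_mono) auto
          then show "norm ((\<Sum>i<n. g i y \<bullet> h) - (\<Sum>n. g n y) \<bullet> h) \<le> e * norm h"
            by (simp add: inner_diff_left inner_sum_left)
        qed
      qed
    qed
    then obtain f where f: "\<And>y. y \<in> S \<Longrightarrow> (\<lambda>n. u n y) sums (f y)"
      "\<And>y. y \<in> S \<Longrightarrow> (f has_derivative (\<lambda>h. (\<Sum>n. g n y) \<bullet> h)) (at y within S)"
      by blast
    have "((\<lambda>x. \<Sum>n. u n x) has_derivative (\<lambda>h. (\<Sum>n. g n x) \<bullet> h)) (at x within S)"
      using f by (intro has_derivative_transform[OF x _ f(2)[OF x]]) (auto simp: sums_iff)
    moreover have "continuous_on S (\<lambda>y. \<Sum>i. g i y)"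
    proof (rule uniform_limit_theorem[OF _ unif])
      show "\<forall>\<^sub>F n in sequentially. continuous_on S (\<lambda>y. \<Sum>i<n. g i y)"
        by (intro always_eventually allI continuous_on_sum
            continuous_on_subset[OF has_gradientD(2)[OF grad]]) simp
    qed simp
    ultimately show ?thesis
      using x at_within_open[OF x S(1)] continuous_on_eq_continuous_at[OF S(1)] by metis
  qed
  then show ?thesis
    by (simp add: has_gradient_def continuous_on_eq_continuous_at)
qed

section \<open>Exponential bounds and integration along a coordinate axis\<close>

definition l1 :: "real ^ 'n \<Rightarrow> real" where
  "l1 w = (\<Sum>k\<in>UNIV. \<bar>w $ k\<bar>)"

lemma l1_nonneg: "0 \<le> l1 w"
  by (simp add: l1_def sum_nonneg)

lemma l1_le: "l1 (w :: real ^ 'n::finite) \<le> real CARD('n) * norm w"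
  unfolding l1_def using sum_bounded_above[of UNIV "\<lambda>k. \<bar>w $ k\<bar>" "norm w"]
  by (simp add: component_le_norm_cart)

text \<open>Weighted norms of a function and of its gradient, kept apart since the two decay at
  different rates in the expansion. The weight is exponential because an integration along an axis,
  over a segment whose length grows with the point, then costs no power of the length but gains a
  factor \<open>1 / \<beta>\<close>.\<close>

definition expbd :: "real \<Rightarrow> real \<Rightarrow> real \<Rightarrow> (real ^ 'n \<Rightarrow> real) \<Rightarrow> (real ^ 'n \<Rightarrow> real ^ 'n::finite) \<Rightarrow> bool" where
  "expbd \<beta> K K' u g \<longleftrightarrow> has_gradient u g \<and>
     (\<forall>w. \<bar>u w\<bar> \<le> K * exp (\<beta> * l1 w) \<and> norm (g w) \<le> K' * exp (\<beta> * l1 w))"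

lemma expbdD:
  assumes "expbd \<beta> K K' u g"
  shows "has_gradient u g" "\<bar>u w\<bar> \<le> K * exp (\<beta> * l1 w)" "norm (g w) \<le> K' * exp (\<beta> * l1 w)"
  using assms by (auto simp: expbd_def)

lemma expbd_mono:
  assumes "expbd \<beta> K K' u g" "K \<le> L" "K' \<le> L'"
  shows "expbd \<beta> L L' u g"
proof -
  have "K * exp x \<le> L * exp x" "K' * exp x \<le> L' * exp x" for x
    using assms by (auto intro: mult_right_mono)
  then show ?thesis
    using assms(1) unfolding expbd_def by (meson order_trans)
qed

lemma expbd_zero: "0 \<le> K \<Longrightarrow> 0 \<le> K' \<Longrightarrow> expbd \<beta> K K' (\<lambda>_. 0) (\<lambda>_. 0)"
  by (auto simp: expbd_def has_gradient_const)

lemma expbd_const: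
  assumes "0 \<le> \<beta>" "\<bar>c\<bar> \<le> K" "0 \<le> K'"
  shows "expbd \<beta> K K' (\<lambda>_. c) (\<lambda>_. 0)"
proof -
  have "K * 1 \<le> K * exp (\<beta> * l1 w)" for w :: "real^'a"
    using assms by (intro mult_left_mono) (auto simp: l1_nonneg)
  then show ?thesis
    using assms by (auto simp: expbd_def has_gradient_const intro: order_trans)
qed

lemma expbd_add:
  assumes "expbd \<beta> K K' u g" "expbd \<beta> L L' v h"
  shows "expbd \<beta> (K + L) (K' + L') (\<lambda>x. u x + v x) (\<lambda>x. g x + h x)"
  unfolding expbd_def
proof (intro conjI allI)
  show "has_gradient (\<lambda>x. u x + v x) (\<lambda>x. g x + h x)"
    using assms by (intro has_gradient_add) (auto dest: expbdD)
  fix w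
  show "\<bar>u w + v w\<bar> \<le> (K + L) * exp (\<beta> * l1 w)"
    using expbdD(2)[OF assms(1), of w] expbdD(2)[OF assms(2), of w]
    by (simp add: distrib_right)
  show "norm (g w + h w) \<le> (K' + L') * exp (\<beta> * l1 w)"
    using expbdD(3)[OF assms(1), of w] expbdD(3)[OF assms(2), of w]
    by (auto simp: distrib_right intro: norm_triangle_le)
qed

lemma expbd_sum:
  assumes "\<And>i. i \<in> I \<Longrightarrow> expbd \<beta> (K i) (K' i) (u i) (g i)"
  shows "expbd \<beta> (\<Sum>i\<in>I. K i) (\<Sum>i\<in>I. K' i) (\<lambda>x. \<Sum>i\<in>I. u i x) (\<lambda>x. \<Sum>i\<in>I. g i x)"
  using assms
  by (induction I rule: infinite_finite_induct) (auto intro!: expbd_zero expbd_add)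

lemma expbd_cmult:
  assumes "expbd \<beta> K K' u g" "0 \<le> c"
  shows "expbd \<beta> (c * K) (c * K') (\<lambda>x. c * u x) (\<lambda>x. c *\<^sub>R g x)"
  using assms unfolding expbd_def
  by (auto intro!: has_gradient_cmult mult_left_mono simp: abs_mult mult.assoc)

lemma expbd_mult_bounded:
  assumes u: "expbd \<beta> K K' u g" and v: "has_gradient v h"
    and bv: "\<And>x. \<bar>v x\<bar> \<le> a" "\<And>x. norm (h x) \<le> b"
  shows "expbd \<beta> (a * K) (a * K' + b * K) (\<lambda>x. v x * u x) (\<lambda>x. v x *\<^sub>R g x + u x *\<^sub>R h x)"
  unfolding expbd_def
proof (intro conjI allI)
  show "has_gradient (\<lambda>x. v x * u x) (\<lambda>x. v x *\<^sub>R g x + u x *\<^sub>R h x)"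
    by (rule has_gradient_mult[OF v expbdD(1)[OF u]])
  fix w
  have a: "0 \<le> a" "0 \<le> b" using bv[of w] norm_ge_zero[of "h w"] by linarith+
  show "\<bar>v w * u w\<bar> \<le> a * K * exp (\<beta> * l1 w)"
    unfolding abs_mult mult.assoc
    by (intro mult_mono) (use a bv expbdD(2)[OF u] in auto)
  have "norm (v w *\<^sub>R g w) \<le> a * (K' * exp (\<beta> * l1 w))"
    unfolding norm_scaleR by (intro mult_mono) (use a bv expbdD(3)[OF u] in auto)
  moreover have "norm (u w *\<^sub>R h w) \<le> (K * exp (\<beta> * l1 w)) * b"
    unfolding norm_scaleR
    by (intro mult_mono) (use a bv expbdD(2)[OF u, of w] in auto)
  ultimately show "norm (v w *\<^sub>R g w + u w *\<^sub>R h w) \<le> (a * K' + b * K) * exp (\<beta> * l1 w)"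
    by (intro norm_triangle_le) (auto simp: algebra_simps)
qed

text \<open>Motion along the \<open>i\<close>-th axis, written as a scaling: \<tau> = 1 fixes the
  point and \<tau> = 0 projects it onto the hyperplane \<open>w $ i = 0\<close>. The unit interval
  thus parametrises the segment in between, whatever the sign of \<open>w $ i\<close>.\<close>

definition scale_coord :: "'n \<Rightarrow> real \<Rightarrow> real ^ 'n \<Rightarrow> real ^ 'n" where
  "scale_coord i \<tau> w = (\<chi> k. if k = i then \<tau> * w $ k else w $ k)"

lemma scale_coord_eq: "scale_coord i \<tau> w = w + ((\<tau> - 1) * w $ i) *\<^sub>R axis i 1"
  by (auto simp: scale_coord_def vec_eq_iff axis_def algebra_simps)

lemma scale_coord_inner: "scale_coord i \<tau> v \<bullet> w = v \<bullet> scale_coord i \<tau> w"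
  by (auto simp: scale_coord_eq inner_add_left inner_add_right inner_axis inner_axis')

lemma norm_scale_coord:
  assumes "0 \<le> \<tau>" "\<tau> \<le> 1"
  shows "norm (scale_coord i \<tau> (w :: real ^ 'n::finite)) \<le> norm w"
  unfolding norm_vec_def
proof (rule L2_set_mono)
  fix k
  have "\<tau> * \<bar>w $ k\<bar> \<le> 1 * \<bar>w $ k\<bar>" using assms by (intro mult_right_mono) auto
  then show "norm (scale_coord i \<tau> w $ k) \<le> norm (w $ k)"
    using assms by (auto simp: scale_coord_def abs_mult)
qed auto

lemma l1_scale_coord:
  assumes "0 \<le> \<tau>"
  shows "l1 (scale_coord i \<tau> (w :: real ^ 'n::finite)) = l1 w - \<bar>w $ i\<bar> + \<tau> * \<bar>w $ i\<bar>"
proof -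
  have "l1 w = \<bar>w $ i\<bar> + (\<Sum>k\<in>UNIV - {i}. \<bar>w $ k\<bar>)"
    unfolding l1_def by (rule sum.remove) auto
  moreover have "l1 (scale_coord i \<tau> w) = \<tau> * \<bar>w $ i\<bar> + (\<Sum>k\<in>UNIV - {i}. \<bar>w $ k\<bar>)"
    unfolding l1_def using assms
    by (subst sum.remove[of _ i]) (auto simp: scale_coord_def abs_mult)
  ultimately show ?thesis by simp
qed

lemma continuous_scale_coord [continuous_intros]:
  assumes "continuous_on S a" "continuous_on S f"
  shows "continuous_on S (\<lambda>x. scale_coord i (a x) (f x))"
  unfolding scale_coord_eq by (intro continuous_intros assms)

lemma has_gradient_scale_coord:
  assumes "has_gradient u g"
  shows "has_gradient (\<lambda>w. u (scale_coord i \<tau> w)) (\<lambda>w. scale_coord i \<tau> (g (scale_coord i \<tau> (w :: real ^ 'n::finite))))"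
proof -
  note 1 = has_gradientD[OF assms]
  have lin: "bounded_linear (scale_coord i \<tau> :: real ^ 'n \<Rightarrow> _)"
    unfolding scale_coord_eq[abs_def]
    by (intro bounded_linear_intros bounded_linear_vec_nth)
  have "((\<lambda>w. u (scale_coord i \<tau> w)) has_derivative
        (\<lambda>h. scale_coord i \<tau> (g (scale_coord i \<tau> w)) \<bullet> h)) (at w)" for w
    unfolding scale_coord_inner
    by (rule has_derivative_compose[OF bounded_linear_imp_has_derivative[OF lin] 1(1)])
  moreover have "continuous_on UNIV (\<lambda>w. scale_coord i \<tau> (g (scale_coord i \<tau> w)))"
    by (intro continuous_intros continuous_on_compose2[OF 1(2)]) auto
  ultimately show ?thesis
    by (simp add: has_gradient_def)
qed

text \<open>The projection increases neither \<open>l1\<close> nor the norm of the gradient, so the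
  constants survive, but nothing is gained.\<close>

lemma expbd_reset:
  assumes "expbd \<beta> K K' u g" "0 \<le> \<beta>"
  shows "expbd \<beta> K K' (\<lambda>w. u (scale_coord i 0 w)) (\<lambda>w. scale_coord i 0 (g (scale_coord i 0 w)))"
  unfolding expbd_def
proof (intro conjI allI)
  show "has_gradient (\<lambda>w. u (scale_coord i 0 w)) (\<lambda>w. scale_coord i 0 (g (scale_coord i 0 w)))"
    by (rule has_gradient_scale_coord[OF expbdD(1)[OF assms(1)]])
  fix w
  have l: "\<beta> * l1 (scale_coord i 0 w) \<le> \<beta> * l1 w"
    using assms(2) by (intro mult_left_mono) (auto simp: l1_scale_coord)
  \<comment> \<open>At the origin \<open>l1\<close> vanishes, so the two bounds there say that the
    constants are nonnegative.\<close>
  have K: "0 \<le> K" "0 \<le> K'"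
    using expbdD(2)[OF assms(1), of 0] expbdD(3)[OF assms(1), of 0]
      norm_ge_zero[of "g 0"] abs_ge_zero[of "u 0"] by (simp_all add: l1_def del: norm_ge_zero abs_ge_zero)
  show "\<bar>u (scale_coord i 0 w)\<bar> \<le> K * exp (\<beta> * l1 w)"
    by (rule order_trans[OF expbdD(2)[OF assms(1)]]) (use l K in \<open>auto intro: mult_left_mono\<close>)
  have "norm (scale_coord i 0 (g (scale_coord i 0 w))) \<le> norm (g (scale_coord i 0 w))"
    by (rule norm_scale_coord) auto
  also have "\<dots> \<le> K' * exp (\<beta> * l1 w)"
    by (rule order_trans[OF expbdD(3)[OF assms(1)]]) (use l K in \<open>auto intro: mult_left_mono\<close>)
  finally show "norm (scale_coord i 0 (g (scale_coord i 0 w))) \<le> K' * exp (\<beta> * l1 w)" .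
qed

definition unit_lebesgue :: "real measure" where
  "unit_lebesgue = restrict_space lborel {0..1}"

lemma space_unit_lebesgue [simp]: "space unit_lebesgue = {0..1}"
  by (simp add: unit_lebesgue_def space_restrict_space)

lemma finite_unit_lebesgue: "finite_measure unit_lebesgue"
  unfolding unit_lebesgue_def
  by (rule finite_measureI) (simp add: space_restrict_space emeasure_restrict_space)

lemma measurable_unit_lebesgue:
  fixes f :: "real \<Rightarrow> 'a::topological_space"
  assumes "continuous_on UNIV f"
  shows "f \<in> borel_measurable unit_lebesgue"
  unfolding unit_lebesgue_def
  using borel_measurable_continuous_onI[OF assms] by (intro measurable_restrict_space1) auto

lemma integrable_unit_lebesgue:
  fixes f :: "real \<Rightarrow> 'a::{banach,second_countable_topology}"
  assumes "continuous_on UNIV f"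
  shows "integrable unit_lebesgue f"
proof -
  interpret finite_measure unit_lebesgue by (rule finite_unit_lebesgue)
  have "compact (f ` {0..1})"
    using assms by (intro compact_continuous_image) (auto intro: continuous_on_subset)
  then obtain B where "\<forall>x\<in>f ` {0..1}. norm x \<le> B"
    by (meson bounded_iff compact_imp_bounded)
  then show ?thesis
    by (intro integrable_const_bound[of _ B] measurable_unit_lebesgue assms) (auto intro!: AE_I2)
qed

lemma measure_unit_lebesgue: "measure unit_lebesgue {0..1} = 1"
  by (simp add: unit_lebesgue_def measure_restrict_space)

lemma integral_unit_lebesgue_le:
  fixes f :: "real \<Rightarrow> 'a::{banach,second_countable_topology}"
  assumes f: "continuous_on UNIV f" and h: "continuous_on UNIV h"
    and le: "\<And>\<tau>. 0 \<le> \<tau> \<Longrightarrow> \<tau> \<le> 1 \<Longrightarrow> norm (f \<tau>) \<le> h \<tau>"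
  shows "norm (\<integral>\<tau>. f \<tau> \<partial>unit_lebesgue) \<le> (\<integral>\<tau>. h \<tau> \<partial>unit_lebesgue)"
  by (rule order_trans[OF integral_norm_bound])
     (use assms in \<open>auto intro!: integral_mono integrable_unit_lebesgue continuous_intros\<close>)

text \<open>The source of the gain \<open>1 / \<beta>\<close>: an exponential is its own
  antiderivative up to the rate.\<close>

lemma integral_exp_unit_lebesgue:
  assumes "0 < c"
  shows "c * (\<integral>\<tau>. exp (\<tau> * c) \<partial>unit_lebesgue) \<le> exp c"
proof -
  have "(\<integral>\<tau>. indicator {0..1} \<tau> *\<^sub>R (c * exp (\<tau> * c)) \<partial>lborel) = exp (1 * c) - exp (0 * c)"
    by (rule integral_FTC_Icc)
       (auto intro!: derivative_eq_intros continuous_intros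
         simp: has_real_derivative_iff_has_vector_derivative[symmetric])
  then have "(\<integral>\<tau>. c * exp (\<tau> * c) \<partial>unit_lebesgue) = exp c - 1"
    unfolding unit_lebesgue_def by (subst integral_restrict_space) auto
  then show ?thesis by simp
qed

text \<open>After the substitution \<open>s = \<tau> * w $ i\<close> this is the integral of
  \<open>u\<close> along the \<open>i\<close>-th axis from the hyperplane \<open>w $ i = 0\<close>
  to \<open>w\<close>. In this form the range of integration is fixed, so that differentiation under
  the integral sign applies in all coordinates at once.\<close>

definition ray_integral :: "'n \<Rightarrow> (real ^ 'n \<Rightarrow> real) \<Rightarrow> real ^ 'n \<Rightarrow> real" where
  "ray_integral i u w = w $ i * (\<integral>\<tau>. u (scale_coord i \<tau> w) \<partial>unit_lebesgue)"

text \<open>The product rule: first the derivative of the integrand, then that of the factor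
  \<open>w $ i\<close>.\<close>

definition ray_gradient ::
    "'n \<Rightarrow> (real ^ 'n \<Rightarrow> real) \<Rightarrow> (real ^ 'n \<Rightarrow> real ^ 'n) \<Rightarrow> real ^ 'n \<Rightarrow> real ^ 'n::finite" where
  "ray_gradient i u g w = w $ i *\<^sub>R (\<integral>\<tau>. scale_coord i \<tau> (g (scale_coord i \<tau> w)) \<partial>unit_lebesgue)
     + (\<integral>\<tau>. u (scale_coord i \<tau> w) \<partial>unit_lebesgue) *\<^sub>R axis i 1"

lemma continuous_on_bounded_cball:
  fixes u :: "'a::euclidean_space \<Rightarrow> 'b::real_normed_vector"
  assumes "continuous_on UNIV u"
  shows "\<exists>C\<ge>0. \<forall>x. norm x \<le> R \<longrightarrow> norm (u x) \<le> C"
proof -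
  have "compact (u ` cball 0 R)"
    using assms by (intro compact_continuous_image) (auto intro: continuous_on_subset)
  then obtain B where "\<forall>x\<in>u ` cball 0 R. norm x \<le> B"
    by (meson bounded_iff compact_imp_bounded)
  then show ?thesis by (intro exI[of _ "max 0 B"]) (auto simp: le_max_iff_disj)
qed

lemma has_gradient_ray_integral:
  assumes u: "has_gradient u g"
  shows "has_gradient (ray_integral i u) (ray_gradient i u (g :: real ^ 'n \<Rightarrow> real ^ 'n::finite))"
proof -
  note 1 = has_gradientD[OF u]
  have "has_gradient (\<lambda>w. \<integral>\<tau>. u (scale_coord i \<tau> w) \<partial>unit_lebesgue)
      (\<lambda>w. \<integral>\<tau>. scale_coord i \<tau> (g (scale_coord i \<tau> w)) \<partial>unit_lebesgue)"
  proof (rule has_gradient_integral[where S = "{0..1}"])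
    show "AE \<tau> in unit_lebesgue. \<tau> \<in> {0..1}" by (rule AE_I2) simp
    fix R
    obtain C where C: "\<And>x. norm x \<le> R \<Longrightarrow> norm (u x) \<le> C" "C \<ge> 0"
      using continuous_on_bounded_cball[OF 1(3)] by blast
    obtain C' where C': "\<And>x. norm x \<le> R \<Longrightarrow> norm (g x) \<le> C'" "C' \<ge> 0"
      using continuous_on_bounded_cball[OF 1(2)] by blast
    \<comment> \<open>Scaling one coordinate down does not leave a ball about the origin, so
      continuity supplies the bounds.\<close>
    have R: "norm (scale_coord i \<tau> x) \<le> R" if "norm x \<le> R" "\<tau> \<in> {0..1}" for \<tau> and x :: "real^'n"
      using that norm_scale_coord[of \<tau> i x] by auto
    have "\<bar>u (scale_coord i \<tau> x)\<bar> \<le> C + C' \<and> norm (scale_coord i \<tau> (g (scale_coord i \<tau> x))) \<le> C + C'"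
      if x: "norm x \<le> R" "\<tau> \<in> {0..1}" for x \<tau>
    proof -
      have "norm (scale_coord i \<tau> (g (scale_coord i \<tau> x))) \<le> norm (g (scale_coord i \<tau> x))"
        using x by (intro norm_scale_coord) auto
      then show ?thesis
        using C(1)[OF R[OF x]] C'(1)[OF R[OF x]] C(2) C'(2) by simp
    qed
    then show "\<exists>C. \<forall>x \<tau>. norm x \<le> R \<longrightarrow> \<tau> \<in> {0..1} \<longrightarrow> \<bar>u (scale_coord i \<tau> x)\<bar> \<le> C \<and>
        norm (scale_coord i \<tau> (g (scale_coord i \<tau> x))) \<le> C"
      by blast
  next
    fix w
    show "(\<lambda>\<tau>. u (scale_coord i \<tau> w)) \<in> borel_measurable unit_lebesgue"
      by (intro measurable_unit_lebesgue continuous_on_compose2[OF 1(3)] continuous_intros) auto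
    show "(\<lambda>\<tau>. scale_coord i \<tau> (g (scale_coord i \<tau> w))) \<in> borel_measurable unit_lebesgue"
      by (intro measurable_unit_lebesgue continuous_intros continuous_on_compose2[OF 1(2)]) auto
  qed (intro finite_unit_lebesgue has_gradient_scale_coord[OF u])+
  moreover have "has_gradient (\<lambda>w :: real ^ 'n. w $ i) (\<lambda>_. axis i 1)"
    unfolding has_gradient_def
    by (intro conjI allI continuous_intros
        has_derivative_eq_rhs[OF bounded_linear_imp_has_derivative[OF bounded_linear_vec_nth[of i]]])
       (simp add: fun_eq_iff inner_axis')
  ultimately show ?thesis
    unfolding ray_integral_def[abs_def] ray_gradient_def[abs_def]
    by (intro has_gradient_mult)
qed

text \<open>The values gain a factor \<open>1 / \<beta>\<close>. In the gradient only the
  differentiated integrand gains it; the derivative of the factor \<open>w $ i\<close> leaves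
  \<open>u\<close> at its full size \<open>K\<close>.\<close>

lemma expbd_ray_integral:
  assumes u: "expbd \<beta> K K' u (g :: real ^ 'n \<Rightarrow> real ^ 'n::finite)" and \<beta>: "0 < \<beta>"
  shows "expbd \<beta> (K / \<beta>) (K' / \<beta> + K) (ray_integral i u) (ray_gradient i u g)"
  unfolding expbd_def
proof (intro conjI allI)
  note 1 = has_gradientD[OF expbdD(1)[OF u]]
  show "has_gradient (ray_integral i u) (ray_gradient i u g)"
    by (rule has_gradient_ray_integral[OF expbdD(1)[OF u]])
  fix w :: "real ^ 'n"
  have K: "0 \<le> K" "0 \<le> K'"
    using expbdD(2)[OF u, of 0] expbdD(3)[OF u, of 0]
      norm_ge_zero[of "g 0"] abs_ge_zero[of "u 0"] by (simp_all add: l1_def del: norm_ge_zero abs_ge_zero)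
  \<comment> \<open>Along the segment only the share of the \<open>i\<close>-th coordinate in
    \<open>l1\<close> varies; the rest of the exponential factors out.\<close>
  have E: "\<bar>w $ i\<bar> * (\<integral>\<tau>. L * exp (\<beta> * l1 (scale_coord i \<tau> w)) \<partial>unit_lebesgue) \<le> L / \<beta> * exp (\<beta> * l1 w)"
    if "0 \<le> L" for L
  proof (cases "w $ i = 0")
    case False
    define d where "d = \<beta> * \<bar>w $ i\<bar>"
    have d: "0 < d" using False \<beta> by (simp add: d_def)
    have "(\<integral>\<tau>. L * exp (\<beta> * l1 (scale_coord i \<tau> w)) \<partial>unit_lebesgue)
        = (\<integral>\<tau>. (L * exp (\<beta> * (l1 w - \<bar>w $ i\<bar>))) * exp (\<tau> * d) \<partial>unit_lebesgue)"
      by (intro Bochner_Integration.integral_cong)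
         (auto simp: l1_scale_coord d_def algebra_simps simp flip: exp_add)
    also have "\<dots> = (L * exp (\<beta> * (l1 w - \<bar>w $ i\<bar>))) * (\<integral>\<tau>. exp (\<tau> * d) \<partial>unit_lebesgue)"
      by simp
    also have "\<bar>w $ i\<bar> * \<dots> = (L / \<beta> * exp (\<beta> * (l1 w - \<bar>w $ i\<bar>))) * (d * (\<integral>\<tau>. exp (\<tau> * d) \<partial>unit_lebesgue))"
      using \<beta> by (simp add: d_def)
    also have "\<dots> \<le> (L / \<beta> * exp (\<beta> * (l1 w - \<bar>w $ i\<bar>))) * exp d"
      using that \<beta> by (intro mult_left_mono integral_exp_unit_lebesgue d) auto
    also have "\<dots> = L / \<beta> * exp (\<beta> * l1 w)"
      by (simp add: d_def algebra_simps flip: exp_add)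
    finally show ?thesis .
  qed (use \<beta> that in auto)
  have cl: "continuous_on UNIV (\<lambda>\<tau>. L * exp (\<beta> * l1 (scale_coord i \<tau> w)))" for L
    unfolding l1_def by (intro continuous_intros)
  have cu: "continuous_on UNIV (\<lambda>\<tau>. u (scale_coord i \<tau> w))"
    "continuous_on UNIV (\<lambda>\<tau>. scale_coord i \<tau> (g (scale_coord i \<tau> w)))"
    by (intro continuous_intros continuous_on_compose2[OF 1(2)] continuous_on_compose2[OF 1(3)]; auto)+
  have "\<bar>ray_integral i u w\<bar> \<le> \<bar>w $ i\<bar> * (\<integral>\<tau>. K * exp (\<beta> * l1 (scale_coord i \<tau> w)) \<partial>unit_lebesgue)"
    unfolding ray_integral_def abs_mult
    by (intro mult_left_mono integral_unit_lebesgue_le[where 'a = real, simplified] cu cl expbdD[OF u]) auto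
  with E[OF K(1)] show "\<bar>ray_integral i u w\<bar> \<le> K / \<beta> * exp (\<beta> * l1 w)" by simp
  have "norm (w $ i *\<^sub>R (\<integral>\<tau>. scale_coord i \<tau> (g (scale_coord i \<tau> w)) \<partial>unit_lebesgue))
      \<le> \<bar>w $ i\<bar> * (\<integral>\<tau>. K' * exp (\<beta> * l1 (scale_coord i \<tau> w)) \<partial>unit_lebesgue)"
    unfolding norm_scaleR
    by (intro mult_left_mono integral_unit_lebesgue_le cu cl order_trans[OF norm_scale_coord] expbdD[OF u]) auto
  moreover have "\<bar>\<integral>\<tau>. u (scale_coord i \<tau> w) \<partial>unit_lebesgue\<bar> \<le> (\<integral>\<tau>. K * exp (\<beta> * l1 w) \<partial>unit_lebesgue)"
  proof (rule integral_unit_lebesgue_le[where 'a = real, simplified])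
    fix \<tau> :: real assume \<tau>: "0 \<le> \<tau>" "\<tau> \<le> 1"
    have "\<tau> * \<bar>w $ i\<bar> \<le> 1 * \<bar>w $ i\<bar>" using \<tau> by (intro mult_right_mono) auto
    then have "\<beta> * l1 (scale_coord i \<tau> w) \<le> \<beta> * l1 w"
      using \<beta> \<tau> by (intro mult_left_mono) (auto simp: l1_scale_coord)
    then show "\<bar>u (scale_coord i \<tau> w)\<bar> \<le> K * exp (\<beta> * l1 w)"
      by (intro order_trans[OF expbdD(2)[OF u]] mult_left_mono K) auto
  qed (use cu in auto)
  ultimately show "norm (ray_gradient i u g w) \<le> (K' / \<beta> + K) * exp (\<beta> * l1 w)"
    using E[OF K(2)] unfolding ray_gradient_def
    by (intro norm_triangle_le) (simp add: measure_unit_lebesgue distrib_right)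
qed

text \<open>The two summands of the \<open>i\<close>-th component combine to the derivative of
  \<open>\<tau> * u (scale_coord i \<tau> w)\<close>, and the fundamental theorem evaluates it
  between 0 and 1. This identity is what later becomes the differential equation in direction
  \<open>i\<close>.\<close>

lemma ray_gradient_nth:
  assumes u: "has_gradient u (g :: real ^ 'n \<Rightarrow> real ^ 'n::finite)"
  shows "ray_gradient i u g w $ i = u w"
proof -
  note 1 = has_gradientD[OF u]
  let ?f = "\<lambda>\<tau>. \<tau> * u (scale_coord i \<tau> w)"
  let ?f' = "\<lambda>\<tau>. \<tau> * (g (scale_coord i \<tau> w) \<bullet> (w $ i *\<^sub>R axis i 1)) + u (scale_coord i \<tau> w)"
  have cu: "continuous_on UNIV (\<lambda>\<tau>. u (scale_coord i \<tau> w))"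
    "continuous_on UNIV (\<lambda>\<tau>. g (scale_coord i \<tau> w))"
    by (intro continuous_intros continuous_on_compose2[OF 1(2)] continuous_on_compose2[OF 1(3)]; auto)+
  have cf: "continuous_on UNIV ?f'"
    using cu by (intro continuous_intros)
  have du: "((\<lambda>\<tau>. u (scale_coord i \<tau> w)) has_real_derivative (g (scale_coord i \<tau> w) \<bullet> (w $ i *\<^sub>R axis i 1))) (at \<tau>)" for \<tau>
  proof -
    have "((\<lambda>\<tau>. scale_coord i \<tau> w) has_derivative (\<lambda>h. h *\<^sub>R (w $ i *\<^sub>R axis i 1))) (at \<tau>)"
      unfolding scale_coord_eq by (auto intro!: derivative_eq_intros)
    from has_derivative_compose[OF this 1(1)] show ?thesis
      unfolding has_field_derivative_def by (rule has_derivative_eq_rhs) (auto simp: fun_eq_iff)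
  qed
  have "(?f has_real_derivative ?f' \<tau>) (at \<tau>)" for \<tau>
    by (rule DERIV_cong[OF DERIV_mult[OF DERIV_ident du]]) simp
  then have "(\<integral>\<tau>. indicator {0..1} \<tau> *\<^sub>R ?f' \<tau> \<partial>lborel) = ?f 1 - ?f 0"
    by (intro integral_FTC_Icc continuous_on_subset[OF cf])
       (simp_all add: has_real_derivative_iff_has_vector_derivative has_vector_derivative_at_within)
  then have "(\<integral>\<tau>. ?f' \<tau> \<partial>unit_lebesgue) = u w"
    unfolding unit_lebesgue_def by (subst integral_restrict_space) (auto simp: scale_coord_eq)
  moreover have "ray_gradient i u g w $ i = (\<integral>\<tau>. ?f' \<tau> \<partial>unit_lebesgue)"
  proof -
    have "(\<integral>\<tau>. scale_coord i \<tau> (g (scale_coord i \<tau> w)) \<partial>unit_lebesgue) $ i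
        = (\<integral>\<tau>. scale_coord i \<tau> (g (scale_coord i \<tau> w)) $ i \<partial>unit_lebesgue)"
      by (rule integral_bounded_linear[OF bounded_linear_vec_nth, symmetric])
         (intro integrable_unit_lebesgue continuous_intros cu)
    also have "w $ i * \<dots> = (\<integral>\<tau>. \<tau> * (g (scale_coord i \<tau> w) \<bullet> (w $ i *\<^sub>R axis i 1)) \<partial>unit_lebesgue)"
      by (subst integral_mult_right_zero[symmetric])
         (auto simp: scale_coord_def inner_axis algebra_simps intro!: Bochner_Integration.integral_cong)
    finally show ?thesis
      unfolding ray_gradient_def
      by (subst Bochner_Integration.integral_add)
         (auto intro!: integrable_unit_lebesgue continuous_intros cu simp: axis_def)
  qed
  ultimately show ?thesis by simp
qed

section \<open>Occupation densities\<close>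

lemma has_gradient_unique:
  assumes "has_gradient u g" "has_gradient u g'"
  shows "g = g'"
proof
  fix x
  have "(\<lambda>h. g x \<bullet> h) = (\<lambda>h. g' x \<bullet> h)"
    using has_derivative_unique[OF has_gradientD(1)[OF assms(1)] has_gradientD(1)[OF assms(2)]] .
  then show "g x = g' x"
    by (metis inner_commute vector_eq_ldot)
qed

text \<open>This extension of \<open>1 / (1 + \<Sum>k w\<^sub>k)\<close> from the orthant is bounded and \<open>C\<^sup>1\<close> everywhere.\<close>

definition hazard :: "real ^ 'n::finite \<Rightarrow> real" where
  "hazard w = 1 - (\<Sum>k\<in>UNIV. w $ k) / (1 + \<bar>\<Sum>k\<in>UNIV. w $ k\<bar>)"

definition hazard_gradient :: "real ^ 'n::finite \<Rightarrow> real ^ 'n" where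
  "hazard_gradient w = (- 1 / (1 + \<bar>\<Sum>k\<in>UNIV. w $ k\<bar>)\<^sup>2) *\<^sub>R (\<chi> k. 1)"

lemma hazard_eq:
  assumes "\<And>k. 0 \<le> w $ k"
  shows "hazard w = 1 / (1 + (\<Sum>k\<in>UNIV. w $ k))"
proof -
  have "0 \<le> (\<Sum>k\<in>UNIV. w $ k)" using assms by (intro sum_nonneg)
  then show ?thesis by (simp add: hazard_def field_simps)
qed

lemma hazard_bounds: "0 \<le> hazard w" "hazard w \<le> 2"
  by (auto simp: hazard_def field_simps)

text \<open>The kink of the modulus at 0 is multiplied by \<open>s\<close> and disappears; elsewhere
  the sign of \<open>s\<close> is locally constant.\<close>

lemma hazard_real_deriv:
  "((\<lambda>s::real. 1 - s / (1 + \<bar>s\<bar>)) has_real_derivative - 1 / (1 + \<bar>s\<bar>)\<^sup>2) (at s)"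
proof -
  consider "s = 0" | "s > 0" | "s < 0" by linarith
  then show ?thesis
  proof cases
    case 1
    have "(\<lambda>h. 1 / (1 + \<bar>h\<bar>)) \<midarrow>0\<rightarrow> (1 / (1 + \<bar>0::real\<bar>))"
      by (intro tendsto_intros) auto
    moreover have "(\<lambda>h::real. (0 + h) / (1 + \<bar>0 + h\<bar>) / h) \<midarrow>0\<rightarrow> 1 \<longleftrightarrow>
        (\<lambda>h::real. 1 / (1 + \<bar>h\<bar>)) \<midarrow>0\<rightarrow> 1"
      by (rule LIM_equal) simp
    ultimately have "(\<lambda>h::real. (0 + h) / (1 + \<bar>0 + h\<bar>) / h) \<midarrow>0\<rightarrow> 1"
      by simp
    then have "((\<lambda>s::real. s / (1 + \<bar>s\<bar>)) has_real_derivative 1) (at 0)"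
      by (simp add: DERIV_def)
    from DERIV_diff[OF DERIV_const this] 1 show ?thesis by simp
  next
    case 2
    have "((\<lambda>s::real. 1 - s / (1 + s)) has_real_derivative - 1 / (1 + \<bar>s\<bar>)\<^sup>2) (at s)"
      using 2 by (auto intro!: derivative_eq_intros simp: field_simps power2_eq_square)
    then show ?thesis
      by (rule DERIV_cong_ev[THEN iffD1, rotated -1])
         (use 2 eventually_nhds_in_open[of "{0<..}" s] in \<open>auto elim!: eventually_mono\<close>)
  next
    case 3
    have "((\<lambda>s::real. 1 - s / (1 - s)) has_real_derivative - 1 / (1 + \<bar>s\<bar>)\<^sup>2) (at s)"
      using 3 by (auto intro!: derivative_eq_intros simp: field_simps power2_eq_square)
    then show ?thesis
      by (rule DERIV_cong_ev[THEN iffD1, rotated -1])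
         (use 3 eventually_nhds_in_open[of "{..<0}" s] in \<open>auto elim!: eventually_mono\<close>)
  qed
qed

lemma has_gradient_hazard: "has_gradient hazard (hazard_gradient :: real ^ 'n::finite \<Rightarrow> _)"
  unfolding has_gradient_def
proof (intro conjI allI)
  fix w :: "real ^ 'n"
  have "((\<lambda>w :: real ^ 'n. \<Sum>k\<in>UNIV. w $ k) has_derivative (\<lambda>h. \<Sum>k\<in>UNIV. h $ k)) (at w)"
    by (intro has_derivative_sum bounded_linear_imp_has_derivative bounded_linear_vec_nth)
  from has_derivative_compose[OF this hazard_real_deriv[unfolded has_field_derivative_def]]
  show "(hazard has_derivative (\<lambda>h. hazard_gradient w \<bullet> h)) (at w)"
    unfolding hazard_def[abs_def]
    by (rule has_derivative_eq_rhs)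
       (auto simp: fun_eq_iff hazard_gradient_def inner_vec_def sum_distrib_left sum_negf)
  show "continuous_on UNIV (hazard_gradient :: real ^ 'n \<Rightarrow> _)"
    unfolding hazard_gradient_def[abs_def]
    by (intro continuous_intros) (auto simp: add_nonneg_eq_0_iff)
qed

lemma norm_hazard_gradient: "norm (hazard_gradient (w :: real ^ 'n::finite)) \<le> real CARD('n)"
proof -
  have "norm (hazard_gradient w) \<le> (\<Sum>k\<in>UNIV. \<bar>hazard_gradient w $ k\<bar>)"
    by (rule norm_le_l1_cart)
  also have "\<dots> \<le> (\<Sum>k\<in>(UNIV::'n set). 1)"
    by (intro sum_mono) (auto simp: hazard_gradient_def divide_simps)
  finally show ?thesis by simp
qed

text \<open>The rate at which mass enters state \<open>i\<close>. The starting point lies on the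
  simplex and has total weight 1, so for \<open>w\<close> in the orthant \<open>hazard w\<close> is
  the reciprocal of the total weight reached.\<close>

definition jump_source ::
    "('n \<Rightarrow> 'n \<Rightarrow> real) \<Rightarrow> ('n \<Rightarrow> real ^ 'n \<Rightarrow> real) \<Rightarrow> 'n \<Rightarrow> real ^ 'n::finite \<Rightarrow> real" where
  "jump_source B v i w = hazard w * (\<Sum>k\<in>UNIV. B k i * v k w)"

text \<open>With respect to Lebesgue measure on the face spanned by \<open>A\<close>, the density of
  the occupation vector \<open>w\<close> after \<open>n\<close> jumps from \<open>j\<close>, with
  present state \<open>i\<close> and set \<open>A\<close> of visited states; the final weight is
  integrated over as well. Jumps from a state to itself, which the diagonal of \<open>B\<close>
  allows, are counted. If the last jump returns to a visited state, the time spent there before is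
  unknown and is integrated over along the ray; if it enters a new state, that time was 0 and the
  whole of \<open>w $ i\<close> is the last stay. No survival factors occur: in the application they
  are absorbed in the power of the total weight in \<open>cone_integral\<close>.\<close>

fun occupation_density ::
    "('n \<Rightarrow> 'n \<Rightarrow> real) \<Rightarrow> 'n \<Rightarrow> nat \<Rightarrow> 'n set \<Rightarrow> 'n \<Rightarrow> real ^ 'n::finite \<Rightarrow> real" where
  "occupation_density B j 0 A i w = (if A = {j} \<and> i = j then 1 else 0)"
| "occupation_density B j (Suc n) A i w =
     (if i \<in> A
      then ray_integral i (jump_source B (occupation_density B j n A) i) w
           + jump_source B (occupation_density B j n (A - {i})) i (scale_coord i 0 w)
      else 0)"

lemma scale_coord_nonneg:
  "0 \<le> \<tau> \<Longrightarrow> (\<And>k. 0 \<le> w $ k) \<Longrightarrow> 0 \<le> scale_coord i \<tau> w $ k"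
  by (simp add: scale_coord_def)

lemma ray_integral_nonneg:
  assumes "\<And>w. (\<And>k. 0 \<le> w $ k) \<Longrightarrow> 0 \<le> u w" "\<And>k. 0 \<le> w $ k"
  shows "0 \<le> ray_integral i u w"
  unfolding ray_integral_def
  by (intro mult_nonneg_nonneg Bochner_Integration.integral_nonneg assms scale_coord_nonneg) auto

lemma jump_source_nonneg:
  assumes "\<And>k i. 0 \<le> B k i" "\<And>k. 0 \<le> v k w"
  shows "0 \<le> jump_source B v i w"
  unfolding jump_source_def
  by (intro mult_nonneg_nonneg sum_nonneg hazard_bounds assms)

lemma occupation_density_nonneg:
  assumes B: "\<And>k i. 0 \<le> B k i" and w: "\<And>k. 0 \<le> w $ k"
  shows "0 \<le> occupation_density B j n A i w"
  using w
proof (induction n arbitrary: A i w)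
  case (Suc n)
  have src: "0 \<le> jump_source B (occupation_density B j n A) i w" if "\<And>k. 0 \<le> w $ k" for A i w
    by (intro jump_source_nonneg B Suc.IH that)
  show ?case
    using ray_integral_nonneg[OF src Suc.prems] src[OF scale_coord_nonneg[OF order_refl Suc.prems]]
    by simp
qed auto

text \<open>The 2 bounds \<open>hazard\<close>, which exceeds 1 where the coordinate sum is
  negative, and \<open>CARD('n)\<close> bounds its gradient.\<close>

lemma expbd_jump_source:
  fixes v :: "'n::finite \<Rightarrow> real ^ 'n \<Rightarrow> real"
  assumes B: "\<And>k i. 0 \<le> B k i" "\<And>i. (\<Sum>k\<in>UNIV. B k i) \<le> b"
    and v: "\<And>k. \<exists>g. expbd \<beta> K L (v k) g" and K: "0 \<le> K" "0 \<le> L"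
  shows "\<exists>g. expbd \<beta> (2 * b * K) (2 * b * L + real CARD('n) * b * K) (jump_source B v i) g"
proof -
  obtain g where g: "\<And>k. expbd \<beta> K L (v k) (g k)" using v by metis
  have "expbd \<beta> (\<Sum>k\<in>UNIV. B k i * K) (\<Sum>k\<in>UNIV. B k i * L)
      (\<lambda>w. \<Sum>k\<in>UNIV. B k i * v k w) (\<lambda>w. \<Sum>k\<in>UNIV. B k i *\<^sub>R g k w)"
    by (intro expbd_sum expbd_cmult g B)
  then have "expbd \<beta> (b * K) (b * L)
      (\<lambda>w. \<Sum>k\<in>UNIV. B k i * v k w) (\<lambda>w. \<Sum>k\<in>UNIV. B k i *\<^sub>R g k w)"
    by (rule expbd_mono) (simp_all flip: sum_distrib_right add: mult_right_mono B K)
  from expbd_mult_bounded[OF this has_gradient_hazard, of 2 "real CARD('n)"]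
  have "expbd \<beta> (2 * (b * K)) (2 * (b * L) + real CARD('n) * (b * K)) (jump_source B v i)
      (\<lambda>x. hazard x *\<^sub>R (\<Sum>k\<in>UNIV. B k i *\<^sub>R g k x) + (\<Sum>k\<in>UNIV. B k i * v k x) *\<^sub>R hazard_gradient x)"
    unfolding jump_source_def[abs_def]
    by (simp add: hazard_bounds norm_hazard_gradient abs_of_nonneg)
  then show ?thesis by (auto simp: mult.assoc)
qed

text \<open>
  Each jump gains a factor: an integration along a ray divides by \<open>\<beta>\<close>, and the visit of
  a new letter divides by \<open>\<kappa> = \<beta>\<close> since the bound contains the factor \<open>\<kappa> ^ card A\<close>.
\<close>

lemma expbd_occupation_density:
  fixes B :: "'n::finite \<Rightarrow> 'n \<Rightarrow> real"
  assumes B: "\<And>k i. 0 \<le> B k i" "\<And>i. (\<Sum>k\<in>UNIV. B k i) \<le> b" and b: "1 \<le> b"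
  shows "\<exists>g. expbd (8 * b) ((8 * b) ^ card A * (1 / 2) ^ n)
           ((8 * b + real CARD('n)) * (8 * b) ^ card A * (3 / 4) ^ n) (occupation_density B j n A i) g"
proof (induction n arbitrary: A i)
  case 0
  have "1 \<le> (8 * b) ^ card A" "0 \<le> (8 * b + real CARD('n)) * (8 * b) ^ card A"
    using b one_le_power[of "8 * b" "card A"] by auto
  then have "expbd (8 * b) ((8 * b) ^ card A) ((8 * b + real CARD('n)) * (8 * b) ^ card A)
      (\<lambda>w :: real ^ 'n. if A = {j} \<and> i = j then 1 else 0) (\<lambda>_. 0)"
    using b by (intro expbd_const) auto
  then show ?case
    unfolding occupation_density.simps power_0 mult_1_right by blast
next
  case (Suc n)
  \<comment> \<open>\<open>C\<close> is chosen so that the share of the values in the gradient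
    bound, \<open>16 * b + 2 * CARD('n)\<close>, equals \<open>2 * C\<close>. Together with the
    \<open>4 * C\<close> from the gradients it makes \<open>6 * C\<close>, against
    \<open>8 * C\<close> in the bound; this is the ratio 3 / 4.\<close>
  define C where "C = 8 * b + real CARD('n)"
  have C: "0 \<le> C" using b by (simp add: C_def)
  show ?case
  proof (cases "i \<in> A")
    case False
    then show ?thesis
      using b by (auto intro!: exI[of _ "\<lambda>_. 0"] expbd_zero)
  next
    case True
    define \<kappa> where "\<kappa> = (8 * b) ^ card (A - {i})"
    have cA: "(8 * b) ^ card A = 8 * b * \<kappa>"
      using True unfolding \<kappa>_def by (subst card.remove[of A i]) auto
    have \<kappa>: "0 < \<kappa>" using b by (simp add: \<kappa>_def)
    define p where "p = (1 / 2 :: real) ^ n"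
    define r where "r = (3 / 4 :: real) ^ n"
    have pr: "0 < p" "p \<le> r"
      unfolding p_def r_def by (auto intro!: power_mono)
    obtain g1 where g1: "expbd (8 * b) (2 * b * (8 * b * \<kappa> * p))
        (2 * b * (C * (8 * b * \<kappa>) * r) + real CARD('n) * b * (8 * b * \<kappa> * p))
        (jump_source B (occupation_density B j n A) i) g1"
    proof (rule exE)
      show "\<exists>g. expbd (8 * b) (2 * b * (8 * b * \<kappa> * p))
        (2 * b * (C * (8 * b * \<kappa>) * r) + real CARD('n) * b * (8 * b * \<kappa> * p))
        (jump_source B (occupation_density B j n A) i) g"
        by (rule expbd_jump_source[OF B Suc.IH[of A, unfolded cA p_def[symmetric] r_def[symmetric] C_def[symmetric]]])
           (use b \<kappa> pr C in auto)
    qed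
    obtain g2 where g2: "expbd (8 * b) (2 * b * (\<kappa> * p))
        (2 * b * (C * \<kappa> * r) + real CARD('n) * b * (\<kappa> * p))
        (jump_source B (occupation_density B j n (A - {i})) i) g2"
    proof (rule exE)
      show "\<exists>g. expbd (8 * b) (2 * b * (\<kappa> * p))
        (2 * b * (C * \<kappa> * r) + real CARD('n) * b * (\<kappa> * p))
        (jump_source B (occupation_density B j n (A - {i})) i) g"
        by (rule expbd_jump_source[OF B Suc.IH[of "A - {i}", folded \<kappa>_def p_def r_def C_def]])
           (use b \<kappa> pr C in auto)
    qed
    have b0: "0 < 8 * b" "0 \<le> 8 * b" using b by auto
    from expbd_add[OF expbd_ray_integral[OF g1 b0(1), of i] expbd_reset[OF g2 b0(2), of i]]
    have "\<exists>g. expbd (8 * b)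
       (2 * b * (8 * b * \<kappa> * p) / (8 * b) + 2 * b * (\<kappa> * p))
       ((2 * b * (C * (8 * b * \<kappa>) * r) + real CARD('n) * b * (8 * b * \<kappa> * p)) / (8 * b)
         + 2 * b * (8 * b * \<kappa> * p) + (2 * b * (C * \<kappa> * r) + real CARD('n) * b * (\<kappa> * p)))
       (occupation_density B j (Suc n) A i) g"
      using True unfolding occupation_density.simps by (simp only: if_True) blast
    then obtain g where g: "expbd (8 * b)
       (2 * b * (8 * b * \<kappa> * p) / (8 * b) + 2 * b * (\<kappa> * p))
       ((2 * b * (C * (8 * b * \<kappa>) * r) + real CARD('n) * b * (8 * b * \<kappa> * p)) / (8 * b)
         + 2 * b * (8 * b * \<kappa> * p) + (2 * b * (C * \<kappa> * r) + real CARD('n) * b * (\<kappa> * p)))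
       (occupation_density B j (Suc n) A i) g" ..
    show ?thesis
    proof (rule exI, rule expbd_mono[OF g])
      show "2 * b * (8 * b * \<kappa> * p) / (8 * b) + 2 * b * (\<kappa> * p) \<le> (8 * b) ^ card A * (1 / 2) ^ Suc n"
        using b unfolding cA power_Suc p_def[symmetric] by (simp add: field_simps)
      have "(2 * b * (C * (8 * b * \<kappa>) * r) + real CARD('n) * b * (8 * b * \<kappa> * p)) / (8 * b)
         + 2 * b * (8 * b * \<kappa> * p) + (2 * b * (C * \<kappa> * r) + real CARD('n) * b * (\<kappa> * p))
         = b * \<kappa> * (4 * C * r + (16 * b + 2 * real CARD('n)) * p)"
        using b by (simp add: field_simps)
      also have "\<dots> \<le> b * \<kappa> * (4 * C * r + (2 * C) * r)"
        using pr b \<kappa> C by (intro mult_left_mono add_left_mono mult_mono) (auto simp: C_def)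
      also have "\<dots> = C * (8 * b) ^ card A * (3 / 4) ^ Suc n"
        unfolding cA power_Suc r_def[symmetric] by (simp add: field_simps)
      finally show "(2 * b * (C * (8 * b * \<kappa>) * r) + real CARD('n) * b * (8 * b * \<kappa> * p)) / (8 * b)
         + 2 * b * (8 * b * \<kappa> * p) + (2 * b * (C * \<kappa> * r) + real CARD('n) * b * (\<kappa> * p))
         \<le> (8 * b + real CARD('n)) * (8 * b) ^ card A * (3 / 4) ^ Suc n"
        unfolding C_def .
    qed
  qed
qed

lemma has_gradient_occupation_density:
  fixes B :: "'n::finite \<Rightarrow> 'n \<Rightarrow> real"
  assumes B: "\<And>k i. 0 \<le> B k i"
  shows "\<exists>g. has_gradient (occupation_density B j n A i) g"
proof -
  \<comment> \<open>Any number that is at least 1 and dominates all column sums of \<open>B\<close>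
    would do.\<close>
  define b where "b = 1 + (\<Sum>i\<in>UNIV. \<Sum>k\<in>UNIV. B k i)"
  have b: "1 \<le> b" unfolding b_def using B by (auto intro!: sum_nonneg)
  have Bb: "(\<Sum>k\<in>UNIV. B k i) \<le> b" for i
    unfolding b_def using B
    by (auto intro!: sum_nonneg order_trans[OF member_le_sum[of i UNIV "\<lambda>i. \<Sum>k\<in>UNIV. B k i"]])
  have "\<exists>g. expbd (8 * b) ((8 * b) ^ card A * (1 / 2) ^ n)
     ((8 * b + real CARD('n)) * (8 * b) ^ card A * (3 / 4) ^ n) (occupation_density B j n A i) g"
    by (rule expbd_occupation_density) (fact B Bb b)+
  then show ?thesis unfolding expbd_def by blast
qed

text \<open>Only the visited set \<open>UNIV\<close> enters: for the others the occupation vector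
  lies on a proper face.\<close>

definition total_density :: "('n \<Rightarrow> 'n \<Rightarrow> real) \<Rightarrow> 'n \<Rightarrow> 'n \<Rightarrow> real ^ 'n::finite \<Rightarrow> real" where
  "total_density B j i w = (\<Sum>n. occupation_density B j n UNIV i w)"

text \<open>In the recursion the first summand has its source as derivative in direction
  \<open>i\<close>, and the second does not depend on \<open>w $ i\<close>. Hence that derivative of
  each term is the jump source of the preceding one, and the sum over the number of jumps reproduces
  itself. The geometric bounds with ratios 1 / 2 and 3 / 4 allow the termwise
  differentiation.\<close>

lemma total_density_gradient:
  fixes B :: "'n::finite \<Rightarrow> 'n \<Rightarrow> real"
  assumes B: "\<And>k i. 0 \<le> B k i"
  shows "summable (\<lambda>n. occupation_density B j n UNIV i w)"
    and "\<exists>g. \<forall>i. has_gradient (total_density B j i) (g i) \<and>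
           (\<forall>w. g i w $ i = jump_source B (total_density B j) i w)"
proof -
  define b where "b = 1 + (\<Sum>i\<in>UNIV. \<Sum>k\<in>UNIV. B k i)"
  have b: "1 \<le> b" unfolding b_def using B by (auto intro!: sum_nonneg)
  have Bb: "(\<Sum>k\<in>UNIV. B k i) \<le> b" for i
    unfolding b_def using B
    by (auto intro!: sum_nonneg order_trans[OF member_le_sum[of i UNIV "\<lambda>i. \<Sum>k\<in>UNIV. B k i"]])
  define L where "L = (8 * b) ^ CARD('n)"
  define L' where "L' = (8 * b + real CARD('n)) * L"
  have L: "0 \<le> L" "0 \<le> L'" using b by (auto simp: L_def L'_def)
  have "\<exists>g. \<forall>n i. expbd (8 * b) (L * (1 / 2) ^ n) (L' * (3 / 4) ^ n) (occupation_density B j n UNIV i) (g n i)"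
  proof (intro choice allI)
    fix n i
    show "\<exists>g. expbd (8 * b) (L * (1 / 2) ^ n) (L' * (3 / 4) ^ n) (occupation_density B j n UNIV i) g"
      unfolding L_def L'_def by (rule expbd_occupation_density) (fact B Bb b)+
  qed
  then obtain g where g: "\<And>n i. expbd (8 * b) (L * (1 / 2) ^ n) (L' * (3 / 4) ^ n)
      (occupation_density B j n UNIV i) (g n i)" by blast
  have bnd: "\<exists>M. summable M \<and> (\<forall>n x. norm x \<le> R \<longrightarrow>
      \<bar>occupation_density B j n UNIV i x\<bar> \<le> M n \<and> norm (g n i x) \<le> M n)" for i R
  proof -
    define E where "E = exp (8 * b * (real CARD('n) * R))"
    define M where "M n = L * E * (1 / 2) ^ n + L' * E * (3 / 4) ^ n" for n :: nat
    have "summable M" unfolding M_def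
      by (intro summable_add summable_mult summable_geometric) auto
    moreover have "\<bar>occupation_density B j n UNIV i x\<bar> \<le> M n \<and> norm (g n i x) \<le> M n"
      if x: "norm x \<le> R" for n x
    proof -
      have "l1 x \<le> real CARD('n) * R"
        by (rule order_trans[OF l1_le mult_left_mono[OF x]]) simp
      then have E: "exp (8 * b * l1 x) \<le> E" "0 \<le> E"
        using b unfolding E_def by (auto intro: mult_left_mono)
      have "\<bar>occupation_density B j n UNIV i x\<bar> \<le> L * (1 / 2) ^ n * E"
        by (rule order_trans[OF expbdD(2)[OF g] mult_left_mono]) (use E L in auto)
      moreover have "norm (g n i x) \<le> L' * (3 / 4) ^ n * E"
        by (rule order_trans[OF expbdD(3)[OF g] mult_left_mono]) (use E L in auto)
      moreover have "0 \<le> L * E * (1 / 2) ^ n" "0 \<le> L' * E * (3 / 4) ^ n"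
        using E L by auto
      ultimately show ?thesis by (simp add: M_def mult_ac)
    qed
    ultimately show ?thesis by blast
  qed
  have su: "summable (\<lambda>n. occupation_density B j n UNIV i w)" for i w
  proof -
    obtain M where "summable M" "\<And>n. \<bar>occupation_density B j n UNIV i w\<bar> \<le> M n"
      using bnd[of "norm w" i] by blast
    then show ?thesis by - (rule summable_comparison_test'[of M 0], simp_all)
  qed
  then show "summable (\<lambda>n. occupation_density B j n UNIV i w)" .
  have sg: "summable (\<lambda>n. g n i w)" for i w
  proof -
    obtain M where "summable M" "\<And>n. norm (g n i w) \<le> M n"
      using bnd[of "norm w" i] by blast
    then show ?thesis by - (rule summable_comparison_test'[of M 0], simp_all)
  qed
  \<comment> \<open>Without a jump the density is constant: it can be nonzero only if
    \<open>UNIV = {j}\<close>, that is in dimension one.\<close>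
  have gi0: "g 0 i w = 0" for i w
  proof -
    have "has_gradient (occupation_density B j 0 UNIV i) (\<lambda>_. 0)"
      unfolding occupation_density.simps by (rule has_gradient_const)
    from has_gradient_unique[OF this expbdD(1)[OF g]] show ?thesis by metis
  qed
  have gi: "g (Suc n) i w $ i = jump_source B (occupation_density B j n UNIV) i w" for n i w
  proof -
    have ex: "\<exists>h. has_gradient (jump_source B (occupation_density B j n A) i) h" for A
    proof -
      obtain h where "\<And>k. has_gradient (occupation_density B j n A k) (h k)"
        using has_gradient_occupation_density[where B = B, OF B] by metis
      then show ?thesis
        unfolding jump_source_def[abs_def]
        by (intro exI) (rule has_gradient_mult has_gradient_hazard has_gradient_sum has_gradient_cmult | assumption)+
    qed
    obtain h1 where h1: "has_gradient (jump_source B (occupation_density B j n UNIV) i) h1"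
      using ex by blast
    obtain h2 where h2: "has_gradient (jump_source B (occupation_density B j n (UNIV - {i})) i) h2"
      using ex by blast
    have "has_gradient (occupation_density B j (Suc n) UNIV i)
       (\<lambda>w. ray_gradient i (jump_source B (occupation_density B j n UNIV) i) h1 w
          + scale_coord i 0 (h2 (scale_coord i 0 w)))"
      unfolding occupation_density.simps
      using has_gradient_add[OF has_gradient_ray_integral[OF h1, of i] has_gradient_scale_coord[OF h2, of i 0]]
      by simp
    from has_gradient_unique[OF expbdD(1)[OF g] this]
    show ?thesis
      by (simp add: ray_gradient_nth[OF h1] scale_coord_def)
  qed
  have "has_gradient (total_density B j i) (\<lambda>w. \<Sum>n. g n i w)" for i
    unfolding total_density_def[abs_def]
    by (rule has_gradient_suminf[OF expbdD(1)[OF g] bnd])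
  moreover have "(\<Sum>n. g n i w) $ i = jump_source B (total_density B j) i w" for i w
  proof -
    have "(\<Sum>n. g n i w) $ i = (\<Sum>n. g n i w $ i)"
      by (rule bounded_linear.suminf[OF bounded_linear_vec_nth sg])
    also have "\<dots> = (\<Sum>n. g (Suc n) i w $ i)"
      using suminf_split_head[OF bounded_linear.summable[OF bounded_linear_vec_nth[of i] sg[of i w]]]
      by (simp add: gi0)
    also have "\<dots> = (\<Sum>n. jump_source B (occupation_density B j n UNIV) i w)"
      by (simp add: gi)
    also have "\<dots> = jump_source B (total_density B j) i w"
      unfolding jump_source_def total_density_def
      by (simp add: suminf_mult suminf_sum su summable_mult summable_sum)
    finally show ?thesis .
  qed
  ultimately show "\<exists>g. \<forall>i. has_gradient (total_density B j i) (g i) \<and>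
           (\<forall>w. g i w $ i = jump_source B (total_density B j) i w)"
    by (intro exI[of _ "\<lambda>i w. \<Sum>n. g n i w"]) auto
qed

section \<open>Lebesgue measure on the faces of the orthant\<close>

text \<open>A state outside \<open>A\<close> has occupation time 0, hence the point mass. The
  product of these measures is Lebesgue measure of dimension \<open>card A\<close> on a face of the
  orthant.\<close>

definition half_line :: "'n set \<Rightarrow> 'n \<Rightarrow> real measure" where
  "half_line A k = (if k \<in> A then density lborel (indicator {0..}) else return borel 0)"

definition face_measure :: "'n set \<Rightarrow> (real ^ 'n::finite) measure" where
  "face_measure A = distr (Pi\<^sub>M UNIV (half_line A)) borel vec_lambda"

lemma sets_half_line [simp, measurable_cong]: "sets (half_line A k) = sets borel"
  by (simp add: half_line_def)

lemma space_half_line [simp]: "space (half_line A k) = UNIV"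
  by (simp add: half_line_def)

lemma sets_face_measure [simp, measurable_cong]: "sets (face_measure A) = sets borel"
  by (simp add: face_measure_def)

lemma sigma_finite_half_line: "sigma_finite_measure (half_line A k)"
proof (cases "k \<in> A")
  case True
  have "sigma_finite_measure (density lborel (indicator {0::real..}))"
    by (subst sigma_finite_measure.sigma_finite_iff_density_finite'[OF sigma_finite_lborel])
       (auto simp: indicator_def)
  with True show ?thesis by (simp add: half_line_def)
next
  case False
  then show ?thesis
    by (auto simp: half_line_def intro!: prob_space_return prob_space_imp_sigma_finite)
qed

lemma product_sigma_finite_half_line: "product_sigma_finite (half_line A)"
  by (auto simp: product_sigma_finite_def sigma_finite_half_line)

lemma measurable_vec_lambda:
  assumes "\<And>k. sets (M k) = sets borel"
  shows "vec_lambda \<in> measurable (Pi\<^sub>M UNIV M) (borel :: (real ^ 'n::finite) measure)"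
proof (rule borel_measurable_euclidean_space[THEN iffD2], intro ballI)
  fix b :: "real ^ 'n" assume "b \<in> Basis"
  then obtain k where b: "b = axis k 1" by (auto simp: Basis_vec_def)
  have "(\<lambda>x. x k) \<in> measurable (Pi\<^sub>M UNIV M) (M k)"
    by (rule measurable_component_singleton) simp
  then have "(\<lambda>x. x k) \<in> borel_measurable (Pi\<^sub>M UNIV M)"
    using assms measurable_cong_sets by blast
  then show "(\<lambda>x. vec_lambda x \<bullet> b) \<in> borel_measurable (Pi\<^sub>M UNIV M)"
    by (simp add: b inner_axis)
qed

text \<open>Tonelli with the coordinate \<open>i\<close> innermost. It reduces the two adjointness
  statements below to one real variable.\<close>

lemma nn_integral_face_measure_split:
  fixes f :: "real ^ 'n::finite \<Rightarrow> ennreal"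
  assumes f: "f \<in> borel_measurable borel"
  shows "(\<integral>\<^sup>+w. f w \<partial>face_measure A) =
    (\<integral>\<^sup>+y. \<integral>\<^sup>+t. f (vec_lambda (y(i := t))) \<partial>half_line A i \<partial>Pi\<^sub>M (UNIV - {i}) (half_line A))"
proof -
  interpret product_sigma_finite "half_line A" by (rule product_sigma_finite_half_line)
  have v: "vec_lambda \<in> measurable (Pi\<^sub>M UNIV (half_line A)) (borel :: (real ^ 'n) measure)"
    by (rule measurable_vec_lambda) simp
  have ins: "insert i (UNIV - {i}) = (UNIV :: 'n set)" by auto
  have "(\<integral>\<^sup>+w. f w \<partial>face_measure A) = (\<integral>\<^sup>+x. f (vec_lambda x) \<partial>Pi\<^sub>M (insert i (UNIV - {i})) (half_line A))"
    unfolding face_measure_def ins by (rule nn_integral_distr[OF v]) (use f in simp)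
  also have "\<dots> = (\<integral>\<^sup>+y. \<integral>\<^sup>+t. f (vec_lambda (y(i := t))) \<partial>half_line A i \<partial>Pi\<^sub>M (UNIV - {i}) (half_line A))"
    by (rule product_nn_integral_insert) (use measurable_compose[OF v f] ins in auto)
  finally show ?thesis .
qed

lemma vec_lambda_upd_add: "vec_lambda (y(i := t)) + s *\<^sub>R axis i 1 = (vec_lambda (y(i := t + s)) :: real ^ 'n)"
  by (auto simp: vec_eq_iff axis_def)

lemma scale_coord_vec_lambda: "scale_coord i \<tau> (vec_lambda (y(i := t))) = vec_lambda (y(i := \<tau> * t))"
  by (auto simp: vec_eq_iff scale_coord_def)

lemma nn_integral_half_line:
  assumes "f \<in> borel_measurable borel" "i \<in> A"
  shows "(\<integral>\<^sup>+t. f t \<partial>half_line A i) = (\<integral>\<^sup>+t\<in>{0..}. f t \<partial>lborel)"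
  using assms by (simp add: half_line_def nn_integral_density mult.commute)

lemma vec_lambda_upd_eq:
  "(\<lambda>t. vec_lambda (y(i := t))) = (\<lambda>t. vec_lambda (y(i := 0)) + t *\<^sub>R (axis i 1 :: real ^ 'n))"
  using vec_lambda_upd_add[of y i 0] by (auto simp: fun_eq_iff)

lemma measurable_vec_lambda_upd [measurable]:
  "(\<lambda>t. vec_lambda (y(i := t)) :: real ^ 'n::finite) \<in> borel_measurable borel"
  by (subst vec_lambda_upd_eq) measurable

lemma nn_integral_shift:
  fixes f :: "real \<Rightarrow> ennreal"
  assumes [measurable]: "f \<in> borel_measurable borel"
  shows "(\<integral>\<^sup>+t\<in>{0..}. f (s + t) \<partial>lborel) = (\<integral>\<^sup>+v\<in>{s..}. f v \<partial>lborel)"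
proof -
  have "(\<integral>\<^sup>+v\<in>{s..}. f v \<partial>lborel) = (\<integral>\<^sup>+t. f (s + t) * indicator {s..} (s + t) \<partial>lborel)"
    using nn_integral_real_affine[of "\<lambda>v. f v * indicator {s..} v" 1 s] by simp
  also have "\<dots> = (\<integral>\<^sup>+t\<in>{0..}. f (s + t) \<partial>lborel)"
    by (intro nn_integral_cong) (auto split: split_indicator)
  finally show ?thesis ..
qed

text \<open>Both sides integrate over the wedge \<open>0 \<le> s \<le> v\<close>.\<close>

lemma nn_integral_wedge:
  fixes f u :: "real \<Rightarrow> ennreal"
  assumes [measurable]: "f \<in> borel_measurable borel" "u \<in> borel_measurable borel"
  shows "(\<integral>\<^sup>+s\<in>{0..}. (\<integral>\<^sup>+t\<in>{0..}. f (s + t) \<partial>lborel) * u s \<partial>lborel) =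
         (\<integral>\<^sup>+v\<in>{0..}. f v * (\<integral>\<^sup>+s\<in>{0..v}. u s \<partial>lborel) \<partial>lborel)"
proof -
  have "(\<integral>\<^sup>+s\<in>{0..}. (\<integral>\<^sup>+t\<in>{0..}. f (s + t) \<partial>lborel) * u s \<partial>lborel)
      = (\<integral>\<^sup>+s. (\<integral>\<^sup>+v. (f v * indicator {s..} v) * (u s * indicator {0..} s) \<partial>lborel) \<partial>lborel)"
    by (intro nn_integral_cong) (simp add: nn_integral_shift nn_integral_multc[symmetric] mult.assoc)
  also have "\<dots> = (\<integral>\<^sup>+s. (\<integral>\<^sup>+v. f v * u s * indicator {(v, s). 0 \<le> s \<and> s \<le> v} (v, s) \<partial>lborel) \<partial>lborel)"
    by (intro nn_integral_cong) (auto split: split_indicator)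
  also have "\<dots> = (\<integral>\<^sup>+v. (\<integral>\<^sup>+s. f v * u s * indicator {(v, s). 0 \<le> s \<and> s \<le> v} (v, s) \<partial>lborel) \<partial>lborel)"
    by (rule lborel_pair.Fubini') measurable
  also have "\<dots> = (\<integral>\<^sup>+v. (\<integral>\<^sup>+s. f v * indicator {0..} v * (u s * indicator {0..v} s) \<partial>lborel) \<partial>lborel)"
    by (intro nn_integral_cong) (auto split: split_indicator)
  also have "\<dots> = (\<integral>\<^sup>+v. f v * indicator {0..} v * (\<integral>\<^sup>+s\<in>{0..v}. u s \<partial>lborel) \<partial>lborel)"
    by (intro nn_integral_cong nn_integral_cmult) measurable
  finally show ?thesis by (simp add: mult_ac)
qed

lemma nn_integral_interval_scale:
  fixes u :: "real \<Rightarrow> real"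
  assumes u: "continuous_on UNIV u" and pos: "\<And>s. 0 \<le> s \<Longrightarrow> s \<le> v \<Longrightarrow> 0 \<le> u s" and v: "0 \<le> v"
  shows "(\<integral>\<^sup>+s\<in>{0..v}. ennreal (u s) \<partial>lborel) = ennreal (v * (\<integral>\<tau>. u (\<tau> * v) \<partial>unit_lebesgue))"
proof (cases "v = 0")
  \<comment> \<open>The substitution \<open>s = v * \<tau>\<close> degenerates for
    \<open>v = 0\<close>, where both sides vanish.\<close>
  case True
  have "(\<integral>\<^sup>+s\<in>{0::real}. ennreal (u s) \<partial>lborel) = ennreal (u 0) * emeasure lborel {0::real}"
    by (rule nn_integral_indicator_singleton[where f = "\<lambda>s. ennreal (u s)"]) auto
  with True show ?thesis by simp
next
  case False
  with v have v: "0 < v" by simp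
  have [measurable]: "u \<in> borel_measurable borel" using u by (rule borel_measurable_continuous_onI)
  have "(\<integral>\<^sup>+s\<in>{0..v}. ennreal (u s) \<partial>lborel)
      = ennreal v * (\<integral>\<^sup>+\<tau>. ennreal (u (v * \<tau>)) * indicator {0..v} (v * \<tau>) \<partial>lborel)"
    using nn_integral_real_affine[of "\<lambda>s. ennreal (u s) * indicator {0..v} s" v 0] v by simp
  also have "(\<integral>\<^sup>+\<tau>. ennreal (u (v * \<tau>)) * indicator {0..v} (v * \<tau>) \<partial>lborel)
      = (\<integral>\<^sup>+\<tau>. ennreal (u (\<tau> * v)) * indicator {0..1} \<tau> \<partial>lborel)"
    using v by (intro nn_integral_cong) (auto split: split_indicator simp: mult.commute zero_le_mult_iff)
  also have "\<dots> = (\<integral>\<^sup>+\<tau>. ennreal (u (\<tau> * v)) \<partial>unit_lebesgue)"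
    unfolding unit_lebesgue_def by (subst nn_integral_restrict_space) auto
  also have "\<dots> = ennreal (\<integral>\<tau>. u (\<tau> * v) \<partial>unit_lebesgue)"
  proof (rule nn_integral_eq_integral)
    show "integrable unit_lebesgue (\<lambda>\<tau>. u (\<tau> * v))"
      by (intro integrable_unit_lebesgue continuous_on_compose2[OF u] continuous_intros) auto
    have "0 \<le> u (\<tau> * v)" if "0 \<le> \<tau>" "\<tau> \<le> 1" for \<tau>
      using that v mult_right_mono[of \<tau> 1 v] by (intro pos) auto
    then show "AE \<tau> in unit_lebesgue. 0 \<le> u (\<tau> * v)"
      by (intro AE_I2) auto
  qed
  finally show ?thesis using v by (simp add: ennreal_mult')
qed

lemma AE_half_line_nonneg: "AE t in half_line A k. 0 \<le> t"
proof (cases "k \<in> A")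
  case True
  then have "half_line A k = density lborel (indicator {0..})"
    by (simp add: half_line_def)
  then show ?thesis
    by (simp only:) (subst AE_density, auto simp: indicator_def)
next
  case False
  then have "half_line A k = return borel 0"
    by (simp add: half_line_def)
  then show ?thesis
    by (simp only:) (subst AE_return, auto)
qed

lemma AE_PiM_half_line_nonneg:
  "AE y in Pi\<^sub>M I (half_line A). \<forall>k\<in>(I :: 'n::finite set). 0 \<le> y k"
proof (rule AE_finite_allI)
  fix k assume k: "k \<in> I"
  interpret product_sigma_finite "half_line A" by (rule product_sigma_finite_half_line)
  show "AE y in Pi\<^sub>M I (half_line A). 0 \<le> y k"
  proof -
    have N: "{t \<in> space (half_line A k). \<not> 0 \<le> t} \<in> null_sets (half_line A k)"
      by (subst AE_iff_null[symmetric]) (auto intro: AE_half_line_nonneg)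
    have "(\<lambda>y. y k) -` {t \<in> space (half_line A k). \<not> 0 \<le> t} \<inter> space (Pi\<^sub>M I (half_line A))
        = Pi\<^sub>E I (\<lambda>j. if j = k then {t. \<not> 0 \<le> t} else UNIV)" (is "?X = ?Y")
      using k by (auto simp: space_PiM PiE_iff extensional_def split: if_splits)
    moreover have "emeasure (Pi\<^sub>M I (half_line A)) ?Y = 0"
      using k N by (subst emeasure_PiM) (auto intro!: prod_zero bexI[of _ k])
    ultimately show ?thesis
      by (intro AE_I[of _ _ ?X]) (use k in \<open>auto intro!: sets_PiM_I_finite simp: PiE_iff\<close>)
  qed
qed simp

lemma AE_face_measure_nonneg: "AE w in face_measure A. \<forall>k. 0 \<le> w $ k"
  unfolding face_measure_def
proof (subst AE_distr_iff)
  show "vec_lambda \<in> measurable (Pi\<^sub>M UNIV (half_line A)) borel"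
    by (rule measurable_vec_lambda) simp
  show "{x \<in> space borel. \<forall>k. 0 \<le> x $ k} \<in> sets (borel :: (real ^ 'a) measure)"
    by measurable
  show "AE x in Pi\<^sub>M UNIV (half_line A). \<forall>k. 0 \<le> (vec_lambda x :: real ^ 'a) $ k"
    using AE_PiM_half_line_nonneg[of UNIV A] by simp
qed

text \<open>A stay of length \<open>t\<close> after the time \<open>s\<close> already spent in
  \<open>i\<close> leads to the coordinate \<open>v = s + t\<close>. Exchanging the order of
  integration collects, for fixed \<open>v\<close>, all \<open>s\<close> in \<open>{0..v}\<close>,
  which is the ray integral. So integration of \<open>f\<close> over the stay is adjoint to
  \<open>ray_integral\<close>.\<close>

lemma nn_integral_face_ray_same:
  fixes f :: "real ^ 'n::finite \<Rightarrow> ennreal" and u :: "real ^ 'n \<Rightarrow> real"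
  assumes f[measurable]: "f \<in> borel_measurable borel" and u: "continuous_on UNIV u"
    and pos: "\<And>w. (\<And>k. 0 \<le> w $ k) \<Longrightarrow> 0 \<le> u w" and i: "i \<in> A"
    and ru[measurable]: "ray_integral i u \<in> borel_measurable borel"
  shows "(\<integral>\<^sup>+w. (\<integral>\<^sup>+t\<in>{0..}. f (w + t *\<^sub>R axis i 1) \<partial>lborel) * ennreal (u w) \<partial>face_measure A)
       = (\<integral>\<^sup>+w. f w * ennreal (ray_integral i u w) \<partial>face_measure A)"
proof -
  have um[measurable]: "u \<in> borel_measurable borel" using u by (rule borel_measurable_continuous_onI)
  have inner: "(\<integral>\<^sup>+s. (\<integral>\<^sup>+t\<in>{0..}. f (vec_lambda (y(i := s)) + t *\<^sub>R axis i 1) \<partial>lborel)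
          * ennreal (u (vec_lambda (y(i := s)))) \<partial>half_line A i)
      = (\<integral>\<^sup>+s. f (vec_lambda (y(i := s))) * ennreal (ray_integral i u (vec_lambda (y(i := s)))) \<partial>half_line A i)"
    if y: "\<forall>k\<in>UNIV - {i}. 0 \<le> y k" for y
  proof -
    have pos': "0 \<le> u (vec_lambda (y(i := s)))" if "0 \<le> s" for s
      using that y by (intro pos) auto
    have cu: "continuous_on UNIV (\<lambda>s. u (vec_lambda (y(i := s))))"
    proof (rule continuous_on_compose2[OF u])
      show "continuous_on UNIV (\<lambda>s. vec_lambda (y(i := s)) :: real ^ 'n)"
        by (subst vec_lambda_upd_eq) (intro continuous_intros)
    qed auto
    have "(\<integral>\<^sup>+s. (\<integral>\<^sup>+t\<in>{0..}. f (vec_lambda (y(i := s)) + t *\<^sub>R axis i 1) \<partial>lborel)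
          * ennreal (u (vec_lambda (y(i := s)))) \<partial>half_line A i)
        = (\<integral>\<^sup>+s\<in>{0..}. (\<integral>\<^sup>+t\<in>{0..}. f (vec_lambda (y(i := s + t))) \<partial>lborel)
          * ennreal (u (vec_lambda (y(i := s)))) \<partial>lborel)"
      unfolding vec_lambda_upd_add by (rule nn_integral_half_line[OF _ i]) measurable
    also have "\<dots> = (\<integral>\<^sup>+v\<in>{0..}. f (vec_lambda (y(i := v))) *
        (\<integral>\<^sup>+s\<in>{0..v}. ennreal (u (vec_lambda (y(i := s)))) \<partial>lborel) \<partial>lborel)"
      by (rule nn_integral_wedge) measurable
    also have "\<dots> = (\<integral>\<^sup>+v\<in>{0..}. f (vec_lambda (y(i := v))) *
        ennreal (ray_integral i u (vec_lambda (y(i := v)))) \<partial>lborel)"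
    proof (intro nn_integral_cong)
      fix v :: real
      have "(\<integral>\<^sup>+s\<in>{0..v}. ennreal (u (vec_lambda (y(i := s)))) \<partial>lborel)
          = ennreal (ray_integral i u (vec_lambda (y(i := v))))" if "0 \<le> v"
        using nn_integral_interval_scale[OF cu pos' that]
        by (simp add: ray_integral_def scale_coord_vec_lambda)
      then show "f (vec_lambda (y(i := v))) * (\<integral>\<^sup>+s\<in>{0..v}. ennreal (u (vec_lambda (y(i := s)))) \<partial>lborel) * indicator {0..} v
          = f (vec_lambda (y(i := v))) * ennreal (ray_integral i u (vec_lambda (y(i := v)))) * indicator {0..} v"
        by (auto split: split_indicator)
    qed
    also have "\<dots> = (\<integral>\<^sup>+s. f (vec_lambda (y(i := s))) * ennreal (ray_integral i u (vec_lambda (y(i := s)))) \<partial>half_line A i)"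
      by (rule nn_integral_half_line[OF _ i, symmetric]) measurable
    finally show ?thesis .
  qed
  show ?thesis
    by (subst (1 2) nn_integral_face_measure_split[of _ _ i], measurable)
       (rule nn_integral_cong_AE, use AE_PiM_half_line_nonneg[of "UNIV - {i}" A] inner in \<open>auto elim!: eventually_mono\<close>)
qed

text \<open>On a first visit the point mass at 0 in coordinate \<open>i\<close> is replaced by the
  length of the stay. The measure changes to the larger face, and \<open>u\<close> is still
  evaluated where the coordinate is 0.\<close>

lemma nn_integral_face_ray_new:
  fixes f :: "real ^ 'n::finite \<Rightarrow> ennreal" and u :: "real ^ 'n \<Rightarrow> real"
  assumes f[measurable]: "f \<in> borel_measurable borel" and um[measurable]: "u \<in> borel_measurable borel"
    and i: "i \<notin> A" and sc[measurable]: "scale_coord i 0 \<in> borel_measurable borel"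
  shows "(\<integral>\<^sup>+w. (\<integral>\<^sup>+t\<in>{0..}. f (w + t *\<^sub>R axis i 1) \<partial>lborel) * ennreal (u w) \<partial>face_measure A)
       = (\<integral>\<^sup>+w. f w * ennreal (u (scale_coord i 0 w)) \<partial>face_measure (insert i A))"
proof -
  have PM: "Pi\<^sub>M (UNIV - {i}) (half_line A) = Pi\<^sub>M (UNIV - {i}) (half_line (insert i A))"
    by (rule PiM_cong) (auto simp: half_line_def)
  have inner: "(\<integral>\<^sup>+s. (\<integral>\<^sup>+t\<in>{0..}. f (vec_lambda (y(i := s)) + t *\<^sub>R axis i 1) \<partial>lborel)
          * ennreal (u (vec_lambda (y(i := s)))) \<partial>half_line A i)
      = (\<integral>\<^sup>+s. f (vec_lambda (y(i := s))) * ennreal (u (scale_coord i 0 (vec_lambda (y(i := s))))) \<partial>half_line (insert i A) i)"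
    for y
  proof -
    have "(\<integral>\<^sup>+s. (\<integral>\<^sup>+t\<in>{0..}. f (vec_lambda (y(i := s)) + t *\<^sub>R axis i 1) \<partial>lborel)
          * ennreal (u (vec_lambda (y(i := s)))) \<partial>half_line A i)
        = (\<integral>\<^sup>+t\<in>{0..}. f (vec_lambda (y(i := t))) \<partial>lborel) * ennreal (u (vec_lambda (y(i := 0))))"
      using i unfolding vec_lambda_upd_add half_line_def
      by (simp add: nn_integral_return)
    also have "\<dots> = (\<integral>\<^sup>+s\<in>{0..}. f (vec_lambda (y(i := s))) * ennreal (u (scale_coord i 0 (vec_lambda (y(i := s))))) \<partial>lborel)"
      unfolding scale_coord_vec_lambda
      by (subst nn_integral_multc[symmetric]) (auto intro!: nn_integral_cong simp: mult_ac)
    also have "\<dots> = (\<integral>\<^sup>+s. f (vec_lambda (y(i := s))) * ennreal (u (scale_coord i 0 (vec_lambda (y(i := s))))) \<partial>half_line (insert i A) i)"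
      by (rule nn_integral_half_line[symmetric]) auto
    finally show ?thesis .
  qed
  show ?thesis
    by (subst (1 2) nn_integral_face_measure_split[of _ _ i], measurable)
       (simp add: inner PM)
qed

text \<open>Links products over coordinates, in which the faces are described, with Lebesgue measure
  on the Euclidean space. The two agree on boxes.\<close>

lemma lborel_vec: "distr (Pi\<^sub>M UNIV (\<lambda>_. lborel)) borel vec_lambda = (lborel :: (real ^ 'n::finite) measure)"
proof (rule lborel_eqI[symmetric])
  interpret product_sigma_finite "\<lambda>_ :: 'n. lborel :: real measure" ..
  have v: "vec_lambda \<in> measurable (Pi\<^sub>M UNIV (\<lambda>_. lborel)) (borel :: (real ^ 'n) measure)"
    by (rule measurable_vec_lambda) simp
  fix l u :: "real ^ 'n" assume lu: "\<And>b. b \<in> Basis \<Longrightarrow> l \<bullet> b \<le> u \<bullet> b"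
  have le: "l $ k \<le> u $ k" for k
    using lu[of "axis k 1"] by (simp add: axis_in_Basis_iff inner_axis)
  have "vec_lambda -` box l u \<inter> space (Pi\<^sub>M UNIV (\<lambda>_. lborel)) = Pi\<^sub>E UNIV (\<lambda>k. {l $ k <..< u $ k})"
    by (auto simp: space_PiM mem_box_cart PiE_iff)
  then have "emeasure (distr (Pi\<^sub>M UNIV (\<lambda>_. lborel)) borel vec_lambda) (box l u)
      = (\<Prod>k\<in>UNIV. emeasure lborel {l $ k <..< u $ k})"
    by (subst emeasure_distr[OF v]) (simp_all add: emeasure_PiM)
  also have "\<dots> = (\<Prod>k\<in>UNIV. ennreal (u $ k - l $ k))"
    using le by simp
  also have "\<dots> = ennreal (\<Prod>k\<in>UNIV. u $ k - l $ k)"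
    using le by (intro prod_ennreal) simp
  also have "(\<Prod>k\<in>UNIV. u $ k - l $ k) = (\<Prod>b\<in>Basis. (u - l) \<bullet> b)"
  proof -
    have B: "(Basis :: (real ^ 'n) set) = (\<lambda>k. axis k 1) ` UNIV"
      by (auto simp: Basis_vec_def)
    show ?thesis unfolding B
      by (subst prod.reindex) (auto intro!: inj_onI simp: axis_eq_axis inner_axis)
  qed
  finally show "emeasure (distr (Pi\<^sub>M UNIV (\<lambda>_. lborel)) borel vec_lambda) (box l u) = (\<Prod>b\<in>Basis. (u - l) \<bullet> b)" .
qed simp

definition orthant :: "(real ^ 'n) set" where
  "orthant = {w. \<forall>k. 0 \<le> w $ k}"

lemma orthant_borel [measurable]: "orthant \<in> sets (borel :: (real ^ 'n::finite) measure)"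
  unfolding orthant_def by measurable

lemma face_measure_UNIV: "face_measure UNIV = density lborel (indicator (orthant :: (real ^ 'n::finite) set))"
proof -
  interpret product_sigma_finite "half_line (UNIV :: 'n set)" by (rule product_sigma_finite_half_line)
  interpret L: product_sigma_finite "\<lambda>_ :: 'n. lborel :: real measure" ..
  have v: "vec_lambda \<in> measurable (Pi\<^sub>M UNIV (\<lambda>_. lborel)) (borel :: (real ^ 'n) measure)"
    by (rule measurable_vec_lambda) simp
  define O' where "O' = Pi\<^sub>E (UNIV :: 'n set) (\<lambda>_. {0::real..})"
  have O': "O' \<in> sets (Pi\<^sub>M UNIV (\<lambda>_. lborel))"
    unfolding O'_def by (rule sets_PiM_I_finite) auto
  have eq: "density (Pi\<^sub>M UNIV (\<lambda>_. lborel)) (indicator O') = Pi\<^sub>M UNIV (half_line UNIV)"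
  proof (rule PiM_eqI)
    have "sets (Pi\<^sub>M UNIV (\<lambda>_ :: 'n. lborel :: real measure)) = sets (Pi\<^sub>M UNIV (half_line UNIV))"
      by (intro sets_PiM_cong) auto
    then show "sets (density (Pi\<^sub>M UNIV (\<lambda>_. lborel)) (indicator O')) = sets (Pi\<^sub>M UNIV (half_line UNIV))"
      by simp
    fix A :: "'n \<Rightarrow> real set" assume "\<And>i. i \<in> UNIV \<Longrightarrow> A i \<in> sets (half_line UNIV i)"
    then have A: "A i \<in> sets borel" for i by simp
    have "emeasure (density (Pi\<^sub>M UNIV (\<lambda>_. lborel)) (indicator O')) (Pi\<^sub>E UNIV A)
        = emeasure (Pi\<^sub>M UNIV (\<lambda>_. lborel)) (O' \<inter> Pi\<^sub>E UNIV A)"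
      by (subst emeasure_density)
         (use O' A in \<open>auto intro!: sets_PiM_I_finite simp flip: indicator_inter_arith
            simp: nn_integral_indicator borel_measurable_indicator\<close>)
    also have "O' \<inter> Pi\<^sub>E UNIV A = Pi\<^sub>E UNIV (\<lambda>k. {0..} \<inter> A k)"
      by (auto simp: O'_def PiE_iff)
    also have "emeasure (Pi\<^sub>M UNIV (\<lambda>_. lborel)) \<dots> = (\<Prod>k\<in>UNIV. emeasure lborel ({0..} \<inter> A k))"
      using A by (subst L.emeasure_PiM) auto
    also have "\<dots> = (\<Prod>k\<in>UNIV. emeasure (half_line UNIV k) (A k))"
    proof (rule prod.cong[OF refl])
      fix k
      have "emeasure (half_line UNIV k) (A k) = (\<integral>\<^sup>+t. indicator {0..} t * indicator (A k) t \<partial>lborel)"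
        using A by (simp add: half_line_def emeasure_density)
      also have "\<dots> = emeasure lborel ({0..} \<inter> A k)"
        using A by (simp flip: indicator_inter_arith)
      finally show "emeasure lborel ({0..} \<inter> A k) = emeasure (half_line UNIV k) (A k)" ..
    qed
    finally show "emeasure (density (Pi\<^sub>M UNIV (\<lambda>_. lborel)) (indicator O')) (Pi\<^sub>E UNIV A)
        = (\<Prod>k\<in>UNIV. emeasure (half_line UNIV k) (A k))" .
  qed simp
  have ind: "indicator O' = (\<lambda>x. indicator (orthant :: (real ^ 'n) set) (vec_lambda x) :: ennreal)"
    by (auto simp: O'_def orthant_def PiE_iff fun_eq_iff split: split_indicator)
  show ?thesis
    unfolding face_measure_def eq[symmetric] ind lborel_vec[symmetric]
    by (rule density_distr[symmetric]) (use v in auto)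
qed

section \<open>Polar coordinates over the simplex\<close>

lemma nn_integral_PiM_lborel_scale:
  fixes f :: "('i \<Rightarrow> real) \<Rightarrow> ennreal"
  assumes "finite I" and f: "f \<in> borel_measurable (Pi\<^sub>M I (\<lambda>_. lborel))" and s: "0 < s"
  shows "(\<integral>\<^sup>+y. f y \<partial>Pi\<^sub>M I (\<lambda>_. lborel)) =
    ennreal (s ^ card I) * (\<integral>\<^sup>+x. f (\<lambda>i\<in>I. s * x i) \<partial>Pi\<^sub>M I (\<lambda>_. lborel))"
  using assms(1) f
proof (induction I arbitrary: f rule: finite_induct)
  case empty
  interpret product_sigma_finite "\<lambda>_ :: 'i. lborel :: real measure" ..
  have "(\<lambda>i\<in>{}. s * x i) = (\<lambda>_. undefined)" for x :: "'i \<Rightarrow> real" by (auto simp: fun_eq_iff)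
  then show ?case by (simp add: nn_integral_empty space_PiM_empty)
next
  case (insert i I)
  interpret product_sigma_finite "\<lambda>_ :: 'i. lborel :: real measure" ..
  note [measurable] = insert.prems
  have sc: "(\<lambda>x. \<lambda>i\<in>J. s * x i) \<in> measurable (Pi\<^sub>M J (\<lambda>_. lborel)) (Pi\<^sub>M J (\<lambda>_. lborel))" for J :: "'i set"
    by measurable
  note [measurable] = sc[of I] sc[of "insert i I"]
  interpret I: sigma_finite_measure "Pi\<^sub>M I (\<lambda>_. lborel :: real measure)"
    by (rule sigma_finite[OF insert.hyps(1)])
  have jm: "(\<lambda>(t, x). f ((\<lambda>i\<in>I. s * x i)(i := t))) \<in> borel_measurable (borel \<Otimes>\<^sub>M Pi\<^sub>M I (\<lambda>_. lborel))"
  proof -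
    have "(\<lambda>(t, x). (\<lambda>i\<in>I. s * x i, t)) \<in> measurable (borel \<Otimes>\<^sub>M Pi\<^sub>M I (\<lambda>_. lborel)) (Pi\<^sub>M I (\<lambda>_. lborel) \<Otimes>\<^sub>M lborel)"
      by measurable
    from measurable_compose[OF measurable_compose[OF this measurable_add_dim] insert.prems]
    show ?thesis by (simp add: split_beta')
  qed
  have jm': "(\<lambda>t. \<integral>\<^sup>+x. f ((\<lambda>i\<in>I. s * x i)(i := t)) \<partial>Pi\<^sub>M I (\<lambda>_. lborel)) \<in> borel_measurable borel"
    by (rule I.borel_measurable_nn_integral[OF jm])
  have "(\<integral>\<^sup>+y. f y \<partial>Pi\<^sub>M (insert i I) (\<lambda>_. lborel)) =
      (\<integral>\<^sup>+t. \<integral>\<^sup>+y. f (y(i := t)) \<partial>Pi\<^sub>M I (\<lambda>_. lborel) \<partial>lborel)"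
    by (rule product_nn_integral_insert_rev) (use insert in auto)
  also have "\<dots> = (\<integral>\<^sup>+t. ennreal (s ^ card I) * (\<integral>\<^sup>+x. f ((\<lambda>i\<in>I. s * x i)(i := t)) \<partial>Pi\<^sub>M I (\<lambda>_. lborel)) \<partial>lborel)"
    by (intro nn_integral_cong insert.IH) measurable
  also have "\<dots> = ennreal (s ^ card I) * (\<integral>\<^sup>+t. (\<integral>\<^sup>+x. f ((\<lambda>i\<in>I. s * x i)(i := t)) \<partial>Pi\<^sub>M I (\<lambda>_. lborel)) \<partial>lborel)"
    by (rule nn_integral_cmult) (use jm' in simp)
  also have "(\<integral>\<^sup>+t. (\<integral>\<^sup>+x. f ((\<lambda>i\<in>I. s * x i)(i := t)) \<partial>Pi\<^sub>M I (\<lambda>_. lborel)) \<partial>lborel)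
      = ennreal s * (\<integral>\<^sup>+t. (\<integral>\<^sup>+x. f ((\<lambda>i\<in>I. s * x i)(i := s * t)) \<partial>Pi\<^sub>M I (\<lambda>_. lborel)) \<partial>lborel)"
    using nn_integral_real_affine[OF jm', of s 0] s by simp
  also have "(\<integral>\<^sup>+t. (\<integral>\<^sup>+x. f ((\<lambda>i\<in>I. s * x i)(i := s * t)) \<partial>Pi\<^sub>M I (\<lambda>_. lborel)) \<partial>lborel)
      = (\<integral>\<^sup>+t. (\<integral>\<^sup>+x. f (\<lambda>j\<in>insert i I. s * (x(i := t)) j) \<partial>Pi\<^sub>M I (\<lambda>_. lborel)) \<partial>lborel)"
    using insert.hyps by (intro nn_integral_cong arg_cong[of _ _ f]) (auto simp: fun_eq_iff)
  also have "\<dots> = (\<integral>\<^sup>+x. f (\<lambda>j\<in>insert i I. s * x j) \<partial>Pi\<^sub>M (insert i I) (\<lambda>_. lborel))"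
    by (rule product_nn_integral_insert_rev[symmetric]) (use insert in auto)
  finally show ?case
    using insert.hyps s
    by (simp add: mult.assoc[symmetric] ennreal_mult' mult.commute restrict_def cong: if_cong)
qed

lemma borel_measurable_vecI:
  fixes f :: "'a \<Rightarrow> real ^ 'n::finite"
  assumes "\<And>k. (\<lambda>x. f x $ k) \<in> borel_measurable M"
  shows "f \<in> borel_measurable M"
  by (rule borel_measurable_euclidean_space[THEN iffD2])
     (use assms in \<open>auto simp: Basis_vec_def inner_axis\<close>)

lemma measurable_simplex_chart [measurable]:
  "simplex_chart r \<in> measurable (Pi\<^sub>M (UNIV - {r}) (\<lambda>_. lborel)) (borel :: (real ^ 'n::finite) measure)"
proof (rule borel_measurable_vecI)
  fix k
  show "(\<lambda>x. simplex_chart r x $ k) \<in> borel_measurable (Pi\<^sub>M (UNIV - {r}) (\<lambda>_. lborel))"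
    by (cases "k = r") (auto simp: simplex_chart_def)
qed

lemma std_simplex_borel [measurable]: "std_simplex \<in> sets (borel :: (real ^ 'n::finite) measure)"
  unfolding std_simplex_def by measurable

lemma sets_simplex_lebesgue [simp, measurable_cong]: "sets (simplex_lebesgue r) = sets borel"
  by (simp add: simplex_lebesgue_def)

lemma nn_integral_simplex_lebesgue:
  fixes f :: "real ^ 'n::finite \<Rightarrow> ennreal"
  assumes [measurable]: "f \<in> borel_measurable borel"
  shows "(\<integral>\<^sup>+x. f x \<partial>simplex_lebesgue r) =
    (\<integral>\<^sup>+x. f (simplex_chart r x) * indicator std_simplex (simplex_chart r x) \<partial>Pi\<^sub>M (UNIV - {r}) (\<lambda>_. lborel))"
  unfolding simplex_lebesgue_def
  by (simp add: nn_integral_density nn_integral_distr mult.commute)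

lemma sum_simplex_chart: "(\<Sum>k\<in>UNIV. simplex_chart r x $ k) = 1"
  by (subst sum.remove[of _ r]) (auto simp: simplex_chart_def)

text \<open>The coordinate \<open>r\<close> is replaced by the total \<open>s\<close>, which is a
  shear with Jacobian 1; scaling the other coordinates by \<open>s\<close> then gives the power
  \<open>CARD('n) - 1\<close>. No constant appears, because \<open>simplex_lebesgue\<close> is
  Lebesgue measure in the same chart.\<close>

lemma nn_integral_orthant_polar:
  fixes f :: "real ^ 'n::finite \<Rightarrow> ennreal"
  assumes f[measurable]: "f \<in> borel_measurable borel"
  shows "(\<integral>\<^sup>+y\<in>orthant. f y \<partial>lborel) =
    (\<integral>\<^sup>+s\<in>{0..}. ennreal (s ^ (CARD('n) - 1)) * (\<integral>\<^sup>+x. f (s *\<^sub>R x) \<partial>simplex_lebesgue r) \<partial>lborel)"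
proof -
  interpret product_sigma_finite "\<lambda>_ :: 'n. lborel :: real measure" ..
  define I where "I = UNIV - {r}"
  interpret I: sigma_finite_measure "Pi\<^sub>M I (\<lambda>_. lborel :: real measure)"
    by (rule sigma_finite) (simp add: I_def)
  interpret P: pair_sigma_finite "Pi\<^sub>M I (\<lambda>_. lborel :: real measure)" "lborel :: real measure" ..
  have ins: "insert r I = UNIV" by (auto simp: I_def)
  define g where "g y = f y * indicator orthant y" for y
  have g[measurable]: "g \<in> borel_measurable borel" unfolding g_def by measurable
  define w where "w y s = (vec_lambda (y(r := s - (\<Sum>k\<in>I. y k))) :: real ^ 'n)" for y s
  have w[measurable]: "(\<lambda>(y, s). w y s) \<in> borel_measurable (Pi\<^sub>M I (\<lambda>_. lborel) \<Otimes>\<^sub>M lborel)"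
  proof (rule borel_measurable_vecI)
    fix k
    show "(\<lambda>x. (case x of (y, s) \<Rightarrow> w y s) $ k) \<in> borel_measurable (Pi\<^sub>M I (\<lambda>_. lborel) \<Otimes>\<^sub>M lborel)"
    proof (cases "k = r")
      case True
      then show ?thesis by (simp add: w_def split_beta')
    next
      case False
      then have "k \<in> I" by (simp add: I_def)
      then have "(\<lambda>x. fst x k) \<in> borel_measurable (Pi\<^sub>M I (\<lambda>_. lborel) \<Otimes>\<^sub>M (lborel :: real measure))"
        by measurable
      with False show ?thesis by (simp add: w_def split_beta')
    qed
  qed
  have v: "vec_lambda \<in> measurable (Pi\<^sub>M UNIV (\<lambda>_. lborel)) (borel :: (real ^ 'n) measure)"
    by (rule measurable_vec_lambda) simp
  have "(\<integral>\<^sup>+y. g y \<partial>lborel) = (\<integral>\<^sup>+x. g (vec_lambda x) \<partial>Pi\<^sub>M (insert r I) (\<lambda>_. lborel))"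
    unfolding ins lborel_vec[symmetric] by (rule nn_integral_distr[OF v]) simp
  also have "\<dots> = (\<integral>\<^sup>+y. \<integral>\<^sup>+t. g (vec_lambda (y(r := t))) \<partial>lborel \<partial>Pi\<^sub>M I (\<lambda>_. lborel))"
    by (rule product_nn_integral_insert) (use measurable_compose[OF v g] ins in \<open>auto simp: I_def\<close>)
  also have "\<dots> = (\<integral>\<^sup>+y. \<integral>\<^sup>+s. g (w y s) \<partial>lborel \<partial>Pi\<^sub>M I (\<lambda>_. lborel))"
  proof (rule nn_integral_cong)
    fix y
    have "(\<lambda>t. g (vec_lambda (y(r := t)))) \<in> borel_measurable borel" by measurable
    from nn_integral_real_affine[OF this, of 1 "- (\<Sum>k\<in>I. y k)"]
    show "(\<integral>\<^sup>+t. g (vec_lambda (y(r := t))) \<partial>lborel) = (\<integral>\<^sup>+s. g (w y s) \<partial>lborel)"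
      unfolding w_def by (simp add: add.commute[of "- x" for x])
  qed
  also have "\<dots> = (\<integral>\<^sup>+s. \<integral>\<^sup>+y. g (w y s) \<partial>Pi\<^sub>M I (\<lambda>_. lborel) \<partial>lborel)"
    by (rule P.Fubini'[symmetric]) measurable
  also have "\<dots> = (\<integral>\<^sup>+s\<in>{0..}. ennreal (s ^ (CARD('n) - 1)) * (\<integral>\<^sup>+x. f (s *\<^sub>R x) \<partial>simplex_lebesgue r) \<partial>lborel)"
  proof (rule nn_integral_cong_AE)
    \<comment> \<open>At \<open>s = 0\<close> the scaling degenerates, so this null set is left
      out.\<close>
    have "AE s in lborel. s \<noteq> (0::real)" by (rule AE_lborel_singleton)
    then show "AE s in lborel. (\<integral>\<^sup>+y. g (w y s) \<partial>Pi\<^sub>M I (\<lambda>_. lborel)) =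
      ennreal (s ^ (CARD('n) - 1)) * (\<integral>\<^sup>+x. f (s *\<^sub>R x) \<partial>simplex_lebesgue r) * indicator {0..} s"
    proof eventually_elim
      case (elim s)
      have sum_w: "(\<Sum>k\<in>UNIV. w y s $ k) = s" for y
        by (subst sum.remove[of _ r]) (auto simp: w_def I_def)
      show ?case
      proof (cases "0 < s")
        case False
        with elim have s: "s < 0" by simp
        have "w y s \<notin> orthant" for y
        proof
          assume "w y s \<in> orthant"
          then have "0 \<le> (\<Sum>k\<in>UNIV. w y s $ k)" by (intro sum_nonneg) (auto simp: orthant_def)
          with s show False by (simp add: sum_w)
        qed
        with s show ?thesis by (simp add: g_def)
      next
        case s: True
        have wm: "(\<lambda>y. g (w y s)) \<in> borel_measurable (Pi\<^sub>M I (\<lambda>_. lborel))"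
          using measurable_compose[OF measurable_compose[OF measurable_Pair2'[of s lborel] w] g] by simp
        have ws: "w (\<lambda>i\<in>I. s * x i) s = s *\<^sub>R simplex_chart r x" for x
          by (auto simp: w_def simplex_chart_def vec_eq_iff I_def sum_distrib_left right_diff_distrib)
        have "g (s *\<^sub>R simplex_chart r x) = f (s *\<^sub>R simplex_chart r x) * indicator std_simplex (simplex_chart r x)" for x
        proof -
          have "s *\<^sub>R simplex_chart r x \<in> orthant \<longleftrightarrow> (\<forall>k. 0 \<le> simplex_chart r x $ k)"
            using s by (simp add: orthant_def zero_le_mult_iff)
          also have "\<dots> \<longleftrightarrow> simplex_chart r x \<in> std_simplex"
          proof
            assume *: "\<forall>k. 0 \<le> simplex_chart r x $ k"
            have "simplex_chart r x $ k \<le> 1" for k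
              using member_le_sum[of k UNIV "\<lambda>k. simplex_chart r x $ k"] * by (simp add: sum_simplex_chart)
            with * show "simplex_chart r x \<in> std_simplex"
              by (simp add: std_simplex_def sum_simplex_chart)
          qed (simp add: std_simplex_def)
          finally show ?thesis by (auto simp: g_def split: split_indicator)
        qed
        then have "(\<integral>\<^sup>+y. g (w y s) \<partial>Pi\<^sub>M I (\<lambda>_. lborel)) = ennreal (s ^ card I) *
            (\<integral>\<^sup>+x. f (s *\<^sub>R simplex_chart r x) * indicator std_simplex (simplex_chart r x) \<partial>Pi\<^sub>M I (\<lambda>_. lborel))"
          using nn_integral_PiM_lborel_scale[OF _ wm s] unfolding ws by (simp add: I_def)
        with s show ?thesis
          by (simp add: nn_integral_simplex_lebesgue I_def card_Diff_singleton)
      qed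
    qed
  qed
  finally show ?thesis by (simp add: g_def)
qed

text \<open>If the two functions differ at \<open>x\<close>, a constant \<open>c\<close> separates
  them on a small ball, whose measure is positive and finite. Comparison on bounded subsets of
  \<open>U\<close> is enough for this, and it is what the identification of the density on the
  corner provides.\<close>

lemma continuous_densities_unique:
  fixes f g :: "'a::euclidean_space \<Rightarrow> real"
  assumes U: "open U" and cf: "continuous_on U f" and cg: "continuous_on U g"
    and pos: "\<And>y. y \<in> U \<Longrightarrow> 0 \<le> f y" "\<And>y. y \<in> U \<Longrightarrow> 0 \<le> g y"
    and m[measurable]: "f \<in> borel_measurable borel" "g \<in> borel_measurable borel"
    and eq: "\<And>A. A \<in> sets borel \<Longrightarrow> bounded A \<Longrightarrow> A \<subseteq> U \<Longrightarrow>
       (\<integral>\<^sup>+y\<in>A. ennreal (f y) \<partial>lborel) = (\<integral>\<^sup>+y\<in>A. ennreal (g y) \<partial>lborel)"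
    and x: "x \<in> U"
  shows "f x = g x"
proof -
  have *: "\<not> f x < g x" if cf: "continuous_on U f" and cg: "continuous_on U g"
    and pos: "\<And>y. y \<in> U \<Longrightarrow> 0 \<le> f y" "\<And>y. y \<in> U \<Longrightarrow> 0 \<le> g y"
    and m[measurable]: "f \<in> borel_measurable borel" "g \<in> borel_measurable borel"
    and eq: "\<And>A. A \<in> sets borel \<Longrightarrow> bounded A \<Longrightarrow> A \<subseteq> U \<Longrightarrow>
       (\<integral>\<^sup>+y\<in>A. ennreal (f y) \<partial>lborel) = (\<integral>\<^sup>+y\<in>A. ennreal (g y) \<partial>lborel)" for f g
  proof
    assume lt: "f x < g x"
    define c where "c = (f x + g x) / 2"
    have c: "f x < c" "c < g x" using lt by (auto simp: c_def)
    have "open ({y \<in> U. f y < c} \<inter> {y \<in> U. c < g y})"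
      using continuous_openin_preimage_gen[OF cf, of "{..<c}"] continuous_openin_preimage_gen[OF cg, of "{c<..}"] U
      by (intro open_Int)
         (auto simp: openin_open_eq vimage_def Int_def conj_commute dest: openin_open_eq[OF U, THEN iffD1])
    then obtain e where e: "0 < e" "ball x e \<subseteq> {y \<in> U. f y < c} \<inter> {y \<in> U. c < g y}"
      using x c by (subst (asm) open_contains_ball) blast
    define A where "A = ball x e"
    have A: "A \<in> sets borel" "bounded A" "A \<subseteq> U" using e by (auto simp: A_def)
    have fin: "emeasure lborel A < \<infinity>" using emeasure_bounded_finite[OF A(2)] by simp
    have posA: "emeasure lborel A \<noteq> 0"
      using open_not_negligible[of A] e A by (auto simp: A_def negligible_iff_emeasure0)
    have c0: "0 < c" using c pos(1)[OF x] by linarith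
    have f_le: "(\<integral>\<^sup>+y\<in>A. ennreal (f y) \<partial>lborel) \<le> ennreal c * emeasure lborel A"
    proof -
      have "(\<integral>\<^sup>+y\<in>A. ennreal (f y) \<partial>lborel) \<le> (\<integral>\<^sup>+y. ennreal c * indicator A y \<partial>lborel)"
      proof (intro nn_integral_mono)
        fix y
        have "ennreal (f y) \<le> ennreal c" if "y \<in> A"
          using e that by (intro ennreal_leI) (auto simp: A_def intro: less_imp_le)
        then show "ennreal (f y) * indicator A y \<le> ennreal c * indicator A y"
          by (auto split: split_indicator)
      qed
      then show ?thesis using A by (simp add: nn_integral_cmult_indicator)
    qed
    \<comment> \<open>Integrals in \<open>ennreal\<close> are not subtracted: \<open>g\<close> is
      \<open>c\<close> plus an excess, and the comparison with \<open>f\<close> forces the integral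
      of the excess to vanish.\<close>
    have split: "ennreal c * indicator A y + ennreal (g y - c) * indicator A y = ennreal (g y) * indicator A y" for y
    proof (cases "y \<in> A")
      case True
      then have "c \<le> g y" using e by (auto simp: A_def intro: less_imp_le)
      with True c0 show ?thesis by (simp flip: ennreal_plus)
    qed simp
    have "(\<integral>\<^sup>+y\<in>A. ennreal (g y) \<partial>lborel) = (\<integral>\<^sup>+y. ennreal c * indicator A y \<partial>lborel)
        + (\<integral>\<^sup>+y. ennreal (g y - c) * indicator A y \<partial>lborel)"
      unfolding split[symmetric] by (rule nn_integral_add) (use A in measurable)
    also have "(\<integral>\<^sup>+y. ennreal c * indicator A y \<partial>lborel) = ennreal c * emeasure lborel A"
      using A by (simp add: nn_integral_cmult_indicator)
    finally have "ennreal c * emeasure lborel A + (\<integral>\<^sup>+y. ennreal (g y - c) * indicator A y \<partial>lborel)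
        \<le> ennreal c * emeasure lborel A + 0"
      using f_le eq[OF A] by simp
    moreover have "ennreal c * emeasure lborel A \<noteq> \<infinity>"
      using fin by (simp add: ennreal_mult_eq_top_iff)
    ultimately have "(\<integral>\<^sup>+y. ennreal (g y - c) * indicator A y \<partial>lborel) = 0"
      by (metis ennreal_add_left_cancel_le infinity_ennreal_def le_zero_eq)
    then have "AE y in lborel. ennreal (g y - c) * indicator A y = 0"
      by (subst (asm) nn_integral_0_iff_AE) (use A in auto)
    then have "AE y in lborel. y \<notin> A"
      by eventually_elim (use e in \<open>auto simp: A_def split: split_indicator_asm\<close>)
    then have "emeasure lborel A = 0"
      using A by (subst (asm) AE_iff_measurable[of A]) auto
    with posA show False by simp
  qed
  show ?thesis
    using *[OF cf cg pos m eq] *[OF cg cf pos(2,1) m(2,1) eq[symmetric]] by force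
qed

section \<open>Functionals determined by smooth functions\<close>

text \<open>The properties that characterise integration against a Borel measure. With them an
  identity between composite integrals extends from smooth to measurable functions without
  exhibiting the measures.\<close>

definition integral_functional :: "(('a::topological_space \<Rightarrow> ennreal) \<Rightarrow> ennreal) \<Rightarrow> bool" where
  "integral_functional \<Phi> \<longleftrightarrow>
     (\<forall>c. \<forall>f\<in>borel_measurable borel. \<Phi> (\<lambda>x. c * f x) = c * \<Phi> f) \<and>
     (\<forall>f\<in>borel_measurable borel. \<forall>g\<in>borel_measurable borel. \<Phi> (\<lambda>x. f x + g x) = \<Phi> f + \<Phi> g) \<and>
     (\<forall>U. (\<forall>n::nat. U n \<in> borel_measurable borel) \<longrightarrow> incseq U \<longrightarrow>
        \<Phi> (\<lambda>x. SUP n. U n x) = (SUP n. \<Phi> (U n)))"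

lemma integral_functionalD:
  assumes "integral_functional \<Phi>"
  shows "f \<in> borel_measurable borel \<Longrightarrow> \<Phi> (\<lambda>x. c * f x) = c * \<Phi> f"
    and "f \<in> borel_measurable borel \<Longrightarrow> g \<in> borel_measurable borel \<Longrightarrow> \<Phi> (\<lambda>x. f x + g x) = \<Phi> f + \<Phi> g"
    and "(\<And>n. U n \<in> borel_measurable borel) \<Longrightarrow> incseq U \<Longrightarrow> \<Phi> (\<lambda>x. SUP n. U n x) = (SUP n::nat. \<Phi> (U n))"
  using assms unfolding integral_functional_def by blast+

lemma integral_functional_mono:
  assumes \<Phi>: "integral_functional \<Phi>" and [measurable]: "f \<in> borel_measurable borel" "g \<in> borel_measurable borel"
    and le: "\<And>x. f x \<le> g x"
  shows "\<Phi> f \<le> \<Phi> g"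
proof -
  have "\<Phi> (\<lambda>x. f x + (g x - f x)) = \<Phi> f + \<Phi> (\<lambda>x. g x - f x)"
    by (rule integral_functionalD(2)[OF \<Phi>]) measurable
  moreover have "(\<lambda>x. f x + (g x - f x)) = g"
    using le by (auto simp: fun_eq_iff add_diff_inverse_ennreal)
  ultimately show ?thesis by simp
qed

lemma integral_functional_incseq:
  assumes "integral_functional \<Phi>" "\<And>n::nat. U n \<in> borel_measurable borel" "incseq U"
  shows "incseq (\<lambda>n. \<Phi> (U n))"
proof (rule incseq_SucI)
  fix n
  show "\<Phi> (U n) \<le> \<Phi> (U (Suc n))"
    by (rule integral_functional_mono[OF assms(1,2,2)]) (rule le_funD[OF incseq_SucD[OF assms(3)]])
qed

text \<open>The values at indicators form a measure: countable additivity is continuity along the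
  increasing partial sums. Induction over nonnegative measurable functions does the rest.\<close>

lemma integral_functional_measure:
  assumes \<Phi>: "integral_functional \<Phi>"
  obtains N where "sets N = sets borel" "\<And>f. f \<in> borel_measurable borel \<Longrightarrow> \<Phi> f = (\<integral>\<^sup>+x. f x \<partial>N)"
proof -
  define N where "N = measure_of UNIV (sets borel) (\<lambda>A. \<Phi> (indicator A))"
  have sN: "sets N = sets borel"
    unfolding N_def by (simp add: sets.sigma_sets_eq[of borel, simplified])
  have mN: "f \<in> borel_measurable N \<longleftrightarrow> f \<in> borel_measurable borel" for f :: "'a \<Rightarrow> ennreal"
    using measurable_cong_sets[OF sN refl] by blast
  have zero: "\<Phi> (\<lambda>_. 0) = 0"
    using integral_functionalD(1)[OF \<Phi>, of "\<lambda>_. 0" 0] by simp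
  have fin: "\<Phi> (\<lambda>x. \<Sum>k<n. f k x) = (\<Sum>k<n. \<Phi> (f k))"
    if "\<And>k. f k \<in> borel_measurable borel" for f and n :: nat
  proof (induction n)
    case (Suc n)
    have "\<Phi> (\<lambda>x. (\<Sum>k<n. f k x) + f n x) = \<Phi> (\<lambda>x. \<Sum>k<n. f k x) + \<Phi> (f n)"
      using that by (intro integral_functionalD(2)[OF \<Phi>]) auto
    with Suc show ?case by simp
  qed (simp add: zero)
  have em: "emeasure N A = \<Phi> (indicator A)" if A: "A \<in> sets borel" for A
  proof (rule emeasure_measure_of[OF N_def])
    show "positive (sets N) (\<lambda>A. \<Phi> (indicator A))"
      using zero by (simp add: positive_def indicator_def[abs_def])
    show "countably_additive (sets N) (\<lambda>A. \<Phi> (indicator A))"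
    proof (rule countably_additiveI)
      fix A :: "nat \<Rightarrow> 'a set" assume A: "range A \<subseteq> sets N" "disjoint_family A"
      have [measurable]: "A k \<in> sets borel" for k using A sN by auto
      define U where "U n x = (\<Sum>k<n. indicator (A k) x :: ennreal)" for n x
      have inc: "incseq U"
        by (rule incseq_SucI) (auto simp: U_def le_fun_def)
      have "(\<Sum>k. \<Phi> (indicator (A k))) = (SUP n. \<Phi> (U n))"
        unfolding suminf_eq_SUP U_def by (subst fin) auto
      also have "\<dots> = \<Phi> (\<lambda>x. SUP n. U n x)"
        by (rule integral_functionalD(3)[OF \<Phi> _ inc, symmetric]) (simp add: U_def[abs_def])
      also have "(\<lambda>x. SUP n. U n x) = indicator (\<Union>k. A k)"
        using suminf_indicator[OF A(2)] unfolding U_def suminf_eq_SUP by (auto simp: fun_eq_iff)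
      finally show "(\<Sum>k. \<Phi> (indicator (A k))) = \<Phi> (indicator (\<Union>k. A k))" .
    qed
  qed (use A sN in auto)
  have "\<Phi> f = (\<integral>\<^sup>+x. f x \<partial>N)" if f: "f \<in> borel_measurable borel" for f
    using f
  proof (induction f rule: borel_measurable_induct)
    case (cong f g)
    then have "f = g" by auto
    with cong show ?case by simp
  next
    case (set A)
    then show ?case using em sN by simp
  next
    case (mult u c)
    then show ?case
      using integral_functionalD(1)[OF \<Phi>, of u c]
      by (simp add: mN nn_integral_cmult)
  next
    case (add u v)
    then show ?case
      using integral_functionalD(2)[OF \<Phi>, of v u]
      by (simp add: mN nn_integral_add)
  next
    case (seq U)
    then have "(\<integral>\<^sup>+x. (SUP n. U n x) \<partial>N) = (SUP n. \<integral>\<^sup>+x. U n x \<partial>N)"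
      by (intro nn_integral_monotone_convergence_SUP) (simp_all add: mN)
    with seq show ?case
      using integral_functionalD(3)[OF \<Phi>, of U] by (simp add: image_comp SUP_apply[abs_def])
  qed
  with sN that show ?thesis by blast
qed

lemma integral_functional_nn_integral:
  assumes [measurable]: "h \<in> borel_measurable M"
  shows "integral_functional (\<lambda>f. \<integral>\<^sup>+x. f (h x) \<partial>M)"
  unfolding integral_functional_def
proof (intro conjI allI ballI impI)
  fix U :: "nat \<Rightarrow> 'b \<Rightarrow> ennreal"
  assume U: "\<forall>n. U n \<in> borel_measurable borel" and "incseq U"
  have [measurable]: "U n \<in> borel_measurable borel" for n using U by blast
  from \<open>incseq U\<close> show "(\<integral>\<^sup>+x. (SUP n. U n (h x)) \<partial>M) = (SUP n. \<integral>\<^sup>+x. U n (h x) \<partial>M)"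
    by (intro nn_integral_monotone_convergence_SUP) (auto simp: incseq_def le_fun_def)
qed (auto simp: nn_integral_cmult nn_integral_add)

lemma integral_functional_add:
  assumes "integral_functional \<Phi>" "integral_functional \<Psi>"
  shows "integral_functional (\<lambda>f. \<Phi> f + \<Psi> f)"
  using assms unfolding integral_functional_def
  by (auto simp: distrib_left add_ac ennreal_SUP_add integral_functional_incseq[OF assms(1)]
      integral_functional_incseq[OF assms(2)])

text \<open>Closure under mixtures, needed for the integral in \<open>s\<close> on the right of
  Duhamel's formula.\<close>

lemma integral_functional_integral:
  fixes \<Phi> :: "'b \<Rightarrow> ('a::topological_space \<Rightarrow> ennreal) \<Rightarrow> ennreal"
  assumes \<Phi>: "\<And>s. integral_functional (\<Phi> s)"
    and m: "\<And>f. f \<in> borel_measurable borel \<Longrightarrow> (\<lambda>s. \<Phi> s f) \<in> borel_measurable M"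
    and w[measurable]: "w \<in> borel_measurable M"
  shows "integral_functional (\<lambda>f. \<integral>\<^sup>+s. w s * \<Phi> s f \<partial>M)"
  unfolding integral_functional_def
proof (intro conjI allI ballI impI)
  fix U :: "nat \<Rightarrow> 'a \<Rightarrow> ennreal"
  assume U: "\<forall>n. U n \<in> borel_measurable borel" and inc: "incseq U"
  have [measurable]: "(\<lambda>s. \<Phi> s (U n)) \<in> borel_measurable M" for n using m U by blast
  have "(\<integral>\<^sup>+s. w s * \<Phi> s (\<lambda>x. SUP n. U n x) \<partial>M) = (\<integral>\<^sup>+s. (SUP n. w s * \<Phi> s (U n)) \<partial>M)"
    using U by (intro nn_integral_cong) (simp add: integral_functionalD(3)[OF \<Phi> _ inc] SUP_mult_left_ennreal)
  also have "\<dots> = (SUP n. \<integral>\<^sup>+s. w s * \<Phi> s (U n) \<partial>M)"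
    using integral_functional_incseq[OF \<Phi> _ inc] U
    by (intro nn_integral_monotone_convergence_SUP)
       (auto simp: incseq_def le_fun_def intro!: mult_left_mono)
  finally show "(\<integral>\<^sup>+s. w s * \<Phi> s (\<lambda>x. SUP n. U n x) \<partial>M) = (SUP n. \<integral>\<^sup>+s. w s * \<Phi> s (U n) \<partial>M)" .
next
  fix f g :: "'a \<Rightarrow> ennreal" assume f: "f \<in> borel_measurable borel" and g: "g \<in> borel_measurable borel"
  note [measurable] = m[OF f] m[OF g]
  show "(\<integral>\<^sup>+s. w s * \<Phi> s (\<lambda>x. f x + g x) \<partial>M) = (\<integral>\<^sup>+s. w s * \<Phi> s f \<partial>M) + (\<integral>\<^sup>+s. w s * \<Phi> s g \<partial>M)"
    by (subst nn_integral_add[symmetric])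
       (auto simp: integral_functionalD(2)[OF \<Phi> f g] distrib_left)
  fix c :: ennreal
  show "(\<integral>\<^sup>+s. w s * \<Phi> s (\<lambda>x. c * f x) \<partial>M) = c * (\<integral>\<^sup>+s. w s * \<Phi> s f \<partial>M)"
    by (subst nn_integral_cmult[symmetric])
       (auto simp: integral_functionalD(1)[OF \<Phi> f] mult_ac)
qed

lemma integral_functional_cmult:
  assumes "integral_functional \<Phi>"
  shows "integral_functional (\<lambda>f. c * \<Phi> f)"
  using integral_functional_integral[of "\<lambda>_. \<Phi>" "count_space {()}" "\<lambda>_. c"] assms
  by (simp add: nn_integral_count_space_finite)

lemma integral_functional_zero: "integral_functional (\<lambda>_. 0)"
  by (simp add: integral_functional_def)

lemma integral_functional_sum:
  assumes "\<And>i. i \<in> I \<Longrightarrow> integral_functional (\<Phi> i)"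
  shows "integral_functional (\<lambda>f. \<Sum>i\<in>I. \<Phi> i f)"
  using assms
  by (induction I rule: infinite_finite_induct)
     (auto intro!: integral_functional_zero integral_functional_add)

text \<open>The squared positive parts are continuously differentiable and vanish together exactly
  on \<open>{..b}\<close>, for the componentwise order. Multiplied by \<open>m\<close> they drive
  the quotient to 0 outside that set.\<close>

definition cutoff :: "real ^ 'n \<Rightarrow> nat \<Rightarrow> real ^ 'n::finite \<Rightarrow> real" where
  "cutoff b m y = 1 / (1 + real m * (\<Sum>k\<in>UNIV. (max 0 (y $ k - b $ k))\<^sup>2))"

lemma max_square_deriv: "((\<lambda>t::real. (max 0 t)\<^sup>2) has_real_derivative 2 * max 0 t) (at t)"
proof -
  consider "t = 0" | "t > 0" | "t < 0" by linarith
  then show ?thesis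
  proof cases
    case 1
    have "(\<lambda>h::real. max 0 h) \<midarrow>0\<rightarrow> max 0 0"
      by (intro tendsto_intros)
    moreover have "(\<lambda>h::real. ((max 0 (0 + h))\<^sup>2 - (max 0 0)\<^sup>2) / h) \<midarrow>0\<rightarrow> 0 \<longleftrightarrow> (\<lambda>h::real. max 0 h) \<midarrow>0\<rightarrow> 0"
      by (rule LIM_equal) (auto simp: max_def power2_eq_square)
    ultimately show ?thesis using 1 by (simp add: DERIV_def)
  next
    case 2
    have "((\<lambda>t::real. t\<^sup>2) has_real_derivative 2 * max 0 t) (at t)"
      using 2 by (auto intro!: derivative_eq_intros)
    then show ?thesis
      by (rule DERIV_cong_ev[THEN iffD1, rotated -1])
         (use 2 eventually_nhds_in_open[of "{0<..}" t] in \<open>auto elim!: eventually_mono\<close>)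
  next
    case 3
    have "((\<lambda>t::real. 0) has_real_derivative 2 * max 0 t) (at t)"
      using 3 by (auto intro!: derivative_eq_intros)
    then show ?thesis
      by (rule DERIV_cong_ev[THEN iffD1, rotated -1])
         (use 3 eventually_nhds_in_open[of "{..<0}" t] in \<open>auto elim!: eventually_mono\<close>)
  qed
qed

lemma has_gradient_cutoff: "\<exists>g. has_gradient (cutoff b m :: real ^ 'n::finite \<Rightarrow> real) g"
proof -
  define v where "v y = 1 + real m * (\<Sum>k\<in>UNIV. (max 0 (y $ k - b $ k))\<^sup>2)" for y :: "real ^ 'n"
  define gv where "gv y = (\<chi> k. real m * (2 * max 0 (y $ k - b $ k)))" for y :: "real ^ 'n"
  have v1: "1 \<le> v y" for y by (auto simp: v_def intro!: mult_nonneg_nonneg sum_nonneg)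
  have d1: "((\<lambda>y :: real ^ 'n. (max 0 (y $ k - b $ k))\<^sup>2) has_derivative (\<lambda>h. 2 * max 0 (y $ k - b $ k) * h $ k)) (at y)" for y k
  proof -
    have "((\<lambda>y :: real ^ 'n. y $ k - b $ k) has_derivative (\<lambda>h. h $ k)) (at y)"
      by (rule has_derivative_eq_rhs[OF has_derivative_diff[OF bounded_linear_imp_has_derivative[OF bounded_linear_vec_nth] has_derivative_const]]) simp
    from has_derivative_compose[OF this max_square_deriv[unfolded has_field_derivative_def]] show ?thesis .
  qed
  have dv: "(v has_derivative (\<lambda>h. gv y \<bullet> h)) (at y)" for y
    unfolding v_def[abs_def]
    by (rule has_derivative_eq_rhs[OF has_derivative_add[OF has_derivative_const
          has_derivative_mult_right[OF has_derivative_sum[OF d1]]]])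
       (simp add: fun_eq_iff gv_def inner_vec_def sum_distrib_left mult_ac)
  have cv: "continuous_on UNIV v" unfolding v_def by (intro continuous_intros)
  have "(cutoff b m has_derivative (\<lambda>h. ((- 1 / (v y)\<^sup>2) *\<^sub>R gv y) \<bullet> h)) (at y)" for y
  proof -
    have "((\<lambda>t::real. 1 / t) has_derivative (\<lambda>h. (- 1 / (v y)\<^sup>2) * h)) (at (v y))"
      using v1[of y] by (auto intro!: derivative_eq_intros simp: fun_eq_iff power2_eq_square divide_simps)
    from has_derivative_compose[OF dv this] show ?thesis
      by (simp add: cutoff_def[abs_def] v_def)
  qed
  moreover have "continuous_on UNIV (\<lambda>y. (- 1 / (v y)\<^sup>2) *\<^sub>R gv y)"
  proof (intro continuous_intros cv)
    show "continuous_on UNIV gv"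
      unfolding gv_def by (intro continuous_on_vec_lambda continuous_intros)
    show "\<forall>y\<in>UNIV. (v y)\<^sup>2 \<noteq> 0" using v1 by (metis not_one_le_zero power2_eq_square mult_eq_0_iff)
  qed
  ultimately have "has_gradient (cutoff b m) (\<lambda>y. (- 1 / (v y)\<^sup>2) *\<^sub>R gv y)"
    unfolding has_gradient_def by blast
  then show ?thesis by (rule exI[of "has_gradient (cutoff b m)"])
qed

lemma cutoff_bounds: "0 \<le> cutoff b m y" "cutoff b m y \<le> 1"
proof -
  have "0 \<le> real m * (\<Sum>k\<in>UNIV. (max 0 (y $ k - b $ k))\<^sup>2)"
    by (intro mult_nonneg_nonneg sum_nonneg) auto
  then show "0 \<le> cutoff b m y" "cutoff b m y \<le> 1" by (auto simp: cutoff_def)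
qed

lemma cutoff_tendsto: "(\<lambda>m. cutoff b m y) \<longlonglongrightarrow> indicator {..b} y"
proof (cases "y \<le> b")
  case True
  then have "max 0 (y $ k - b $ k) = 0" for k by (auto simp: less_eq_vec_def)
  with True show ?thesis by (simp add: cutoff_def)
next
  case False
  then obtain k where k: "b $ k < y $ k" by (auto simp: less_eq_vec_def not_le)
  define d where "d = (\<Sum>k\<in>UNIV. (max 0 (y $ k - b $ k))\<^sup>2)"
  have "0 < (max 0 (y $ k - b $ k))\<^sup>2" using k by auto
  also have "\<dots> \<le> d" unfolding d_def by (rule member_le_sum) auto
  finally have d: "0 < d" .
  have "filterlim (\<lambda>m. d * real m) at_top sequentially"
    using d by (intro filterlim_tendsto_pos_mult_at_top[OF tendsto_const] filterlim_real_sequentially)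
  then have "filterlim (\<lambda>m. 1 + d * real m) at_infinity sequentially"
    by (intro filterlim_at_top_imp_at_infinity filterlim_tendsto_add_at_top[OF tendsto_const])
  then have "(\<lambda>m. 1 / (1 + d * real m)) \<longlonglongrightarrow> 0"
    by (rule tendsto_divide_0[OF tendsto_const])
  with False show ?thesis by (simp add: cutoff_def d_def mult.commute)
qed

text \<open>The cutoffs are nonnegative test functions and converge to the indicators of the sets
  \<open>{..b}\<close>, which are stable under intersection and generate the Borel sets. The
  constant 1 is a test function too, so finiteness passes from one functional to the other.\<close>

lemma integral_functional_eqI:
  fixes \<Phi> \<Psi> :: "(real ^ 'n::finite \<Rightarrow> ennreal) \<Rightarrow> ennreal"
  assumes \<Phi>: "integral_functional \<Phi>" and \<Psi>: "integral_functional \<Psi>" and fin: "\<Phi> (\<lambda>_. 1) < \<infinity>"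
    and eq: "\<And>f g. has_gradient f g \<Longrightarrow> (\<And>y. 0 \<le> f y) \<Longrightarrow> \<Phi> (\<lambda>y. ennreal (f y)) = \<Psi> (\<lambda>y. ennreal (f y))"
    and f: "f \<in> borel_measurable borel"
  shows "\<Phi> f = \<Psi> f"
proof -
  obtain M where M: "sets M = sets borel" "\<And>f. f \<in> borel_measurable borel \<Longrightarrow> \<Phi> f = (\<integral>\<^sup>+x. f x \<partial>M)"
    using integral_functional_measure[OF \<Phi>] by blast
  obtain N where N: "sets N = sets borel" "\<And>f. f \<in> borel_measurable borel \<Longrightarrow> \<Psi> f = (\<integral>\<^sup>+x. f x \<partial>N)"
    using integral_functional_measure[OF \<Psi>] by blast
  note [measurable_cong] = M(1) N(1)
  have spM: "space M = UNIV" "space N = UNIV"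
    using sets_eq_imp_space_eq[OF M(1)] sets_eq_imp_space_eq[OF N(1)] by auto
  have fM: "(\<integral>\<^sup>+x. 1 \<partial>M) < \<infinity>" using fin M(2)[of "\<lambda>_. 1"] by simp
  have "\<Psi> (\<lambda>_. 1) = \<Phi> (\<lambda>_. 1)"
    using eq[OF has_gradient_const[of 1]] by simp
  then have fN: "(\<integral>\<^sup>+x. 1 \<partial>N) < \<infinity>" using fin N(2)[of "\<lambda>_. 1"] by simp
  have cut: "cutoff b m \<in> borel_measurable borel" for b :: "real ^ 'n" and m
    using has_gradient_cutoff[of b m] by (auto dest: has_gradient_measurable)
  note [measurable] = cut
  have lim: "(\<lambda>m. \<integral>\<^sup>+y. ennreal (cutoff b m y) \<partial>L) \<longlonglongrightarrow> (\<integral>\<^sup>+y. ennreal (indicator {..b} y) \<partial>L)"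
    if "(\<integral>\<^sup>+x. 1 \<partial>L) < \<infinity>" and L[measurable_cong]: "sets L = sets borel" for L and b :: "real ^ 'n"
  proof (rule nn_integral_dominated_convergence[where w = "\<lambda>_. 1"])
    show "AE x in L. (\<lambda>m. ennreal (cutoff b m x)) \<longlonglongrightarrow> ennreal (indicator {..b} x)"
      by (intro AE_I2 tendsto_ennrealI cutoff_tendsto)
    show "AE x in L. ennreal (cutoff b j x) \<le> 1" for j
      using cutoff_bounds by (intro AE_I2) (simp add: ennreal_le_1)
  qed (use that in measurable)
  have box: "emeasure M {..b} = emeasure N {..b}" for b
  proof -
    have "(\<integral>\<^sup>+y. ennreal (cutoff b m y) \<partial>M) = (\<integral>\<^sup>+y. ennreal (cutoff b m y) \<partial>N)" for m
    proof -
      obtain g where "has_gradient (cutoff b m) g" using has_gradient_cutoff by blast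
      from eq[OF this cutoff_bounds(1)] show ?thesis by (simp add: M(2) N(2))
    qed
    then have "(\<integral>\<^sup>+y. ennreal (indicator {..b} y) \<partial>M) = (\<integral>\<^sup>+y. ennreal (indicator {..b} y) \<partial>N)"
      using LIMSEQ_unique[OF lim[OF fM M(1), of b]] lim[OF fN N(1), of b] by simp
    then show ?thesis using M(1) N(1) by (simp add: ennreal_indicator)
  qed
  have "M = N"
  proof (rule measure_eqI_generator_eq[where E = "range (\<lambda>a. {..a})" and \<Omega> = UNIV and A = "\<lambda>n. {.. (\<chi> k. real n)}"])
    show "Int_stable (range (\<lambda>a :: real ^ 'n. {..a}))"
    proof (rule Int_stableI_image)
      fix a b :: "real ^ 'n"
      show "\<exists>c\<in>UNIV. {..a} \<inter> {..b} = {..c}"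
        by (intro bexI[of _ "\<chi> k. min (a $ k) (b $ k)"]) (auto simp: less_eq_vec_def)
    qed
    show "sets M = sigma_sets UNIV (range (\<lambda>a. {..a}))" "sets N = sigma_sets UNIV (range (\<lambda>a. {..a}))"
      unfolding M(1) N(1) borel_eq_atMost by simp_all
    show "(\<Union>n. {.. (\<chi> k. real n)}) = (UNIV :: (real ^ 'n) set)"
    proof -
      have "\<exists>n. x \<le> (\<chi> k. real n)" for x :: "real ^ 'n"
      proof -
        obtain n where "norm x \<le> real n" using real_arch_simple by blast
        then have "x $ k \<le> real n" for k using component_le_norm_cart[of x k] by linarith
        then show ?thesis by (auto simp: less_eq_vec_def)
      qed
      then show ?thesis by auto
    qed
    fix n
    have "emeasure M {.. (\<chi> k. real n)} \<le> emeasure M (space M)" by (rule emeasure_space)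
    also have "\<dots> < \<infinity>" using fM by simp
    finally show "emeasure M {.. (\<chi> k. real n)} \<noteq> \<infinity>" by simp
  qed (use box in auto)
  then show ?thesis using M(2)[OF f] N(2)[OF f] by simp
qed

section \<open>Stationary measures of the zig-zag process\<close>

lemma std_simplexD:
  assumes "x \<in> std_simplex"
  shows "0 \<le> x $ k" "x $ k \<le> 1" "(\<Sum>k\<in>UNIV. x $ k) = 1"
  using assms by (auto simp: std_simplex_def)

lemma norm_std_simplex:
  assumes "x \<in> std_simplex"
  shows "norm (x :: real ^ 'n::finite) \<le> 1"
  using norm_le_l1_cart[of x] std_simplexD[OF assms] by simp

lemma has_gradient_line:
  fixes v w :: "'a::euclidean_space"
  assumes "has_gradient f g"
  shows "has_gradient (\<lambda>s::real. f (s *\<^sub>R v + w)) (\<lambda>s. g (s *\<^sub>R v + w) \<bullet> v)"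
proof -
  note 1 = has_gradientD[OF assms]
  have "((\<lambda>s. f (s *\<^sub>R v + w)) has_derivative (\<lambda>h. g (s *\<^sub>R v + w) \<bullet> (h *\<^sub>R v))) (at s)" for s
    by (rule has_derivative_compose[of "\<lambda>s. s *\<^sub>R v + w", OF _ 1(1)])
       (auto intro!: derivative_eq_intros)
  moreover have "continuous_on UNIV (\<lambda>s. g (s *\<^sub>R v + w) \<bullet> v)"
    by (intro continuous_intros continuous_on_compose2[OF 1(2)]) auto
  ultimately show ?thesis
    by (simp add: has_gradient_def mult.commute)
qed

text \<open>
  \<open>\<mu> i\<close> is the restriction of the stationary distribution to the state \<open>i\<close>, and
  \<open>B = a q + (m + 1) Id\<close> with \<open>m\<close> so large that \<open>B\<close> has nonnegative entries.
\<close>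

locale stationary_zigzag =
  fixes \<mu> :: "'n::finite \<Rightarrow> (real ^ 'n) measure" and B :: "'n \<Rightarrow> 'n \<Rightarrow> real" and m :: nat
  assumes sets_mu [simp, measurable_cong]: "\<And>i. sets (\<mu> i) = sets borel"
    and fin: "\<And>i. finite_measure (\<mu> i)"
    and supp: "\<And>i. AE x in \<mu> i. x \<in> std_simplex"
    and B_nonneg: "\<And>k i. 0 \<le> B k i"
    and B_row: "\<And>j. (\<Sum>i\<in>UNIV. B j i) = real (Suc m)"
    and weak: "\<And>f g i. has_gradient f g \<Longrightarrow>
      (\<integral>x. (axis i 1 - x) \<bullet> g x \<partial>\<mu> i) + (\<Sum>j\<in>UNIV. B j i * (\<integral>x. f x \<partial>\<mu> j))
        = real (Suc m) * (\<integral>x. f x \<partial>\<mu> i)"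
begin

lemma space_mu [simp]: "space (\<mu> i) = UNIV"
  using sets_eq_imp_space_eq[OF sets_mu] by simp

lemma sigma_finite_mu: "sigma_finite_measure (\<mu> i)"
  by (intro finite_measure.axioms(1) fin)

lemma integrable_mu:
  fixes u :: "real ^ 'n \<Rightarrow> real"
  assumes "continuous_on UNIV u"
  shows "integrable (\<mu> i) u"
proof -
  interpret finite_measure "\<mu> i" by (rule fin)
  obtain C where C: "\<And>x. norm x \<le> 1 \<Longrightarrow> norm (u x) \<le> C"
    using continuous_on_bounded_cball[OF assms, of 1] by blast
  have "u \<in> borel_measurable borel" using assms by (rule borel_measurable_continuous_onI)
  moreover have "AE x in \<mu> i. norm (u x) \<le> C"
    using supp[of i] by eventually_elim (rule C[OF norm_std_simplex])
  ultimately show ?thesis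
    by (intro integrable_const_bound[of _ C]) auto
qed

lemma nn_integral_mu:
  fixes u :: "real ^ 'n \<Rightarrow> real"
  assumes "continuous_on UNIV u" "\<And>x. 0 \<le> u x"
  shows "(\<integral>\<^sup>+x. ennreal (u x) \<partial>\<mu> i) = ennreal (\<integral>x. u x \<partial>\<mu> i)"
  using assms by (intro nn_integral_eq_integral integrable_mu) auto

text \<open>
  Duhamel's formula: the derivative in \<open>s\<close> of \<open>s ^ Suc m * \<integral>f (s x + (\<sigma> - s) e\<^sub>i) \<mu>\<^sub>i(dx)\<close> is given
  by the weak equation.
\<close>

lemma duhamel_smooth:
  assumes f: "has_gradient f g" and pos: "\<And>y. 0 \<le> f y" and \<sigma>: "1 \<le> \<sigma>"
  shows "ennreal (\<sigma> ^ Suc m) * (\<integral>\<^sup>+x. ennreal (f (\<sigma> *\<^sub>R x)) \<partial>\<mu> i) =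
     (\<integral>\<^sup>+x. ennreal (f (x + (\<sigma> - 1) *\<^sub>R axis i 1)) \<partial>\<mu> i) +
     (\<integral>\<^sup>+s. (ennreal (s ^ m) * indicator {1..\<sigma>} s) *
        (\<Sum>j\<in>UNIV. ennreal (B j i) * (\<integral>\<^sup>+x. ennreal (f (s *\<^sub>R x + (\<sigma> - s) *\<^sub>R axis i 1)) \<partial>\<mu> j)) \<partial>lborel)"
proof -
  note 1 = has_gradientD[OF f]
  define e where "e = (axis i 1 :: real ^ 'n)"
  \<comment> \<open>For \<open>x\<close> in the simplex \<open>s\<close> is the total weight at the
    last jump and \<open>\<sigma> - s\<close> the length of the stay in \<open>i\<close> that
    follows. The final weight \<sigma> is kept fixed while \<open>s\<close> runs from 1 to
    \<sigma>.\<close>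
  let ?y = "\<lambda>s x. (s *\<^sub>R (x - e) + \<sigma> *\<^sub>R e)"
  define k where "k j s = (\<integral>x. f (?y s x) \<partial>\<mu> j)" for j s
  define k' where "k' j s = (\<integral>x. g (?y s x) \<bullet> (x - e) \<partial>\<mu> j)" for j s
  have arg: "s *\<^sub>R (x - e) + \<sigma> *\<^sub>R e = s *\<^sub>R x + (\<sigma> - s) *\<^sub>R e" for s x
    by (simp add: algebra_simps)
  have c: "continuous_on UNIV (\<lambda>x. f (?y s x))"
    "continuous_on UNIV (\<lambda>x. g (?y s x) \<bullet> (x - e))" for s
    by (intro continuous_intros continuous_on_compose2[OF 1(2)] continuous_on_compose2[OF 1(3)]; auto)+
  have k: "has_gradient (k j) (k' j)" for j
    unfolding k_def[abs_def] k'_def[abs_def]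
  proof (rule has_gradient_integral[OF fin supp])
    show "has_gradient (\<lambda>s. f (?y s x)) (\<lambda>s. g (?y s x) \<bullet> (x - e))" for x
      by (rule has_gradient_line[OF f])
    show "(\<lambda>x. f (?y s x)) \<in> borel_measurable (\<mu> j)"
      "(\<lambda>x. g (?y s x) \<bullet> (x - e)) \<in> borel_measurable (\<mu> j)" for s
      using borel_measurable_continuous_onI[OF c(1)] borel_measurable_continuous_onI[OF c(2)] by auto
    fix R :: real
    obtain C where C: "\<And>y. norm y \<le> \<bar>R\<bar> * 2 + \<sigma> \<Longrightarrow> norm (f y) \<le> C" "C \<ge> 0"
      using continuous_on_bounded_cball[OF 1(3), of "\<bar>R\<bar> * 2 + \<sigma>"] by blast
    obtain C' where C': "\<And>y. norm y \<le> \<bar>R\<bar> * 2 + \<sigma> \<Longrightarrow> norm (g y) \<le> C'" "C' \<ge> 0"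
      using continuous_on_bounded_cball[OF 1(2), of "\<bar>R\<bar> * 2 + \<sigma>"] by blast
    have "\<bar>f (?y s x)\<bar> \<le> C + C' * 2 \<and>
        norm (g (?y s x) \<bullet> (x - e)) \<le> C + C' * 2"
      if s: "norm s \<le> R" and x: "x \<in> std_simplex" for s x
    proof -
      have xe: "norm (x - e) \<le> 2"
        using norm_triangle_ineq4[of x e] norm_std_simplex[OF x] by (simp add: e_def)
      have "norm (?y s x) \<le> \<bar>s\<bar> * norm (x - e) + \<bar>\<sigma>\<bar> * norm e"
        by (rule order_trans[OF norm_triangle_ineq]) simp
      also have "\<dots> \<le> \<bar>R\<bar> * 2 + \<sigma>"
        using s xe \<sigma> by (intro add_mono mult_mono) (auto simp: e_def)
      finally have n: "norm (?y s x) \<le> \<bar>R\<bar> * 2 + \<sigma>" .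
      have "\<bar>g (?y s x) \<bullet> (x - e)\<bar> \<le> C' * 2"
        by (rule order_trans[OF Cauchy_Schwarz_ineq2]) (intro mult_mono C' n xe, auto)
      with C(1)[OF n] C(2) C'(2) show ?thesis by simp
    qed
    then show "\<exists>C. \<forall>s x. norm s \<le> R \<longrightarrow> x \<in> std_simplex \<longrightarrow> \<bar>f (?y s x)\<bar> \<le> C \<and>
        norm (g (?y s x) \<bullet> (x - e)) \<le> C"
      by blast
  qed
  have kpos: "0 \<le> k j s" for j s
    unfolding k_def by (intro Bochner_Integration.integral_nonneg pos)
  have knn: "(\<integral>\<^sup>+x. ennreal (f (s *\<^sub>R x + (\<sigma> - s) *\<^sub>R e)) \<partial>\<mu> j) = ennreal (k j s)" for j s
    unfolding k_def arg[symmetric] by (rule nn_integral_mu[OF c(1) pos])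
  define h where "h s = s ^ m * (\<Sum>j\<in>UNIV. B j i * k j s)" for s
  \<comment> \<open>The weak equation is applied to the function of \<open>x\<close> with
    \<open>s\<close> frozen. The chain rule gives the factor \<open>s\<close>, and the scalar
    product of the gradient with \<open>e - x\<close> is minus the derivative in
    \<open>s\<close>.\<close>
  have weak_k: "real (Suc m) * k i s + s * k' i s = (\<Sum>j\<in>UNIV. B j i * k j s)" for s
  proof -
    have "has_gradient (\<lambda>x. f (s *\<^sub>R x + (\<sigma> - s) *\<^sub>R e)) (\<lambda>x. s *\<^sub>R g (s *\<^sub>R x + (\<sigma> - s) *\<^sub>R e))"
      by (rule has_gradient_affine[OF f])
    from weak[OF this, of i]
    have "(\<integral>x. (e - x) \<bullet> (s *\<^sub>R g (?y s x)) \<partial>\<mu> i) + (\<Sum>j\<in>UNIV. B j i * k j s) = real (Suc m) * k i s"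
      unfolding k_def arg unfolding e_def .
    moreover have "(\<integral>x. (e - x) \<bullet> (s *\<^sub>R g (?y s x)) \<partial>\<mu> i) = (\<integral>x. - s * (g (?y s x) \<bullet> (x - e)) \<partial>\<mu> i)"
      by (intro Bochner_Integration.integral_cong) (auto simp: inner_commute inner_diff_left inner_diff_right algebra_simps)
    ultimately show ?thesis by (simp add: k'_def)
  qed
  have der: "((\<lambda>s. s ^ Suc m * k i s) has_real_derivative h s) (at s)" for s
  proof -
    have ki: "(k i has_real_derivative k' i s) (at s)"
      using has_gradientD(1)[OF k, of i s] by (simp add: has_field_derivative_def)
    have "((\<lambda>s. s ^ Suc m * k i s) has_real_derivative (real (Suc m) * s ^ m * k i s + k' i s * s ^ Suc m)) (at s)"
      by (rule DERIV_cong[OF DERIV_mult[OF DERIV_pow ki]]) simp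
    moreover have "real (Suc m) * s ^ m * k i s + k' i s * s ^ Suc m = h s"
      unfolding h_def weak_k[symmetric] by (simp add: algebra_simps)
    ultimately show ?thesis by simp
  qed
  have hm: "h \<in> borel_measurable borel"
    unfolding h_def using has_gradientD(3)[OF k]
    by (intro borel_measurable_continuous_onI continuous_intros) auto
  \<comment> \<open>Nonnegativity of \<open>B\<close> enters here: the fundamental theorem is
    applied to a nonnegative integrand, as an identity in \<open>ennreal\<close>.\<close>
  have hpos: "0 \<le> h s" if "0 \<le> s" for s
    unfolding h_def using that by (intro mult_nonneg_nonneg sum_nonneg kpos B_nonneg) auto
  have I: "(\<integral>\<^sup>+s. ennreal (h s) * indicator {1..\<sigma>} s \<partial>lborel) = ennreal (\<sigma> ^ Suc m * k i \<sigma> - 1 ^ Suc m * k i 1)"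
    by (rule nn_integral_FTC_Icc[OF hm der hpos \<sigma>]) auto
  have Imono: "k i 1 \<le> \<sigma> ^ Suc m * k i \<sigma>"
  proof -
    have "(\<lambda>s. s ^ Suc m * k i s) 1 \<le> (\<lambda>s. s ^ Suc m * k i s) \<sigma>"
      by (rule DERIV_nonneg_imp_nondecreasing[OF \<sigma>]) (use der hpos in force)
    then show ?thesis by simp
  qed
  have "ennreal (\<sigma> ^ Suc m) * ennreal (k i \<sigma>) = ennreal (k i 1) +
      (\<integral>\<^sup>+s. ennreal (h s) * indicator {1..\<sigma>} s \<partial>lborel)"
    unfolding I using Imono kpos \<sigma>
    by (simp add: ennreal_plus[symmetric] ennreal_mult[symmetric] del: ennreal_plus power_Suc)
  moreover have "(ennreal (s ^ m) * indicator {1..\<sigma>} s) * (\<Sum>j\<in>UNIV. ennreal (B j i) * ennreal (k j s))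
      = ennreal (h s) * indicator {1..\<sigma>} s" for s
  proof (cases "s \<in> {1..\<sigma>}")
    case True
    have "(\<Sum>j\<in>UNIV. ennreal (B j i) * ennreal (k j s)) = ennreal (\<Sum>j\<in>UNIV. B j i * k j s)"
      by (simp add: sum_ennreal[symmetric] ennreal_mult B_nonneg kpos)
    with True show ?thesis
      by (simp add: h_def ennreal_mult' sum_nonneg B_nonneg kpos)
  qed simp
  ultimately show ?thesis
    using knn[where s = \<sigma> and j = i] knn[where s = 1 and j = i] unfolding e_def[symmetric] by (simp add: knn)
qed

lemma measurable_mu_integral:
  assumes [measurable]: "f \<in> borel_measurable borel"
  shows "(\<lambda>s. \<integral>\<^sup>+x. f (s *\<^sub>R x + (\<sigma> - s) *\<^sub>R axis i 1) \<partial>\<mu> j) \<in> borel_measurable borel"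
proof -
  interpret sigma_finite_measure "\<mu> j" by (rule sigma_finite_mu)
  show ?thesis by measurable
qed

text \<open>Both sides are integral functionals of \<open>f\<close>, and the left one is finite at
  1, so the smooth case suffices. Measurable functions are needed for the passage to densities and
  for the masses of the faces.\<close>

lemma duhamel:
  assumes f: "f \<in> borel_measurable borel" and \<sigma>: "1 \<le> \<sigma>"
  shows "ennreal (\<sigma> ^ Suc m) * (\<integral>\<^sup>+x. f (\<sigma> *\<^sub>R x) \<partial>\<mu> i) =
     (\<integral>\<^sup>+x. f (x + (\<sigma> - 1) *\<^sub>R axis i 1) \<partial>\<mu> i) +
     (\<integral>\<^sup>+s. (ennreal (s ^ m) * indicator {1..\<sigma>} s) *
        (\<Sum>j\<in>UNIV. ennreal (B j i) * (\<integral>\<^sup>+x. f (s *\<^sub>R x + (\<sigma> - s) *\<^sub>R axis i 1) \<partial>\<mu> j)) \<partial>lborel)"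
proof (rule integral_functional_eqI[OF _ _ _ _ f])
  show "integral_functional (\<lambda>f. ennreal (\<sigma> ^ Suc m) * (\<integral>\<^sup>+x. f (\<sigma> *\<^sub>R x) \<partial>\<mu> i))"
    by (intro integral_functional_cmult integral_functional_nn_integral) measurable
  show "integral_functional (\<lambda>f. (\<integral>\<^sup>+x. f (x + (\<sigma> - 1) *\<^sub>R axis i 1) \<partial>\<mu> i) +
     (\<integral>\<^sup>+s. (ennreal (s ^ m) * indicator {1..\<sigma>} s) *
        (\<Sum>j\<in>UNIV. ennreal (B j i) * (\<integral>\<^sup>+x. f (s *\<^sub>R x + (\<sigma> - s) *\<^sub>R axis i 1) \<partial>\<mu> j)) \<partial>lborel))"
  proof (intro integral_functional_add integral_functional_integral integral_functional_sum
      integral_functional_cmult integral_functional_nn_integral)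
    fix f :: "real ^ 'n \<Rightarrow> ennreal" assume "f \<in> borel_measurable borel"
    note [measurable] = measurable_mu_integral[OF this, where \<sigma> = \<sigma> and i = i]
    show "(\<lambda>s. \<Sum>j\<in>UNIV. ennreal (B j i) * (\<integral>\<^sup>+x. f (s *\<^sub>R x + (\<sigma> - s) *\<^sub>R axis i 1) \<partial>\<mu> j)) \<in> borel_measurable lborel"
      by measurable
  qed measurable
  show "ennreal (\<sigma> ^ Suc m) * (\<integral>\<^sup>+x. 1 \<partial>\<mu> i) < \<infinity>"
    using finite_measure.emeasure_finite[OF fin, of i UNIV]
    by (simp add: ennreal_mult_less_top less_top)
qed (rule duhamel_smooth[OF _ _ \<sigma>])

section \<open>The stationary measures lifted to the cone\<close>

text \<open>Integration against the image of \<sigma>^(m+1) d\<sigma> times \<open>\<mu> i\<close>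
  under multiplication, so that the total weight becomes a variable of its own. The power is the
  integrating factor of Duhamel's formula, and \<sigma> starts at 1 because the chain is started
  there.\<close>

definition cone_integral :: "'n \<Rightarrow> (real ^ 'n \<Rightarrow> ennreal) \<Rightarrow> ennreal" where
  "cone_integral i F = (\<integral>\<^sup>+\<sigma>. ennreal (\<sigma> ^ Suc m) * indicator {1..} \<sigma> * (\<integral>\<^sup>+x. F (\<sigma> *\<^sub>R x) \<partial>\<mu> i) \<partial>lborel)"

lemma integral_functional_cone_integral: "integral_functional (cone_integral i)"
proof -
  interpret sigma_finite_measure "\<mu> i" by (rule sigma_finite_mu)
  show ?thesis
    unfolding cone_integral_def[abs_def]
  proof (rule integral_functional_integral)
    show "integral_functional (\<lambda>F. \<integral>\<^sup>+x. F (\<sigma> *\<^sub>R x) \<partial>\<mu> i)" for \<sigma>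
      by (rule integral_functional_nn_integral) measurable
    fix F :: "real ^ 'n \<Rightarrow> ennreal" assume [measurable]: "F \<in> borel_measurable borel"
    show "(\<lambda>\<sigma>. \<integral>\<^sup>+x. F (\<sigma> *\<^sub>R x) \<partial>\<mu> i) \<in> borel_measurable lborel"
      by measurable
  qed auto
qed

text \<open>The length of a stay in \<open>i\<close> is integrated with Lebesgue measure; nothing is
  normalised.\<close>

definition ray_mean :: "'n \<Rightarrow> (real ^ 'n \<Rightarrow> ennreal) \<Rightarrow> real ^ 'n \<Rightarrow> ennreal" where
  "ray_mean i F y = (\<integral>\<^sup>+t\<in>{0..}. F (y + t *\<^sub>R axis i 1) \<partial>lborel)"

lemma measurable_ray_mean [measurable]:
  assumes [measurable]: "F \<in> borel_measurable borel"
  shows "ray_mean i F \<in> borel_measurable borel"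
  unfolding ray_mean_def by measurable

text \<open>Duhamel's formula integrated over \<sigma>. Once the integrals in \<sigma> and
  \<open>s\<close> are exchanged, \<sigma> enters only through the stay \<open>\<sigma> - s\<close>,
  which produces \<open>ray_mean\<close>. What is left is \<open>s ^ m\<close> instead of
  \<open>s ^ Suc m\<close>, and the missing power is supplied by the reciprocal of the coordinate
  sum, since \<open>s *\<^sub>R x\<close> has sum \<open>s\<close> for \<open>x\<close> on the
  simplex.\<close>

lemma cone_integral_step:
  assumes F[measurable]: "F \<in> borel_measurable borel"
  shows "cone_integral i F = (\<integral>\<^sup>+x. ray_mean i F x \<partial>\<mu> i) +
    (\<Sum>j\<in>UNIV. cone_integral j (\<lambda>y. ennreal (1 / (\<Sum>k\<in>UNIV. y $ k)) * (ennreal (B j i) * ray_mean i F y)))"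
proof -
  define e where "e = (axis i 1 :: real ^ 'n)"
  define H where "H \<sigma> s j = (\<integral>\<^sup>+x. F (s *\<^sub>R x + (\<sigma> - s) *\<^sub>R e) \<partial>\<mu> j)" for \<sigma> s j
  have Hm[measurable]: "(\<lambda>(\<sigma>, s). H \<sigma> s j) \<in> borel_measurable (borel \<Otimes>\<^sub>M borel)" for j
  proof -
    interpret sigma_finite_measure "\<mu> j" by (rule sigma_finite_mu)
    show ?thesis unfolding H_def by measurable
  qed
  have [measurable]: "(\<lambda>x. H (fst x) (snd x) j) \<in> borel_measurable (borel \<Otimes>\<^sub>M borel)" for j
    using Hm[of j] by (simp add: split_beta')
  have [measurable]: "Measurable.pred (borel \<Otimes>\<^sub>M borel) (\<lambda>x :: real \<times> real. snd x \<in> {1..fst x})"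
    unfolding atLeastAtMost_iff by measurable
  interpret Mi: sigma_finite_measure "\<mu> i" by (rule sigma_finite_mu)
  let ?T = "\<lambda>j. cone_integral j (\<lambda>y. ennreal (1 / (\<Sum>k\<in>UNIV. y $ k)) * (ennreal (B j i) * ray_mean i F y))"
  \<comment> \<open>The region of integration is attached to the pair of variables, so that it
    survives the exchange of the two integrals.\<close>
  let ?G = "\<lambda>j \<sigma> s. ennreal (s ^ m) * ennreal (B j i) * H \<sigma> s j * indicator {(\<sigma>, s). 1 \<le> s \<and> s \<le> \<sigma>} (\<sigma>, s)"
  let ?R = "\<lambda>\<sigma>. \<integral>\<^sup>+s. (ennreal (s ^ m) * indicator {1..\<sigma>} s) * (\<Sum>j\<in>UNIV. ennreal (B j i) * H \<sigma> s j) \<partial>lborel"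
  let ?S = "\<lambda>\<sigma>. \<integral>\<^sup>+x. F (x + (\<sigma> - 1) *\<^sub>R e) \<partial>\<mu> i"
  let ?V = "\<lambda>s x \<sigma>. F (s *\<^sub>R x + (\<sigma> - s) *\<^sub>R e) * indicator {s..} \<sigma>"
  have "cone_integral i F = (\<integral>\<^sup>+\<sigma>. indicator {1..} \<sigma> * (?S \<sigma>) +
      indicator {1..} \<sigma> * (?R \<sigma>) \<partial>lborel)"
    unfolding cone_integral_def
  proof (intro nn_integral_cong)
    fix \<sigma> :: real
    show "ennreal (\<sigma> ^ Suc m) * indicator {1..} \<sigma> * (\<integral>\<^sup>+x. F (\<sigma> *\<^sub>R x) \<partial>\<mu> i) =
      indicator {1..} \<sigma> * (?S \<sigma>) +
      indicator {1..} \<sigma> * (?R \<sigma>)"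
    proof (cases "1 \<le> \<sigma>")
      case True
      with duhamel[OF F True, of i] show ?thesis unfolding H_def e_def by simp
    qed simp
  qed
  also have "\<dots> = (\<integral>\<^sup>+\<sigma>. indicator {1..} \<sigma> * (?S \<sigma>) \<partial>lborel) +
      (\<integral>\<^sup>+\<sigma>. indicator {1..} \<sigma> * (?R \<sigma>) \<partial>lborel)"
    by (rule nn_integral_add) measurable
  also have "(\<integral>\<^sup>+\<sigma>. indicator {1..} \<sigma> * (?S \<sigma>) \<partial>lborel) = (\<integral>\<^sup>+x. ray_mean i F x \<partial>\<mu> i)"
  proof -
    interpret P: pair_sigma_finite "\<mu> i" "lborel :: real measure" ..
    have "(\<integral>\<^sup>+\<sigma>. indicator {1..} \<sigma> * (?S \<sigma>) \<partial>lborel)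
        = (\<integral>\<^sup>+\<sigma>. (\<integral>\<^sup>+x. F (x + (\<sigma> - 1) *\<^sub>R e) * indicator {1..} \<sigma> \<partial>\<mu> i) \<partial>lborel)"
    proof (rule nn_integral_cong)
      fix \<sigma> :: real
      show "indicator {1..} \<sigma> * (?S \<sigma>)
          = (\<integral>\<^sup>+x. F (x + (\<sigma> - 1) *\<^sub>R e) * indicator {1..} \<sigma> \<partial>\<mu> i)"
        by (subst nn_integral_multc) (auto simp: mult.commute)
    qed
    also have "\<dots> = (\<integral>\<^sup>+x. (\<integral>\<^sup>+\<sigma>. F (x + (\<sigma> - 1) *\<^sub>R e) * indicator {1..} \<sigma> \<partial>lborel) \<partial>\<mu> i)"
      by (rule P.Fubini') measurable
    also have "\<dots> = (\<integral>\<^sup>+x. ray_mean i F x \<partial>\<mu> i)"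
    proof (rule nn_integral_cong)
      fix x
      have "(\<lambda>v. F (x + (v - 1) *\<^sub>R e)) \<in> borel_measurable borel" by measurable
      from nn_integral_shift[OF this, of 1]
      show "(\<integral>\<^sup>+\<sigma>. F (x + (\<sigma> - 1) *\<^sub>R e) * indicator {1..} \<sigma> \<partial>lborel) = ray_mean i F x"
        by (simp add: ray_mean_def e_def)
    qed
    finally show ?thesis .
  qed
  also have "(\<integral>\<^sup>+\<sigma>. indicator {1..} \<sigma> * (?R \<sigma>) \<partial>lborel)
      = (\<Sum>j\<in>UNIV. ?T j)"
  proof -
    have "(\<integral>\<^sup>+\<sigma>. indicator {1..} \<sigma> * (?R \<sigma>) \<partial>lborel)
      = (\<integral>\<^sup>+\<sigma>. (\<integral>\<^sup>+s. (\<Sum>j\<in>UNIV. ?G j \<sigma> s) \<partial>lborel) \<partial>lborel)"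
      by (subst nn_integral_cmult[symmetric])
         (auto intro!: nn_integral_cong split: split_indicator simp: sum_distrib_left mult_ac)
    also have "\<dots> = (\<Sum>j\<in>UNIV. \<integral>\<^sup>+\<sigma>. (\<integral>\<^sup>+s. ?G j \<sigma> s \<partial>lborel) \<partial>lborel)"
    proof -
      have "(\<lambda>s. indicator {(\<sigma>, s). 1 \<le> s \<and> s \<le> \<sigma>} (\<sigma>, s) :: ennreal) = indicator {1..\<sigma>}" for \<sigma> :: real
        by (auto simp: fun_eq_iff split: split_indicator)
      then have [measurable]: "(\<lambda>s. indicator {(\<sigma>, s). 1 \<le> s \<and> s \<le> \<sigma>} (\<sigma>, s) :: ennreal) \<in> borel_measurable borel" for \<sigma> :: real
        by simp
      have "(\<integral>\<^sup>+\<sigma>. \<integral>\<^sup>+s. (\<Sum>j\<in>UNIV. ?G j \<sigma> s) \<partial>lborel \<partial>lborel) = (\<integral>\<^sup>+\<sigma>. (\<Sum>j\<in>UNIV. \<integral>\<^sup>+s. ?G j \<sigma> s \<partial>lborel) \<partial>lborel)"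
        by (rule nn_integral_cong, rule nn_integral_sum) measurable
      also have "\<dots> = (\<Sum>j\<in>UNIV. \<integral>\<^sup>+\<sigma>. \<integral>\<^sup>+s. ?G j \<sigma> s \<partial>lborel \<partial>lborel)"
        by (rule nn_integral_sum) measurable
      finally show ?thesis .
    qed
    also have "\<dots> = (\<Sum>j\<in>UNIV. ?T j)"
    proof (rule sum.cong[OF refl])
      fix j
      interpret sigma_finite_measure "\<mu> j" by (rule sigma_finite_mu)
      interpret P: pair_sigma_finite "\<mu> j" "lborel :: real measure" ..
      have "(\<integral>\<^sup>+\<sigma>. (\<integral>\<^sup>+s. ?G j \<sigma> s \<partial>lborel) \<partial>lborel)
        = (\<integral>\<^sup>+s. (\<integral>\<^sup>+\<sigma>. ?G j \<sigma> s \<partial>lborel) \<partial>lborel)"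
        by (rule lborel_pair.Fubini'[symmetric]) measurable
      also have "\<dots> = (\<integral>\<^sup>+s. (ennreal (s ^ m) * ennreal (B j i) * indicator {1..} s) * (\<integral>\<^sup>+\<sigma>. H \<sigma> s j * indicator {s..} \<sigma> \<partial>lborel) \<partial>lborel)"
        by (subst nn_integral_cmult[symmetric])
           (auto intro!: nn_integral_cong split: split_indicator simp: mult_ac)
      also have "\<dots> = ?T j"
        unfolding cone_integral_def
      proof (rule nn_integral_cong)
        fix s :: real
        show "(ennreal (s ^ m) * ennreal (B j i) * indicator {1..} s) * (\<integral>\<^sup>+\<sigma>. H \<sigma> s j * indicator {s..} \<sigma> \<partial>lborel)
          = ennreal (s ^ Suc m) * indicator {1..} s * (\<integral>\<^sup>+x. ennreal (1 / (\<Sum>k\<in>UNIV. (s *\<^sub>R x) $ k)) * (ennreal (B j i) * ray_mean i F (s *\<^sub>R x)) \<partial>\<mu> j)"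
        proof (cases "1 \<le> s")
          case True
          have "(\<integral>\<^sup>+\<sigma>. H \<sigma> s j * indicator {s..} \<sigma> \<partial>lborel)
              = (\<integral>\<^sup>+\<sigma>. (\<integral>\<^sup>+x. ?V s x \<sigma> \<partial>\<mu> j) \<partial>lborel)"
            unfolding H_def by (intro nn_integral_cong) (simp add: nn_integral_multc)
          also have "\<dots> = (\<integral>\<^sup>+x. (\<integral>\<^sup>+\<sigma>. ?V s x \<sigma> \<partial>lborel) \<partial>\<mu> j)"
            by (rule P.Fubini') measurable
          also have "\<dots> = (\<integral>\<^sup>+x. ray_mean i F (s *\<^sub>R x) \<partial>\<mu> j)"
          proof (rule nn_integral_cong)
            fix x
            have "(\<lambda>v. F (s *\<^sub>R x + (v - s) *\<^sub>R e)) \<in> borel_measurable borel" by measurable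
            from nn_integral_shift[OF this, of s]
            show "(\<integral>\<^sup>+\<sigma>. ?V s x \<sigma> \<partial>lborel) = ray_mean i F (s *\<^sub>R x)"
              by (simp add: ray_mean_def e_def)
          qed
          finally have L: "(\<integral>\<^sup>+\<sigma>. H \<sigma> s j * indicator {s..} \<sigma> \<partial>lborel) = (\<integral>\<^sup>+x. ray_mean i F (s *\<^sub>R x) \<partial>\<mu> j)" .
          have "(\<integral>\<^sup>+x. ennreal (1 / (\<Sum>k\<in>UNIV. (s *\<^sub>R x) $ k)) * (ennreal (B j i) * ray_mean i F (s *\<^sub>R x)) \<partial>\<mu> j)
              = (\<integral>\<^sup>+x. (ennreal (1 / s) * ennreal (B j i)) * ray_mean i F (s *\<^sub>R x) \<partial>\<mu> j)"
            by (rule nn_integral_cong_AE)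
               (use supp[of j] in \<open>auto elim!: eventually_mono simp: std_simplexD(3) mult.assoc simp flip: sum_distrib_left\<close>)
          also have "\<dots> = (ennreal (1 / s) * ennreal (B j i)) * (\<integral>\<^sup>+x. ray_mean i F (s *\<^sub>R x) \<partial>\<mu> j)"
            by (rule nn_integral_cmult) measurable
          finally have R: "(\<integral>\<^sup>+x. ennreal (1 / (\<Sum>k\<in>UNIV. (s *\<^sub>R x) $ k)) * (ennreal (B j i) * ray_mean i F (s *\<^sub>R x)) \<partial>\<mu> j)
              = (ennreal (1 / s) * ennreal (B j i)) * (\<integral>\<^sup>+x. ray_mean i F (s *\<^sub>R x) \<partial>\<mu> j)" .
          have "ennreal (s ^ Suc m) * ennreal (1 / s) = ennreal (s ^ m)"
            using True by (simp flip: ennreal_mult)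
          then show ?thesis
            unfolding L R using True by (simp add: mult.assoc[symmetric])
        qed simp
      qed
      finally show "(\<integral>\<^sup>+\<sigma>. (\<integral>\<^sup>+s. ?G j \<sigma> s \<partial>lborel) \<partial>lborel)
        = ?T j" .
    qed
    finally show ?thesis .
  qed
  finally show ?thesis .
qed

end

lemma nn_integral_face_measure_empty:
  fixes f :: "real ^ 'n::finite \<Rightarrow> ennreal"
  assumes [measurable]: "f \<in> borel_measurable borel"
  shows "(\<integral>\<^sup>+w. f w \<partial>face_measure {}) = f 0"
proof -
  have "prob_space (Pi\<^sub>M UNIV (half_line ({} :: 'n set)))"
    by (intro prob_space_PiM) (auto simp: half_line_def prob_space_return)
  note P = prob_space.emeasure_space_1[OF this]
  have v: "vec_lambda \<in> measurable (Pi\<^sub>M UNIV (half_line {})) (borel :: (real ^ 'n) measure)"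
    by (rule measurable_vec_lambda) simp
  have "(\<integral>\<^sup>+w. f w \<partial>face_measure {}) = (\<integral>\<^sup>+x. f (vec_lambda x) \<partial>Pi\<^sub>M UNIV (half_line {}))"
    unfolding face_measure_def by (rule nn_integral_distr[OF v]) simp
  also have "\<dots> = (\<integral>\<^sup>+x. f 0 \<partial>Pi\<^sub>M UNIV (half_line ({} :: 'n set)))"
  proof (rule nn_integral_cong_AE)
    have "AE x in Pi\<^sub>M UNIV (half_line {}). \<forall>k\<in>(UNIV :: 'n set). x k = 0"
    proof (rule AE_finite_allI)
      fix k :: 'n
      have "AE t in half_line {} k. t = 0" unfolding half_line_def by (simp add: AE_return)
      then show "AE x in Pi\<^sub>M UNIV (half_line {}). x k = 0"
        by (intro AE_PiM_component) (auto simp: half_line_def prob_space_return)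
    qed simp
    then show "AE x in Pi\<^sub>M UNIV (half_line {}). f (vec_lambda x) = f 0"
    proof eventually_elim
      case (elim x)
      then have "vec_lambda x = (0 :: real ^ 'n)" by (simp add: vec_eq_iff)
      then show ?case by simp
    qed
  qed
  also have "\<dots> = f 0"
    by (simp add: P)
  finally show ?thesis .
qed

lemma AE_face_measure_zero:
  assumes "k \<notin> A"
  shows "AE w in face_measure A. (w :: real ^ 'n::finite) $ k = 0"
proof -
  have "(\<integral>\<^sup>+w. indicator {w. w $ k \<noteq> 0} w \<partial>face_measure A) = 0"
    using assms by (subst nn_integral_face_measure_split[of _ _ k]) (auto simp: half_line_def nn_integral_return)
  then have "AE w in face_measure A. indicator {w. w $ k \<noteq> 0} w = (0 :: ennreal)"
    by (subst (asm) nn_integral_0_iff_AE) auto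
  then show ?thesis
    by eventually_elim (auto split: split_indicator_asm)
qed

lemma continuous_occupation_density:
  assumes "\<And>k i. 0 \<le> B k i"
  shows "continuous_on UNIV (occupation_density B j n A i)"
proof -
  obtain g where "has_gradient (occupation_density B j n A i) g"
    using has_gradient_occupation_density[where B = B, OF assms] by blast
  then show ?thesis by (rule has_gradientD(3))
qed

lemma continuous_hazard: "continuous_on UNIV hazard"
  by (rule has_gradientD(3)[OF has_gradient_hazard])

lemma continuous_jump_source:
  assumes "\<And>k. continuous_on UNIV (v k)"
  shows "continuous_on UNIV (jump_source B v i)"
  unfolding jump_source_def[abs_def]
  by (intro continuous_intros continuous_hazard assms)

context stationary_zigzag
begin

lemma cone_integral_sum:
  assumes "\<And>i. i \<in> I \<Longrightarrow> G i \<in> borel_measurable borel"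
  shows "cone_integral j (\<lambda>y. \<Sum>i\<in>I. G i y) = (\<Sum>i\<in>I. cone_integral j (G i))"
  using assms
proof (induction I rule: infinite_finite_induct)
  case (insert i I)
  then show ?case
    using integral_functionalD(2)[OF integral_functional_cone_integral, of "G i" "\<lambda>y. \<Sum>i\<in>I. G i y" j]
    by simp
qed (simp_all add: cone_integral_def)

section \<open>Expansion over the number of jumps\<close>

text \<open>One jump, acting on the functions that are integrated: from \<open>j\<close> at
  \<open>y\<close> a jump to \<open>i\<close> at rate \<open>B j i\<close> divided by the total
  weight, and then a stay in \<open>i\<close>.\<close>

definition jump_op :: "('n \<Rightarrow> real ^ 'n \<Rightarrow> ennreal) \<Rightarrow> 'n \<Rightarrow> real ^ 'n \<Rightarrow> ennreal" where
  "jump_op F j y = ennreal (1 / (\<Sum>k\<in>UNIV. y $ k)) * (\<Sum>i\<in>UNIV. ennreal (B j i) * ray_mean i (F i) y)"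

lemma measurable_jump_op [measurable]:
  assumes "\<And>i. F i \<in> borel_measurable borel"
  shows "jump_op F j \<in> borel_measurable borel"
proof -
  note [measurable] = assms
  show ?thesis unfolding jump_op_def by measurable
qed

lemma measurable_jump_op_iter:
  assumes "\<And>i. F i \<in> borel_measurable borel"
  shows "(jump_op ^^ n) F j \<in> borel_measurable borel"
  using assms by (induction n arbitrary: j) auto

definition cone_total :: "('n \<Rightarrow> real ^ 'n \<Rightarrow> ennreal) \<Rightarrow> ennreal" where
  "cone_total F = (\<Sum>i\<in>UNIV. cone_integral i (F i))"

text \<open>The contribution of the paths that are still in their first stay.\<close>

definition start_total :: "('n \<Rightarrow> real ^ 'n \<Rightarrow> ennreal) \<Rightarrow> ennreal" where
  "start_total F = (\<Sum>i\<in>UNIV. \<integral>\<^sup>+x. ray_mean i (F i) x \<partial>\<mu> i)"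

lemma cone_total_step:
  assumes F: "\<And>i. F i \<in> borel_measurable borel"
  shows "cone_total F = start_total F + cone_total (jump_op F)"
proof -
  let ?G = "\<lambda>i j y. ennreal (1 / (\<Sum>k\<in>UNIV. y $ k)) * (ennreal (B j i) * ray_mean i (F i) y)"
  have m: "?G i j \<in> borel_measurable borel" for i j
    using measurable_ray_mean[OF F] by measurable
  have "cone_total F = start_total F + (\<Sum>i\<in>UNIV. \<Sum>j\<in>UNIV. cone_integral j (?G i j))"
    unfolding cone_total_def start_total_def
    by (simp add: cone_integral_step[OF F] sum.distrib)
  also have "(\<Sum>i\<in>UNIV. \<Sum>j\<in>UNIV. cone_integral j (?G i j)) = (\<Sum>j\<in>UNIV. \<Sum>i\<in>UNIV. cone_integral j (?G i j))"
    by (rule sum.swap)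
  also have "\<dots> = (\<Sum>j\<in>UNIV. cone_integral j (\<lambda>y. \<Sum>i\<in>UNIV. ?G i j y))"
    by (intro sum.cong refl cone_integral_sum[symmetric] m)
  also have "\<dots> = cone_total (jump_op F)"
    unfolding cone_total_def jump_op_def by (simp add: sum_distrib_left)
  finally show ?thesis .
qed

lemma cone_total_iterate:
  assumes F: "\<And>i. F i \<in> borel_measurable borel"
  shows "cone_total F = (\<Sum>n<N. start_total ((jump_op ^^ n) F)) + cone_total ((jump_op ^^ N) F)"
proof (induction N)
  case (Suc N)
  then show ?case
    using cone_total_step[of "(jump_op ^^ N) F"] measurable_jump_op_iter[OF F]
    by (simp add: add.assoc)
qed simp

text \<open>The rate is twice the row sum of \<open>B\<close>: a ray integration divides by it and
  the sum over the targets multiplies by \<open>real (Suc m)\<close>, so that each jump halves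
  \<open>C\<close>. Total weights below 1 do not occur in the cone integrals, and from 1 on the
  reciprocal of the weight is at most 1.\<close>

definition exp_dominated :: "real \<Rightarrow> ('n \<Rightarrow> real ^ 'n \<Rightarrow> ennreal) \<Rightarrow> bool" where
  "exp_dominated C F \<longleftrightarrow> (\<forall>i y. y \<in> orthant \<longrightarrow> 1 \<le> (\<Sum>k\<in>UNIV. y $ k) \<longrightarrow>
     F i y \<le> ennreal (C * exp (- (2 * real (Suc m)) * (\<Sum>k\<in>UNIV. y $ k))))"

lemma nn_integral_exp_half_line:
  assumes "0 < \<beta>"
  shows "(\<integral>\<^sup>+t. ennreal (exp (- \<beta> * t)) * indicator {0..} t \<partial>lborel) = ennreal (1 / \<beta>)"
proof -
  have "((\<lambda>t. - exp (- \<beta> * t) / \<beta>) \<longlongrightarrow> - 0 / \<beta>) at_top"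
    using assms
    by (intro tendsto_intros filterlim_compose[OF exp_at_bot]
        filterlim_tendsto_neg_mult_at_bot[OF tendsto_const] filterlim_ident) auto
  then have "(\<integral>\<^sup>+t. ennreal (exp (- \<beta> * t)) * indicator {0..} t \<partial>lborel) = ennreal (- 0 / \<beta> - (- exp (- \<beta> * 0) / \<beta>))"
    using assms by (intro nn_integral_FTC_atLeast) (auto intro!: derivative_eq_intros)
  then show ?thesis by simp
qed

lemma exp_dominated_jump_op:
  assumes F: "exp_dominated C F" and C: "0 \<le> C"
  shows "exp_dominated (C / 2) (jump_op F)"
  unfolding exp_dominated_def
proof (intro allI impI)
  fix j and y :: "real ^ 'n"
  define S where "S = (\<Sum>k\<in>UNIV. y $ k)"
  define \<beta> where "\<beta> = 2 * real (Suc m)"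
  assume y: "y \<in> orthant" and "1 \<le> (\<Sum>k\<in>UNIV. y $ k)"
  then have S: "1 \<le> S" by (simp add: S_def)
  have \<beta>: "0 < \<beta>" by (simp add: \<beta>_def)
  have ray: "ray_mean i (F i) y \<le> ennreal (C * exp (- \<beta> * S) / \<beta>)" for i
  proof -
    have "ray_mean i (F i) y \<le> (\<integral>\<^sup>+t. ennreal (C * exp (- \<beta> * S)) * (ennreal (exp (- \<beta> * t)) * indicator {0..} t) \<partial>lborel)"
      unfolding ray_mean_def
    proof (rule nn_integral_mono)
      fix t :: real
      have sum: "(\<Sum>k\<in>UNIV. (y + t *\<^sub>R axis i 1) $ k) = S + t"
      proof -
        have "(\<Sum>k\<in>UNIV. axis i (1::real) $ k) = 1" by (simp add: axis_def)
        then show ?thesis by (simp add: S_def sum.distrib flip: sum_distrib_left)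
      qed
      have "F i (y + t *\<^sub>R axis i 1) \<le> ennreal (C * exp (- \<beta> * (S + t)))" if "0 \<le> t"
        using F[unfolded exp_dominated_def, rule_format, of "y + t *\<^sub>R axis i 1" i] y S that
        unfolding sum \<beta>_def by (auto simp: orthant_def axis_def)
      also have "C * exp (- \<beta> * (S + t)) = (C * exp (- \<beta> * S)) * exp (- \<beta> * t)"
        by (simp add: exp_add[symmetric] algebra_simps)
      also have "ennreal \<dots> = ennreal (C * exp (- \<beta> * S)) * ennreal (exp (- \<beta> * t))"
        using C by (intro ennreal_mult) auto
      finally show "F i (y + t *\<^sub>R axis i 1) * indicator {0..} t
          \<le> ennreal (C * exp (- \<beta> * S)) * (ennreal (exp (- \<beta> * t)) * indicator {0..} t)"
        by (auto split: split_indicator)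
    qed
    also have "\<dots> = ennreal (C * exp (- \<beta> * S)) * ennreal (1 / \<beta>)"
      by (subst nn_integral_cmult) (auto simp: nn_integral_exp_half_line[OF \<beta>, simplified])
    also have "\<dots> = ennreal (C * exp (- \<beta> * S) / \<beta>)"
      using C \<beta> by (simp flip: ennreal_mult)
    finally show ?thesis .
  qed
  have "jump_op F j y \<le> 1 * (\<Sum>i\<in>UNIV. ennreal (B j i) * ennreal (C * exp (- \<beta> * S) / \<beta>))"
    unfolding jump_op_def S_def[symmetric]
    using S by (intro mult_mono sum_mono ray order_refl) (auto simp: ennreal_le_1)
  also have "\<dots> = ennreal ((\<Sum>i\<in>UNIV. B j i) * (C * exp (- \<beta> * S) / \<beta>))"
  proof -
    have "1 * (\<Sum>i\<in>UNIV. ennreal (B j i) * ennreal c) = ennreal ((\<Sum>i\<in>UNIV. B j i) * c)" if "0 \<le> c" for c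
      using that by (simp add: sum_distrib_right sum_ennreal[symmetric] B_nonneg ennreal_mult)
    then show ?thesis using C \<beta> by simp
  qed
  also have "(\<Sum>i\<in>UNIV. B j i) * (C * exp (- \<beta> * S) / \<beta>) = C / 2 * exp (- \<beta> * S)"
    unfolding B_row \<beta>_def by (simp del: of_nat_Suc)
  finally show "jump_op F j y \<le> ennreal (C / 2 * exp (- (2 * real (Suc m)) * (\<Sum>k\<in>UNIV. y $ k)))"
    by (simp add: S_def \<beta>_def)
qed

lemma cone_total_exp_dominated:
  obtains K where "0 \<le> K" "\<And>C F. exp_dominated C F \<Longrightarrow> 0 \<le> C \<Longrightarrow> cone_total F \<le> ennreal (C * K)"
proof -
  \<comment> \<open>The factorial is the Gamma integral of \<sigma>^(m+1) exp(-\<sigma>); the rate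
    of decay is weakened to 1 to reach it.\<close>
  define K where "K = (\<Sum>i\<in>UNIV. fact (Suc m) * measure (\<mu> i) UNIV)"
  have "cone_total F \<le> ennreal (C * K)" if F: "exp_dominated C F" and C: "0 \<le> C" for C F
  proof -
    have "cone_integral i (F i) \<le> ennreal (C * (fact (Suc m) * measure (\<mu> i) UNIV))" for i
    proof -
      interpret finite_measure "\<mu> i" by (rule fin)
      have "cone_integral i (F i) \<le> (\<integral>\<^sup>+\<sigma>. (ennreal (\<sigma> ^ Suc m * exp (- \<sigma>)) * indicator {0..} \<sigma>) * (ennreal C * emeasure (\<mu> i) UNIV) \<partial>lborel)"
        unfolding cone_integral_def
      proof (rule nn_integral_mono)
        fix \<sigma> :: real
        show "ennreal (\<sigma> ^ Suc m) * indicator {1..} \<sigma> * (\<integral>\<^sup>+x. F i (\<sigma> *\<^sub>R x) \<partial>\<mu> i)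
            \<le> (ennreal (\<sigma> ^ Suc m * exp (- \<sigma>)) * indicator {0..} \<sigma>) * (ennreal C * emeasure (\<mu> i) UNIV)"
        proof (cases "1 \<le> \<sigma>")
          case True
          have "(\<integral>\<^sup>+x. F i (\<sigma> *\<^sub>R x) \<partial>\<mu> i) \<le> (\<integral>\<^sup>+x. ennreal (C * exp (- \<sigma>)) \<partial>\<mu> i)"
          proof (rule nn_integral_mono_AE)
            show "AE x in \<mu> i. F i (\<sigma> *\<^sub>R x) \<le> ennreal (C * exp (- \<sigma>))"
              using supp[of i]
            proof eventually_elim
              case (elim x)
              have sum: "(\<Sum>k\<in>UNIV. (\<sigma> *\<^sub>R x) $ k) = \<sigma>"
                using std_simplexD(3)[OF elim] by (simp flip: sum_distrib_left)
              have "F i (\<sigma> *\<^sub>R x) \<le> ennreal (C * exp (- (2 * real (Suc m)) * \<sigma>))"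
                using F[unfolded exp_dominated_def, rule_format, of "\<sigma> *\<^sub>R x" i] std_simplexD(1)[OF elim] True
                unfolding sum by (auto simp: orthant_def)
              also have "\<dots> \<le> ennreal (C * exp (- \<sigma>))"
              proof (intro ennreal_leI mult_left_mono C)
                have "1 \<le> 2 * real (Suc m)" by simp
                from mult_right_mono[OF this, of \<sigma>] True
                have "- (2 * real (Suc m)) * \<sigma> \<le> - \<sigma>" by (simp del: of_nat_Suc)
                then show "exp (- (2 * real (Suc m)) * \<sigma>) \<le> exp (- \<sigma>)" by simp
              qed
              finally show ?case .
            qed
          qed
          also have "\<dots> = ennreal (exp (- \<sigma>)) * (ennreal C * emeasure (\<mu> i) UNIV)"
            using C by (simp add: ennreal_mult mult_ac)
          finally show ?thesis
            using True by (auto simp: ennreal_mult mult.assoc intro!: mult_left_mono)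
        qed simp
      qed
      also have "\<dots> = ennreal (fact (Suc m)) * (ennreal C * emeasure (\<mu> i) UNIV)"
        by (subst nn_integral_multc, measurable)
           (use nn_intergal_power_times_exp_Ici[of "Suc m"] in \<open>simp del: power_Suc fact_Suc\<close>)
      also have "\<dots> = ennreal (C * (fact (Suc m) * measure (\<mu> i) UNIV))"
        using C by (simp add: emeasure_eq_measure ennreal_mult mult_ac del: fact_Suc)
      finally show ?thesis .
    qed
    then have "cone_total F \<le> (\<Sum>i\<in>UNIV. ennreal (C * (fact (Suc m) * measure (\<mu> i) UNIV)))"
      unfolding cone_total_def by (rule sum_mono)
    also have "\<dots> = ennreal (C * K)"
      using C by (subst sum_ennreal) (auto simp: K_def sum_distrib_left)
    finally show ?thesis .
  qed
  moreover have "0 \<le> K" unfolding K_def by (intro sum_nonneg) auto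
  ultimately show ?thesis using that by blast
qed

text \<open>The remainder after \<open>N\<close> jumps is at most a constant times
  \<open>C / 2 ^ N\<close>.\<close>

lemma cone_total_series:
  assumes F: "\<And>i. F i \<in> borel_measurable borel" and dom: "exp_dominated C F" and C: "0 \<le> C"
  shows "cone_total F = (\<Sum>n. start_total ((jump_op ^^ n) F))"
proof -
  obtain K where K: "0 \<le> K" "\<And>C F. exp_dominated C F \<Longrightarrow> 0 \<le> C \<Longrightarrow> cone_total F \<le> ennreal (C * K)"
    using cone_total_exp_dominated by blast
  have domN: "exp_dominated (C / 2 ^ N) ((jump_op ^^ N) F)" for N
  proof (induction N)
    case (Suc N)
    from exp_dominated_jump_op[OF this] C show ?case by (simp add: mult.commute)
  qed (use dom in simp)
  have "(\<lambda>N. ennreal (C / 2 ^ N * K)) \<longlonglongrightarrow> ennreal 0"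
  proof (intro tendsto_ennrealI)
    have "(\<lambda>N. C * K * (1 / 2) ^ N) \<longlonglongrightarrow> C * K * 0"
      by (intro tendsto_intros LIMSEQ_power_zero) auto
    then show "(\<lambda>N. C / 2 ^ N * K) \<longlonglongrightarrow> 0" by (simp add: power_one_over mult_ac)
  qed
  moreover have "cone_total ((jump_op ^^ N) F) \<le> ennreal (C / 2 ^ N * K)" for N
    using K(2)[OF domN] C by simp
  ultimately have "(\<lambda>N. cone_total ((jump_op ^^ N) F)) \<longlonglongrightarrow> 0"
    by - (rule tendsto_sandwich[where f = "\<lambda>_. 0" and h = "\<lambda>N. ennreal (C / 2 ^ N * K)"], simp_all)
  moreover have "(\<lambda>N. \<Sum>n<N. start_total ((jump_op ^^ n) F)) \<longlonglongrightarrow> (\<Sum>n. start_total ((jump_op ^^ n) F))"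
    by (intro summable_LIMSEQ) simp
  ultimately have "(\<lambda>N. (\<Sum>n<N. start_total ((jump_op ^^ n) F)) + cone_total ((jump_op ^^ N) F))
      \<longlonglongrightarrow> (\<Sum>n. start_total ((jump_op ^^ n) F)) + 0"
    by - (rule tendsto_add)
  then have "(\<lambda>N. cone_total F) \<longlonglongrightarrow> (\<Sum>n. start_total ((jump_op ^^ n) F))"
    unfolding cone_total_iterate[OF F, symmetric] by simp
  then show ?thesis
    by (rule LIMSEQ_unique[OF tendsto_const])
qed

section \<open>Duality between jumps and occupation densities\<close>

text \<open>The contribution of the paths with \<open>n\<close> jumps from \<open>x\<close> in state
  \<open>j\<close>, split by the present state and by the visited set, since each visited set has
  its densities on a different face.\<close>

definition occupation_integral :: "nat \<Rightarrow> 'n \<Rightarrow> ('n \<Rightarrow> real ^ 'n \<Rightarrow> ennreal) \<Rightarrow> real ^ 'n \<Rightarrow> ennreal" where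
  "occupation_integral n j F x =
     (\<Sum>i\<in>UNIV. \<Sum>A\<in>UNIV. \<integral>\<^sup>+w. F i (x + w) * ennreal (occupation_density B j n A i w) \<partial>face_measure A)"

text \<open>The first stay is treated as a first visit to \<open>j\<close> from the empty face,
  whose measure is the point mass at the origin.\<close>

lemma occupation_integral_0:
  assumes F: "\<And>i. F i \<in> borel_measurable borel"
  shows "occupation_integral 0 j F x = ray_mean j (F j) x"
proof -
  note [measurable] = F
  have "occupation_integral 0 j F x = (\<Sum>i\<in>UNIV. \<Sum>A\<in>UNIV. if i = j \<and> A = {j} then \<integral>\<^sup>+w. F j (x + w) \<partial>face_measure {j} else 0)"
    unfolding occupation_integral_def by (intro sum.cong refl) auto
  also have "\<dots> = (\<Sum>i\<in>UNIV. if i = j then \<Sum>A\<in>UNIV. (if A = {j} then \<integral>\<^sup>+w. F j (x + w) \<partial>face_measure {j} else 0) else 0)"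
    by (intro sum.cong refl) auto
  also have "\<dots> = (\<integral>\<^sup>+w. F j (x + w) \<partial>face_measure {j})"
    by simp
  also have "\<dots> = (\<integral>\<^sup>+w. (\<integral>\<^sup>+t\<in>{0..}. F j (x + (w + t *\<^sub>R axis j 1)) \<partial>lborel) * ennreal 1 \<partial>face_measure {})"
  proof -
    have "scale_coord j 0 \<in> borel_measurable (borel :: (real ^ 'n) measure)"
      by (intro borel_measurable_continuous_onI continuous_intros)
    from nn_integral_face_ray_new[of "\<lambda>w. F j (x + w)" "\<lambda>_. 1" j "{}", OF _ _ _ this]
    show ?thesis by simp
  qed
  also have "\<dots> = ray_mean j (F j) x"
    by (subst nn_integral_face_measure_empty) (auto simp: ray_mean_def)
  finally show ?thesis .
qed

text \<open>Duality: a jump applied to the functions \<open>F\<close> is shifted to the densities,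
  where it becomes their recursion. The two adjointness lemmas for \<open>face_measure\<close> treat
  the returns to a visited state and the first visits. Since \<open>x\<close> lies on the simplex,
  the total weight of \<open>x + w\<close> is \<open>1 + (\<Sum>k\<in>UNIV. w $ k)\<close>, the
  reciprocal of the hazard.\<close>

lemma occupation_integral_Suc:
  assumes F: "\<And>i. F i \<in> borel_measurable borel" and x: "x \<in> std_simplex"
  shows "occupation_integral (Suc n) j F x = occupation_integral n j (jump_op F) x"
proof -
  note [measurable] = F
  define v where "v A = occupation_density B j n A" for A
  have vc: "continuous_on UNIV (v A k)" for A k
    unfolding v_def by (rule continuous_occupation_density[where B = B, OF B_nonneg])
  have vp: "0 \<le> v A k w" if "\<And>k. 0 \<le> w $ k" for A k w
    unfolding v_def by (rule occupation_density_nonneg[where B = B, OF B_nonneg that])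
  note [measurable] = borel_measurable_continuous_onI[OF vc]
  define J where "J A i = jump_source B (v A) i" for A i
  have Jc: "continuous_on UNIV (J A i)" for A i
    unfolding J_def by (rule continuous_jump_source[OF vc])
  note [measurable] = borel_measurable_continuous_onI[OF Jc]
  have Jp: "0 \<le> J A i w" if "\<And>k. 0 \<le> w $ k" for A i w
    unfolding J_def by (intro jump_source_nonneg B_nonneg vp that)
  have sc: "scale_coord i 0 \<in> borel_measurable (borel :: (real ^ 'n) measure)" for i
    by (intro borel_measurable_continuous_onI continuous_intros)
  note [measurable] = sc
  have rm[measurable]: "ray_integral i (J A i) \<in> borel_measurable borel" for A i
  proof -
    obtain h where h: "\<And>k. has_gradient (v A k) (h k)"
      using has_gradient_occupation_density[where B = B, OF B_nonneg] unfolding v_def by metis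
    have "has_gradient (J A i) (\<lambda>w. hazard w *\<^sub>R (\<Sum>k\<in>UNIV. B k i *\<^sub>R h k w) + (\<Sum>k\<in>UNIV. B k i * v A k w) *\<^sub>R hazard_gradient w)"
      unfolding J_def jump_source_def[abs_def]
      by (intro has_gradient_mult has_gradient_hazard has_gradient_sum has_gradient_cmult h)
    from has_gradient_measurable(1)[OF has_gradient_ray_integral[OF this]] show ?thesis .
  qed
  define R where "R i w = (\<integral>\<^sup>+t\<in>{0..}. F i (x + (w + t *\<^sub>R axis i 1)) \<partial>lborel)" for i w
  have Rm[measurable]: "R i \<in> borel_measurable borel" for i unfolding R_def by measurable
  have Rr: "ray_mean i (F i) (x + w) = R i w" for i w
    by (simp add: ray_mean_def R_def add.assoc)
  let ?N = "\<lambda>A i. \<integral>\<^sup>+w. R i w * ennreal (J A i w) \<partial>face_measure A"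
  let ?P = "\<lambda>A i. \<integral>\<^sup>+w. F i (x + w) * ennreal (occupation_density B j (Suc n) A i w) \<partial>face_measure A"
  let ?a = "\<lambda>A i w. F i (x + w) * ennreal (ray_integral i (J A i) w)"
  let ?b = "\<lambda>A i w. F i (x + w) * ennreal (J (A - {i}) i (scale_coord i 0 w))"
  have op: "(\<Sum>k\<in>UNIV. jump_op F k (x + w) * ennreal (v A k w)) = (\<Sum>i\<in>UNIV. R i w * ennreal (J A i w))"
    if w: "\<And>k. 0 \<le> w $ k" for A w
  proof -
    have "(\<Sum>k\<in>UNIV. (x + w) $ k) = 1 + (\<Sum>k\<in>UNIV. w $ k)"
      using std_simplexD(3)[OF x] by (simp add: sum.distrib)
    then have h: "1 / (\<Sum>k\<in>UNIV. (x + w) $ k) = hazard w"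
      by (simp add: hazard_eq[OF w])
    have "(\<Sum>k\<in>UNIV. jump_op F k (x + w) * ennreal (v A k w))
        = (\<Sum>k\<in>UNIV. \<Sum>i\<in>UNIV. R i w * (ennreal (hazard w) * (ennreal (B k i) * ennreal (v A k w))))"
      unfolding jump_op_def h Rr by (simp add: sum_distrib_left sum_distrib_right mult_ac)
    also have "\<dots> = (\<Sum>i\<in>UNIV. R i w * (ennreal (hazard w) * (\<Sum>k\<in>UNIV. ennreal (B k i) * ennreal (v A k w))))"
      by (subst sum.swap) (simp add: sum_distrib_left)
    also have "\<dots> = (\<Sum>i\<in>UNIV. R i w * ennreal (J A i w))"
    proof (intro sum.cong refl arg_cong2[where f = times])
      fix i
      have "(\<Sum>k\<in>UNIV. ennreal (B k i) * ennreal (v A k w)) = ennreal (\<Sum>k\<in>UNIV. B k i * v A k w)"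
        using vp[OF w] B_nonneg by (simp add: sum_ennreal[symmetric] ennreal_mult)
      then show "ennreal (hazard w) * (\<Sum>k\<in>UNIV. ennreal (B k i) * ennreal (v A k w)) = ennreal (J A i w)"
        by (simp add: J_def jump_source_def ennreal_mult'[symmetric] hazard_bounds)
    qed
    finally show ?thesis .
  qed
  have "occupation_integral n j (jump_op F) x
      = (\<Sum>A\<in>UNIV. \<Sum>k\<in>UNIV. \<integral>\<^sup>+w. jump_op F k (x + w) * ennreal (v A k w) \<partial>face_measure A)"
    unfolding occupation_integral_def v_def by (rule sum.swap)
  also have "\<dots> = (\<Sum>A\<in>UNIV. \<integral>\<^sup>+w. (\<Sum>k\<in>UNIV. jump_op F k (x + w) * ennreal (v A k w)) \<partial>face_measure A)"
    by (intro sum.cong refl nn_integral_sum[symmetric]) measurable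
  also have "\<dots> = (\<Sum>A\<in>UNIV. \<integral>\<^sup>+w. (\<Sum>i\<in>UNIV. R i w * ennreal (J A i w)) \<partial>face_measure A)"
  proof (intro sum.cong refl nn_integral_cong_AE)
    fix A :: "'n set"
    show "AE w in face_measure A. (\<Sum>k\<in>UNIV. jump_op F k (x + w) * ennreal (v A k w))
        = (\<Sum>i\<in>UNIV. R i w * ennreal (J A i w))"
      using AE_face_measure_nonneg[of A] by eventually_elim (rule op, blast)
  qed
  also have "\<dots> = (\<Sum>A\<in>UNIV. \<Sum>i\<in>UNIV. ?N A i)"
    by (intro sum.cong refl nn_integral_sum) measurable
  also have "\<dots> = (\<Sum>i\<in>UNIV. \<Sum>A\<in>UNIV. ?N A i)"
    by (rule sum.swap)
  also have "\<dots> = (\<Sum>i\<in>UNIV. \<Sum>A\<in>UNIV. ?P A i)"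
  proof (rule sum.cong[OF refl])
    fix i
    have in': "(?N A i)
        = (\<integral>\<^sup>+w. ?a A i w \<partial>face_measure A)" if "i \<in> A" for A
      unfolding R_def
      by (rule nn_integral_face_ray_same[of "\<lambda>w. F i (x + w)" "J A i" i A]) (use that Jc Jp in auto)
    have out': "(?N A i)
        = (\<integral>\<^sup>+w. F i (x + w) * ennreal (J A i (scale_coord i 0 w)) \<partial>face_measure (insert i A))" if "i \<notin> A" for A
      unfolding R_def
      by (rule nn_integral_face_ray_new[of "\<lambda>w. F i (x + w)" "J A i" i A]) (use that sc in auto)
    \<comment> \<open>Here \<open>A\<close> is the visited set before the jump into
      \<open>i\<close>; the two parts are the returns and the first visits.\<close>
    have "(\<Sum>A\<in>UNIV. ?N A i)
        = (\<Sum>A\<in>{A. i \<in> A}. ?N A i)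
        + (\<Sum>A\<in>{A. i \<notin> A}. ?N A i)"
      by (subst sum.union_disjoint[symmetric]) (auto intro!: sum.cong)
    \<comment> \<open>First visits are reindexed by the visited set after the jump, which puts them
      on the same face as the returns.\<close>
    also have "(\<Sum>A\<in>{A. i \<notin> A}. ?N A i)
        = (\<Sum>A\<in>{A. i \<in> A}. \<integral>\<^sup>+w. ?b A i w \<partial>face_measure A)"
      by (rule sum.reindex_bij_witness[of _ "\<lambda>A. A - {i}" "insert i"]) (auto simp: out' insert_absorb)
    also have "(\<Sum>A\<in>{A. i \<in> A}. ?N A i)
        = (\<Sum>A\<in>{A. i \<in> A}. \<integral>\<^sup>+w. ?a A i w \<partial>face_measure A)"
      by (intro sum.cong refl in') simp
    also have "(\<Sum>A\<in>{A. i \<in> A}. \<integral>\<^sup>+w. ?a A i w \<partial>face_measure A)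
        + (\<Sum>A\<in>{A. i \<in> A}. \<integral>\<^sup>+w. ?b A i w \<partial>face_measure A)
        = (\<Sum>A\<in>{A. i \<in> A}. ?P A i)"
      unfolding sum.distrib[symmetric]
    proof (rule sum.cong[OF refl])
      fix A assume "A \<in> {A. i \<in> A}"
      then have A: "i \<in> A" by simp
      have "(\<integral>\<^sup>+w. ?a A i w \<partial>face_measure A)
          + (\<integral>\<^sup>+w. ?b A i w \<partial>face_measure A)
          = (\<integral>\<^sup>+w. ?a A i w + ?b A i w \<partial>face_measure A)"
        by (rule nn_integral_add[symmetric]) measurable
      also have "\<dots> = (?P A i)"
      proof (rule nn_integral_cong_AE)
        show "AE w in face_measure A. ?a A i w + ?b A i w
          = F i (x + w) * ennreal (occupation_density B j (Suc n) A i w)"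
          using AE_face_measure_nonneg
        proof eventually_elim
          case (elim w)
          have "0 \<le> ray_integral i (J A i) w" using elim by (intro ray_integral_nonneg Jp) auto
          moreover have "0 \<le> J (A - {i}) i (scale_coord i 0 w)" using elim by (intro Jp scale_coord_nonneg) auto
          ultimately show ?case
            using A by (simp add: J_def v_def distrib_left[symmetric])
        qed
      qed
      finally show "(\<integral>\<^sup>+w. ?a A i w \<partial>face_measure A)
          + (\<integral>\<^sup>+w. ?b A i w \<partial>face_measure A)
          = (?P A i)" .
    qed
    also have "\<dots> = (\<Sum>A\<in>UNIV. ?P A i)"
      by (rule sum.mono_neutral_left) auto
    finally show "(\<Sum>A\<in>UNIV. ?N A i)
      = (\<Sum>A\<in>UNIV. ?P A i)" .
  qed
  finally show ?thesis unfolding occupation_integral_def ..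
qed

lemma start_total_iterate:
  assumes F: "\<And>i. F i \<in> borel_measurable borel"
  shows "start_total ((jump_op ^^ n) F) = (\<Sum>j\<in>UNIV. \<integral>\<^sup>+x. occupation_integral n j F x \<partial>\<mu> j)"
proof -
  \<comment> \<open>The jumps pass one after the other from the functions to the densities.\<close>
  have *: "occupation_integral 0 j ((jump_op ^^ n) F) x = occupation_integral n j F x"
    if "x \<in> std_simplex" for j x
    using F
  proof (induction n arbitrary: F)
    case (Suc n)
    have "occupation_integral 0 j ((jump_op ^^ n) (jump_op F)) x = occupation_integral n j (jump_op F) x"
      by (rule Suc.IH) (rule measurable_jump_op[OF Suc.prems])
    then show ?case
      using occupation_integral_Suc[OF Suc.prems that] by (simp add: funpow_swap1)
  qed simp
  show ?thesis
    unfolding start_total_def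
  proof (intro sum.cong refl nn_integral_cong_AE)
    fix j
    show "AE x in \<mu> j. ray_mean j ((jump_op ^^ n) F j) x = occupation_integral n j F x"
      using supp[of j]
      by eventually_elim (simp add: *[symmetric] occupation_integral_0 measurable_jump_op_iter F)
  qed
qed

end

section \<open>The density on the cone\<close>

lemma nn_integral_lborel_translate:
  fixes f :: "'a::euclidean_space \<Rightarrow> ennreal"
  assumes "f \<in> borel_measurable borel"
  shows "(\<integral>\<^sup>+y. f (y + c) \<partial>lborel) = (\<integral>\<^sup>+y. f y \<partial>lborel)"
proof -
  have "(\<integral>\<^sup>+y. f y \<partial>distr lborel borel ((+) c)) = (\<integral>\<^sup>+y. f (c + y) \<partial>lborel)"
    by (rule nn_integral_distr) (use assms in auto)
  then show ?thesis by (simp add: lborel_distr_plus add.commute)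
qed

lemma nn_integral_lborel_scale:
  fixes f :: "'a::euclidean_space \<Rightarrow> ennreal"
  assumes [measurable]: "f \<in> borel_measurable borel" and c: "0 < c"
  shows "(\<integral>\<^sup>+y. f y \<partial>lborel) = ennreal (c ^ DIM('a)) * (\<integral>\<^sup>+y. f (c *\<^sub>R y) \<partial>lborel)"
proof -
  have "(\<integral>\<^sup>+y. f y \<partial>lborel) = (\<integral>\<^sup>+y. f y \<partial>density (distr lborel borel (\<lambda>y. 0 + c *\<^sub>R y)) (\<lambda>_. ennreal (\<bar>c\<bar> ^ DIM('a))))"
    using c by (subst lborel_affine[of c 0]) auto
  also have "\<dots> = ennreal (c ^ DIM('a)) * (\<integral>\<^sup>+y. f (c *\<^sub>R y) \<partial>lborel)"
    using c by (simp add: nn_integral_density nn_integral_distr nn_integral_cmult)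
  finally show ?thesis .
qed

definition unit_corner :: "(real ^ 'n) set" where
  "unit_corner = {y. \<forall>k. 1 < y $ k}"

lemma open_unit_corner: "open (unit_corner :: (real ^ 'n::finite) set)"
proof -
  have "open (\<Inter>k\<in>(UNIV :: 'n set). {y :: real ^ 'n. 1 < y $ k})"
    by (intro open_INT ballI open_Collect_less continuous_intros) simp
  moreover have "unit_corner = (\<Inter>k\<in>(UNIV :: 'n set). {y :: real ^ 'n. 1 < y $ k})"
    by (auto simp: unit_corner_def)
  ultimately show ?thesis by simp
qed

lemma unit_corner_scale:
  assumes "y \<in> unit_corner" "1 \<le> c"
  shows "c *\<^sub>R y \<in> unit_corner"
  unfolding unit_corner_def
proof (clarsimp)
  fix k
  have "1 < y $ k" using assms(1) by (auto simp: unit_corner_def)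
  then have "1 * 1 < c * y $ k" using assms(2) by (intro mult_le_less_imp_less) auto
  then show "1 < c * y $ k" by simp
qed

context stationary_zigzag
begin

text \<open>The occupation densities convolved with the starting law. Integration over
  \<open>x\<close> keeps their regularity, whatever the measures \<open>\<mu> j\<close> look like on
  the simplex.\<close>

definition cone_density :: "'n \<Rightarrow> real ^ 'n \<Rightarrow> real" where
  "cone_density i y = (\<Sum>j\<in>UNIV. \<integral>x. total_density B j i (y - x) \<partial>\<mu> j)"

lemma total_density_continuous: "continuous_on UNIV (total_density B j i)"
proof -
  obtain g where "\<forall>i. has_gradient (total_density B j i) (g i) \<and>
           (\<forall>w. g i w $ i = jump_source B (total_density B j) i w)"
    using total_density_gradient(2)[where B = B and j = j, OF B_nonneg] by blast
  then show ?thesis using has_gradientD(3) by blast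
qed

lemma total_density_nonneg:
  assumes "\<And>k. 0 \<le> w $ k"
  shows "0 \<le> total_density B j i w"
  unfolding total_density_def
  by (intro suminf_nonneg total_density_gradient(1)[where B = B, OF B_nonneg]
      occupation_density_nonneg[where B = B, OF B_nonneg assms])

lemma corner_diff_simplex:
  assumes "y \<in> unit_corner" "x \<in> std_simplex"
  shows "0 \<le> (y - x) $ k"
  using assms std_simplexD(2)[OF assms(2), of k] by (auto simp: unit_corner_def less_imp_le intro: order_trans)

lemma cone_density_nonneg:
  assumes "y \<in> unit_corner"
  shows "0 \<le> cone_density i y"
  unfolding cone_density_def
proof (intro sum_nonneg integral_nonneg_AE)
  fix j
  show "AE x in \<mu> j. 0 \<le> total_density B j i (y - x)"
    using supp[of j] by eventually_elim (intro total_density_nonneg corner_diff_simplex assms)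
qed

text \<open>For \<open>y\<close> in the corner and \<open>x\<close> in the simplex,
  \<open>y - x\<close> lies in the orthant and \<open>hazard (y - x)\<close> is the reciprocal of
  the coordinate sum of \<open>y\<close>. It does not depend on \<open>x\<close> and leaves the
  integral, so the equations of the occupation densities become a closed system for the cone
  densities.\<close>

lemma cone_density_gradient:
  "\<exists>g. \<forall>i. has_gradient (cone_density i) (g i) \<and>
     (\<forall>y\<in>unit_corner. g i y $ i = 1 / (\<Sum>k\<in>UNIV. y $ k) * (\<Sum>k\<in>UNIV. B k i * cone_density k y))"
proof -
  have "\<forall>j. \<exists>g. \<forall>i. has_gradient (total_density B j i) (g i) \<and>
           (\<forall>w. g i w $ i = jump_source B (total_density B j) i w)"
    using total_density_gradient(2)[where B = B, OF B_nonneg] by blast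
  then obtain g where g: "\<And>j i. has_gradient (total_density B j i) (g j i)"
    "\<And>j i w. g j i w $ i = jump_source B (total_density B j) i w"
    by metis
  define h where "h i y = (\<Sum>j\<in>UNIV. \<integral>x. g j i (y - x) \<partial>\<mu> j)" for i y
  have cg: "continuous_on UNIV (\<lambda>x. g j i (y - x))" for i j y
    by (intro continuous_on_compose2[OF has_gradientD(2)[OF g(1)]] continuous_intros) auto
  have ct: "continuous_on UNIV (\<lambda>x. total_density B j i (y - x))" for i j y
    by (intro continuous_on_compose2[OF total_density_continuous] continuous_intros) auto
  have "has_gradient (\<lambda>y. \<integral>x. total_density B j i (y - x) \<partial>\<mu> j) (\<lambda>y. \<integral>x. g j i (y - x) \<partial>\<mu> j)" for i j
  proof (rule has_gradient_integral[OF fin supp])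
    show "has_gradient (\<lambda>y. total_density B j i (y - x)) (\<lambda>y. g j i (y - x))" for x
      using has_gradient_affine[OF g(1), of j i 1 "- x"] by simp
    show "(\<lambda>x. total_density B j i (y - x)) \<in> borel_measurable (\<mu> j)"
      "(\<lambda>x. g j i (y - x)) \<in> borel_measurable (\<mu> j)" for y
      using borel_measurable_continuous_onI[OF ct] borel_measurable_continuous_onI[OF cg] by auto
    fix R :: real
    obtain C where C: "\<And>y. norm y \<le> R + 1 \<Longrightarrow> norm (total_density B j i y) \<le> C" "C \<ge> 0"
      using continuous_on_bounded_cball[OF total_density_continuous, of "R + 1"] by blast
    obtain C' where C': "\<And>y. norm y \<le> R + 1 \<Longrightarrow> norm (g j i y) \<le> C'" "C' \<ge> 0"
      using continuous_on_bounded_cball[OF has_gradientD(2)[OF g(1)], of "R + 1"] by blast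
    have "\<bar>total_density B j i (y - x)\<bar> \<le> C + C' \<and> norm (g j i (y - x)) \<le> C + C'"
      if "norm y \<le> R" "x \<in> std_simplex" for x y
    proof -
      have "norm (y - x) \<le> R + 1"
        using norm_triangle_ineq4[of y x] norm_std_simplex[OF that(2)] that(1) by linarith
      from C(1)[OF this] C'(1)[OF this] C(2) C'(2) show ?thesis by simp
    qed
    then show "\<exists>C. \<forall>y x. norm y \<le> R \<longrightarrow> x \<in> std_simplex \<longrightarrow>
        \<bar>total_density B j i (y - x)\<bar> \<le> C \<and> norm (g j i (y - x)) \<le> C"
      by blast
  qed
  then have "has_gradient (cone_density i) (h i)" for i
    unfolding cone_density_def[abs_def] h_def by (rule has_gradient_sum)
  moreover have "h i y $ i = 1 / (\<Sum>k\<in>UNIV. y $ k) * (\<Sum>k\<in>UNIV. B k i * cone_density k y)"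
    if y: "y \<in> unit_corner" for i y
  proof -
    have ig: "integrable (\<mu> j) (\<lambda>x. g j i (y - x))" for j
    proof -
      interpret finite_measure "\<mu> j" by (rule fin)
      obtain C where C: "\<And>x. norm x \<le> 1 \<Longrightarrow> norm (g j i (y - x)) \<le> C"
        using continuous_on_bounded_cball[OF cg, of 1] by blast
      have "AE x in \<mu> j. norm (g j i (y - x)) \<le> C"
        using supp[of j] by eventually_elim (rule C[OF norm_std_simplex])
      then show ?thesis
        using borel_measurable_continuous_onI[OF cg[of j i y]]
        by (intro integrable_const_bound[of _ C]) auto
    qed
    have "h i y $ i = (\<Sum>j\<in>UNIV. (\<integral>x. g j i (y - x) $ i \<partial>\<mu> j))"
      unfolding h_def sum_component
      by (intro sum.cong refl integral_bounded_linear[OF bounded_linear_vec_nth, symmetric] ig)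
    also have "\<dots> = (\<Sum>j\<in>UNIV. \<integral>x. 1 / (\<Sum>k\<in>UNIV. y $ k) * (\<Sum>k\<in>UNIV. B k i * total_density B j k (y - x)) \<partial>\<mu> j)"
    proof (intro sum.cong refl integral_cong_AE)
      fix j
      show "AE x in \<mu> j. g j i (y - x) $ i
          = 1 / (\<Sum>k\<in>UNIV. y $ k) * (\<Sum>k\<in>UNIV. B k i * total_density B j k (y - x))"
        using supp[of j]
      proof eventually_elim
        case (elim x)
        have "hazard (y - x) = 1 / (\<Sum>k\<in>UNIV. y $ k)"
          using hazard_eq[OF corner_diff_simplex[OF y elim]] std_simplexD(3)[OF elim]
          by (simp add: sum_subtractf)
        then show ?case by (simp add: g(2) jump_source_def)
      qed
      show "(\<lambda>x. g j i (y - x) $ i) \<in> borel_measurable (\<mu> j)"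
        using borel_measurable_continuous_onI[OF continuous_on_component[OF cg[of j i y], of i]] by simp
      show "(\<lambda>x. 1 / (\<Sum>k\<in>UNIV. y $ k) * (\<Sum>k\<in>UNIV. B k i * total_density B j k (y - x))) \<in> borel_measurable (\<mu> j)"
        using borel_measurable_continuous_onI[OF ct] by auto
    qed
    also have "\<dots> = (\<Sum>j\<in>UNIV. 1 / (\<Sum>k\<in>UNIV. y $ k) * (\<Sum>k\<in>UNIV. B k i * (\<integral>x. total_density B j k (y - x) \<partial>\<mu> j)))"
      by (simp add: Bochner_Integration.integral_sum integrable_mu[OF ct])
    also have "\<dots> = 1 / (\<Sum>k\<in>UNIV. y $ k) * (\<Sum>k\<in>UNIV. B k i * cone_density k y)"
      unfolding cone_density_def sum_distrib_left by (rule sum.swap)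
    finally show ?thesis .
  qed
  ultimately show ?thesis by blast
qed

lemma cone_density_continuous: "continuous_on UNIV (cone_density i)"
  using cone_density_gradient has_gradientD(3) by blast

text \<open>If \<open>k\<close> has not been visited, the \<open>k\<close>-th coordinate of
  \<open>x + w\<close> is \<open>x $ k\<close>, at most 1, and the point is not in the corner. All
  visited sets except \<open>UNIV\<close> drop out.\<close>

lemma occupation_integral_corner:
  assumes A[measurable]: "A \<in> sets borel" and AU: "A \<subseteq> unit_corner" and x: "x \<in> std_simplex"
  shows "occupation_integral n j (\<lambda>k. if k = i then indicator A else (\<lambda>_. 0)) x =
    (\<integral>\<^sup>+w. indicator A (x + w) * ennreal (occupation_density B j n UNIV i w) * indicator orthant w \<partial>lborel)"
proof -
  note [measurable] = borel_measurable_continuous_onI[OF continuous_occupation_density[where B = B, OF B_nonneg]]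
  have Z: "(\<integral>\<^sup>+w. indicator A (x + w) * ennreal (occupation_density B j n S i w) \<partial>face_measure S) = 0"
    if SU: "S \<noteq> UNIV" for S
  proof -
    obtain k where k: "k \<notin> S" using SU by blast
    have "(\<integral>\<^sup>+w. indicator A (x + w) * ennreal (occupation_density B j n S i w) \<partial>face_measure S)
        = (\<integral>\<^sup>+w. 0 \<partial>face_measure S)"
    proof (rule nn_integral_cong_AE)
      show "AE w in face_measure S. indicator A (x + w) * ennreal (occupation_density B j n S i w) = 0"
        using AE_face_measure_zero[OF k]
      proof eventually_elim
        case (elim w)
        then have "(x + w) $ k \<le> 1" using std_simplexD(2)[OF x] by simp
        then have "x + w \<notin> unit_corner" by (auto simp: unit_corner_def not_less)
        then have "x + w \<notin> A" using AU by blast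
        then show ?case by simp
      qed
    qed
    then show ?thesis by simp
  qed
  have "occupation_integral n j (\<lambda>k. if k = i then indicator A else (\<lambda>_. 0)) x
      = (\<Sum>k\<in>UNIV. if k = i then \<Sum>S\<in>UNIV. \<integral>\<^sup>+w. indicator A (x + w) * ennreal (occupation_density B j n S i w) \<partial>face_measure S else 0)"
    unfolding occupation_integral_def by (intro sum.cong refl) auto
  also have "\<dots> = (\<Sum>S\<in>UNIV. \<integral>\<^sup>+w. indicator A (x + w) * ennreal (occupation_density B j n S i w) \<partial>face_measure S)"
    by (simp only: sum.delta finite UNIV_I if_True)
  also have "\<dots> = (\<Sum>S\<in>(UNIV :: 'n set set). if S = UNIV then \<integral>\<^sup>+w. indicator A (x + w) * ennreal (occupation_density B j n UNIV i w) \<partial>face_measure UNIV else 0)"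
    by (intro sum.cong refl) (auto simp: Z)
  also have "\<dots> = (\<integral>\<^sup>+w. indicator A (x + w) * ennreal (occupation_density B j n UNIV i w) \<partial>face_measure UNIV)"
    by simp
  also have "\<dots> = (\<integral>\<^sup>+w. indicator A (x + w) * ennreal (occupation_density B j n UNIV i w) * indicator orthant w \<partial>lborel)"
    unfolding face_measure_UNIV by (subst nn_integral_density) (auto simp: mult_ac)
  finally show ?thesis .
qed

text \<open>The expansion over jumps for the indicator of \<open>A\<close> in state
  \<open>i\<close>. All terms are nonnegative, so sums and integrals may be exchanged, and the
  translation by \<open>x\<close> turns the density of \<open>w\<close> into that of
  \<open>x + w\<close>. Boundedness of \<open>A\<close> serves the exponential domination.\<close>

lemma cone_integral_density:
  assumes A[measurable]: "A \<in> sets borel" and bA: "bounded A" and AU: "A \<subseteq> unit_corner"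
  shows "cone_integral i (indicator A) = (\<integral>\<^sup>+y\<in>A. ennreal (cone_density i y) \<partial>lborel)"
proof -
  define F where "F k = (if k = i then indicator A else (\<lambda>_. 0 :: ennreal))" for k
  have Fm: "F k \<in> borel_measurable borel" for k by (auto simp: F_def)
  note [measurable] = borel_measurable_continuous_onI[OF continuous_occupation_density[where B = B, OF B_nonneg]]
    borel_measurable_continuous_onI[OF total_density_continuous]
  obtain R where R: "\<And>y. y \<in> A \<Longrightarrow> norm y \<le> R" using bA by (auto simp: bounded_iff)
  define L where "L = real CARD('n) * R"
  have L: "(\<Sum>k\<in>UNIV. y $ k) \<le> L" if "y \<in> A" for y
  proof -
    have "(\<Sum>k\<in>UNIV. y $ k) \<le> l1 y" unfolding l1_def by (intro sum_mono) simp
    also have "\<dots> \<le> L"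
      unfolding L_def by (rule order_trans[OF l1_le mult_left_mono[OF R[OF that]]]) simp
    finally show ?thesis .
  qed
  \<comment> \<open>\<open>L\<close> bounds the coordinate sums on \<open>A\<close>, so the constant
    compensates the decay there.\<close>
  have dom: "exp_dominated (exp (2 * real (Suc m) * L)) F"
    unfolding exp_dominated_def
  proof (intro allI impI)
    fix k y
    have "1 \<le> exp (2 * real (Suc m) * L) * exp (- (2 * real (Suc m)) * (\<Sum>k\<in>UNIV. y $ k))" if "y \<in> A"
    proof -
      have "0 \<le> 2 * real (Suc m) * (L - (\<Sum>k\<in>UNIV. y $ k))" using L[OF that] by (intro mult_nonneg_nonneg) auto
      then have "1 \<le> exp (2 * real (Suc m) * (L - (\<Sum>k\<in>UNIV. y $ k)))" by simp
      also have "\<dots> = exp (2 * real (Suc m) * L) * exp (- (2 * real (Suc m)) * (\<Sum>k\<in>UNIV. y $ k))"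
        by (simp add: exp_add[symmetric] right_diff_distrib del: of_nat_Suc)
      finally show ?thesis .
    qed
    then show "F k y \<le> ennreal (exp (2 * real (Suc m) * L) * exp (- (2 * real (Suc m)) * (\<Sum>k\<in>UNIV. y $ k)))"
      by (auto simp: F_def ennreal_ge_1 split: split_indicator simp del: of_nat_Suc)
  qed
  have "cone_integral i (indicator A) = cone_total F"
    unfolding cone_total_def F_def
    by (subst sum.remove[of _ i]) (auto simp: cone_integral_def)
  also have "\<dots> = (\<Sum>n. start_total ((jump_op ^^ n) F))"
    by (rule cone_total_series[OF Fm dom]) simp
  also have "\<dots> = (\<Sum>n. \<Sum>j\<in>UNIV. \<integral>\<^sup>+x. (\<integral>\<^sup>+w. indicator A (x + w) * ennreal (occupation_density B j n UNIV i w) * indicator orthant w \<partial>lborel) \<partial>\<mu> j)"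
  proof (rule suminf_cong)
    fix n
    show "start_total ((jump_op ^^ n) F) = (\<Sum>j\<in>UNIV. \<integral>\<^sup>+x. (\<integral>\<^sup>+w. indicator A (x + w) * ennreal (occupation_density B j n UNIV i w) * indicator orthant w \<partial>lborel) \<partial>\<mu> j)"
      unfolding start_total_iterate[OF Fm]
    proof (intro sum.cong refl nn_integral_cong_AE)
      fix j
      show "AE x in \<mu> j. occupation_integral n j F x = (\<integral>\<^sup>+w. indicator A (x + w) * ennreal (occupation_density B j n UNIV i w) * indicator orthant w \<partial>lborel)"
        using supp[of j] unfolding F_def
        by eventually_elim (rule occupation_integral_corner[OF A AU])
    qed
  qed
  also have "\<dots> = (\<Sum>j\<in>UNIV. \<Sum>n. \<integral>\<^sup>+x. (\<integral>\<^sup>+w. indicator A (x + w) * ennreal (occupation_density B j n UNIV i w) * indicator orthant w \<partial>lborel) \<partial>\<mu> j)"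
    by (rule suminf_sum) simp
  also have "\<dots> = (\<Sum>j\<in>UNIV. \<integral>\<^sup>+x. (\<integral>\<^sup>+y. indicator A y * ennreal (total_density B j i (y - x)) \<partial>lborel) \<partial>\<mu> j)"
  proof (rule sum.cong[OF refl])
    fix j
    have "(\<Sum>n. \<integral>\<^sup>+x. (\<integral>\<^sup>+w. indicator A (x + w) * ennreal (occupation_density B j n UNIV i w) * indicator orthant w \<partial>lborel) \<partial>\<mu> j)
        = (\<integral>\<^sup>+x. (\<Sum>n. \<integral>\<^sup>+w. indicator A (x + w) * ennreal (occupation_density B j n UNIV i w) * indicator orthant w \<partial>lborel) \<partial>\<mu> j)"
      by (rule nn_integral_suminf[symmetric]) measurable
    also have "\<dots> = (\<integral>\<^sup>+x. (\<integral>\<^sup>+y. indicator A y * ennreal (total_density B j i (y - x)) \<partial>lborel) \<partial>\<mu> j)"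
    proof (rule nn_integral_cong_AE)
      show "AE x in \<mu> j. (\<Sum>n. \<integral>\<^sup>+w. indicator A (x + w) * ennreal (occupation_density B j n UNIV i w) * indicator orthant w \<partial>lborel)
          = (\<integral>\<^sup>+y. indicator A y * ennreal (total_density B j i (y - x)) \<partial>lborel)"
        using supp[of j]
      proof eventually_elim
        case (elim x)
        have "(\<Sum>n. \<integral>\<^sup>+w. indicator A (x + w) * ennreal (occupation_density B j n UNIV i w) * indicator orthant w \<partial>lborel)
            = (\<integral>\<^sup>+w. (\<Sum>n. indicator A (x + w) * ennreal (occupation_density B j n UNIV i w) * indicator orthant w) \<partial>lborel)"
          by (rule nn_integral_suminf[symmetric]) measurable
        also have "\<dots> = (\<integral>\<^sup>+w. indicator A (w + x) * ennreal (total_density B j i ((w + x) - x)) \<partial>lborel)"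
        proof (rule nn_integral_cong)
          fix w
          show "(\<Sum>n. indicator A (x + w) * ennreal (occupation_density B j n UNIV i w) * indicator orthant w)
              = indicator A (w + x) * ennreal (total_density B j i ((w + x) - x))"
          proof (cases "x + w \<in> A")
            case True
            then have w: "0 \<le> w $ k" for k using corner_diff_simplex[of "x + w" x k] AU elim by auto
            then have "w \<in> orthant" by (simp add: orthant_def)
            moreover have "(\<Sum>n. ennreal (occupation_density B j n UNIV i w)) = ennreal (total_density B j i w)"
              unfolding total_density_def
              by (intro suminf_ennreal2 total_density_gradient(1)[where B = B, OF B_nonneg]
                  occupation_density_nonneg[where B = B, OF B_nonneg w])
            ultimately show ?thesis using True by (simp add: add.commute)
          qed (simp add: add.commute)
        qed
        also have "\<dots> = (\<integral>\<^sup>+y. indicator A y * ennreal (total_density B j i (y - x)) \<partial>lborel)"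
          by (rule nn_integral_lborel_translate[of "\<lambda>y. indicator A y * ennreal (total_density B j i (y - x))"]) measurable
        finally show ?case .
      qed
    qed
    finally show "(\<Sum>n. \<integral>\<^sup>+x. (\<integral>\<^sup>+w. indicator A (x + w) * ennreal (occupation_density B j n UNIV i w) * indicator orthant w \<partial>lborel) \<partial>\<mu> j)
        = (\<integral>\<^sup>+x. (\<integral>\<^sup>+y. indicator A y * ennreal (total_density B j i (y - x)) \<partial>lborel) \<partial>\<mu> j)" .
  qed
  also have "\<dots> = (\<Sum>j\<in>UNIV. \<integral>\<^sup>+y. indicator A y * (\<integral>\<^sup>+x. ennreal (total_density B j i (y - x)) \<partial>\<mu> j) \<partial>lborel)"
  proof (rule sum.cong[OF refl])
    fix j
    interpret sigma_finite_measure "\<mu> j" by (rule sigma_finite_mu)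
    interpret P: pair_sigma_finite "lborel :: (real ^ 'n) measure" "\<mu> j" ..
    have "(\<integral>\<^sup>+x. (\<integral>\<^sup>+y. indicator A y * ennreal (total_density B j i (y - x)) \<partial>lborel) \<partial>\<mu> j)
        = (\<integral>\<^sup>+y. (\<integral>\<^sup>+x. indicator A y * ennreal (total_density B j i (y - x)) \<partial>\<mu> j) \<partial>lborel)"
      by (rule P.Fubini') measurable
    also have "\<dots> = (\<integral>\<^sup>+y. indicator A y * (\<integral>\<^sup>+x. ennreal (total_density B j i (y - x)) \<partial>\<mu> j) \<partial>lborel)"
      by (rule nn_integral_cong, rule nn_integral_cmult) measurable
    finally show "(\<integral>\<^sup>+x. (\<integral>\<^sup>+y. indicator A y * ennreal (total_density B j i (y - x)) \<partial>lborel) \<partial>\<mu> j) = \<dots>" .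
  qed
  also have "\<dots> = (\<integral>\<^sup>+y. (\<Sum>j\<in>UNIV. indicator A y * (\<integral>\<^sup>+x. ennreal (total_density B j i (y - x)) \<partial>\<mu> j)) \<partial>lborel)"
  proof (rule nn_integral_sum[symmetric])
    fix j
    interpret sigma_finite_measure "\<mu> j" by (rule sigma_finite_mu)
    show "(\<lambda>y. indicator A y * (\<integral>\<^sup>+x. ennreal (total_density B j i (y - x)) \<partial>\<mu> j)) \<in> borel_measurable lborel"
      by measurable
  qed
  also have "\<dots> = (\<integral>\<^sup>+y\<in>A. ennreal (cone_density i y) \<partial>lborel)"
  proof (rule nn_integral_cong)
    fix y
    have "(\<Sum>j\<in>UNIV. \<integral>\<^sup>+x. ennreal (total_density B j i (y - x)) \<partial>\<mu> j) = ennreal (cone_density i y)" if y: "y \<in> A"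
    proof -
      have yU: "y \<in> unit_corner" using y AU by auto
      have ae: "AE x in \<mu> j. 0 \<le> total_density B j i (y - x)" for j
        using supp[of j] by eventually_elim (intro total_density_nonneg corner_diff_simplex yU)
      have ct: "continuous_on UNIV (\<lambda>x. total_density B j i (y - x))" for j
        by (intro continuous_on_compose2[OF total_density_continuous] continuous_intros) auto
      have "(\<integral>\<^sup>+x. ennreal (total_density B j i (y - x)) \<partial>\<mu> j) = ennreal (\<integral>x. total_density B j i (y - x) \<partial>\<mu> j)" for j
        by (rule nn_integral_eq_integral[OF integrable_mu[OF ct] ae])
      then show ?thesis
        unfolding cone_density_def by (simp add: sum_ennreal integral_nonneg_AE[OF ae])
    qed
    then show "(\<Sum>j\<in>UNIV. indicator A y * (\<integral>\<^sup>+x. ennreal (total_density B j i (y - x)) \<partial>\<mu> j)) = ennreal (cone_density i y) * indicator A y"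
      by (auto split: split_indicator)
  qed
  finally show ?thesis .
qed

text \<open>Under multiplication by \<open>c\<close> the cone measure gains
  \<open>c ^ (m + 2)\<close>, of which \<open>m + 1\<close> powers come from the weight and one from
  d\<sigma>, while Lebesgue measure gains \<open>c ^ CARD('n)\<close>. Continuity makes the
  resulting equality pointwise. The degree may be negative, hence the powers on both sides.\<close>

lemma cone_density_homogeneous:
  assumes y: "y \<in> unit_corner" and c: "1 \<le> c"
  shows "c ^ CARD('n) * cone_density i (c *\<^sub>R y) = c ^ (m + 2) * cone_density i y"
proof (rule continuous_densities_unique[OF open_unit_corner _ _ _ _ _ _ _ y])
  have cc: "continuous_on UNIV (\<lambda>y. cone_density i (c *\<^sub>R y))"
    by (intro continuous_on_compose2[OF cone_density_continuous] continuous_intros) auto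
  show "continuous_on unit_corner (\<lambda>y. c ^ CARD('n) * cone_density i (c *\<^sub>R y))"
    "continuous_on unit_corner (\<lambda>y. c ^ (m + 2) * cone_density i y)"
    by (intro continuous_intros continuous_on_subset[OF cc] continuous_on_subset[OF cone_density_continuous]; simp)+
  show "(\<lambda>y. c ^ CARD('n) * cone_density i (c *\<^sub>R y)) \<in> borel_measurable borel"
    "(\<lambda>y. c ^ (m + 2) * cone_density i y) \<in> borel_measurable borel"
    by (intro borel_measurable_continuous_onI continuous_intros cc cone_density_continuous)+
  show "0 \<le> c ^ CARD('n) * cone_density i (c *\<^sub>R z)" "0 \<le> c ^ (m + 2) * cone_density i z" if "z \<in> unit_corner" for z
    using c that by (auto intro!: mult_nonneg_nonneg cone_density_nonneg unit_corner_scale)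
  fix A :: "(real ^ 'n) set"
  assume A: "A \<in> sets borel" "bounded A" "A \<subseteq> unit_corner"
  note [measurable] = A(1) borel_measurable_continuous_onI[OF cone_density_continuous]
  \<comment> \<open>The dilation of \<open>A\<close> by \<open>c\<close>, written as a preimage so
    that it is visibly measurable.\<close>
  define A' where "A' = (\<lambda>y. (1 / c) *\<^sub>R y) -` A"
  have A'i: "y \<in> A' \<longleftrightarrow> (1 / c) *\<^sub>R y \<in> A" for y by (simp add: A'_def)
  have A'm[measurable]: "A' \<in> sets borel"
    unfolding A'_def by (rule measurable_sets_borel[OF _ A(1)]) measurable
  have A'_eq: "A' = (\<lambda>y. c *\<^sub>R y) ` A"
    using c by (force simp: A'_def image_iff)
  have A'b: "bounded A'" unfolding A'_eq by (rule bounded_scaling[OF A(2)])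
  have A'U: "A' \<subseteq> unit_corner" unfolding A'_eq using A(3) c unit_corner_scale by auto
  let ?h = "\<lambda>s. (\<integral>\<^sup>+x. indicator A (s *\<^sub>R x) \<partial>\<mu> i)"
  have "(\<integral>\<^sup>+y\<in>A. ennreal (c ^ CARD('n) * cone_density i (c *\<^sub>R y)) \<partial>lborel)
      = ennreal (c ^ CARD('n)) * (\<integral>\<^sup>+y. ennreal (cone_density i (c *\<^sub>R y)) * indicator A' (c *\<^sub>R y) \<partial>lborel)"
    using c by (subst nn_integral_cmult[symmetric])
       (auto intro!: nn_integral_cong simp: A'i ennreal_mult' mult.assoc split: split_indicator)
  also have "\<dots> = (\<integral>\<^sup>+y\<in>A'. ennreal (cone_density i y) \<partial>lborel)"
    using c nn_integral_lborel_scale[of "\<lambda>y. ennreal (cone_density i y) * indicator A' y" c] by simp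
  also have "\<dots> = cone_integral i (indicator A')"
    by (rule cone_integral_density[OF A'm A'b A'U, symmetric])
  also have "\<dots> = (\<integral>\<^sup>+\<sigma>. ennreal (\<sigma> ^ Suc m) * indicator {1..} \<sigma> * (\<integral>\<^sup>+x. indicator A ((\<sigma> / c) *\<^sub>R x) \<partial>\<mu> i) \<partial>lborel)"
    unfolding cone_integral_def by (intro nn_integral_cong) (simp add: indicator_def A'i)
  also have "\<dots> = ennreal c * (\<integral>\<^sup>+s. ennreal ((c * s) ^ Suc m) * indicator {1..} (c * s) * ?h (((c * s) / c)) \<partial>lborel)"
  proof -
    interpret sigma_finite_measure "\<mu> i" by (rule sigma_finite_mu)
    have "(\<lambda>\<sigma>. ennreal (\<sigma> ^ Suc m) * indicator {1..} \<sigma> * (\<integral>\<^sup>+x. indicator A ((\<sigma> / c) *\<^sub>R x) \<partial>\<mu> i)) \<in> borel_measurable borel"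
      by measurable
    from nn_integral_real_affine[OF this, of c 0] c show ?thesis by simp
  qed
  also have "(\<integral>\<^sup>+s. ennreal ((c * s) ^ Suc m) * indicator {1..} (c * s) * ?h (((c * s) / c)) \<partial>lborel)
      = (\<integral>\<^sup>+s. ennreal (c ^ Suc m) * (ennreal (s ^ Suc m) * indicator {1..} s * ?h s) \<partial>lborel)"
  proof (rule nn_integral_cong)
    fix s :: real
    have cs: "(c * s) / c = s" using c by simp
    show "ennreal ((c * s) ^ Suc m) * indicator {1..} (c * s) * ?h (((c * s) / c))
        = ennreal (c ^ Suc m) * (ennreal (s ^ Suc m) * indicator {1..} s * ?h s)"
    proof (cases "1 \<le> s")
      case True
      then have "1 * 1 \<le> c * s" using c by (intro mult_mono) auto
      with True c show ?thesis
        unfolding cs by (simp add: power_mult_distrib ennreal_mult mult.assoc del: power_Suc)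
    next
      \<comment> \<open>The substitution changes the range \<open>1 \<le> s\<close> into
        \<open>1 \<le> c * s\<close>. The additional values \<open>s < 1\<close> contribute nothing,
        since then \<open>s *\<^sub>R x\<close> has no coordinate above 1.\<close>
      case False
      have "?h s = (\<integral>\<^sup>+x. 0 \<partial>\<mu> i)" if cs1: "1 \<le> c * s"
      proof (rule nn_integral_cong_AE)
        have s0: "0 \<le> s" using cs1 c zero_le_mult_iff[of c s] by auto
        show "AE x in \<mu> i. indicator A (s *\<^sub>R x) = (0 :: ennreal)"
          using supp[of i]
        proof eventually_elim
          case (elim x)
          have "s * x $ k \<le> 1 * 1" for k
            using False s0 std_simplexD(1,2)[OF elim, of k] by (intro mult_mono) auto
          then have "s *\<^sub>R x \<notin> unit_corner" by (auto simp: unit_corner_def not_less)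
          then have "s *\<^sub>R x \<notin> A" using A(3) by blast
          then show ?case by simp
        qed
      qed
      with False show ?thesis unfolding cs by (auto split: split_indicator)
    qed
  qed
  also have "ennreal c * \<dots> = ennreal (c ^ (m + 2)) * cone_integral i (indicator A)"
  proof -
    interpret sigma_finite_measure "\<mu> i" by (rule sigma_finite_mu)
    show ?thesis
      unfolding cone_integral_def using c
      by (subst nn_integral_cmult) (auto simp: mult.assoc[symmetric] ennreal_mult[symmetric] simp del: power_Suc, simp)
  qed
  also have "\<dots> = ennreal (c ^ (m + 2)) * (\<integral>\<^sup>+y\<in>A. ennreal (cone_density i y) \<partial>lborel)"
    by (simp only: cone_integral_density[OF A])
  also have "\<dots> = (\<integral>\<^sup>+y\<in>A. ennreal (c ^ (m + 2) * cone_density i y) \<partial>lborel)"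
    using c by (subst nn_integral_cmult[symmetric]) (auto intro!: nn_integral_cong simp: ennreal_mult' mult.assoc)
  finally show "(\<integral>\<^sup>+y\<in>A. ennreal (c ^ CARD('n) * cone_density i (c *\<^sub>R y)) \<partial>lborel)
      = (\<integral>\<^sup>+y\<in>A. ennreal (c ^ (m + 2) * cone_density i y) \<partial>lborel)" .
qed

end

section \<open>The density on the simplex\<close>

definition positive_orthant :: "(real ^ 'n) set" where
  "positive_orthant = {y. \<forall>k. 0 < y $ k}"

lemma open_positive_orthant: "open (positive_orthant :: (real ^ 'n::finite) set)"
proof -
  have "open (\<Inter>k\<in>(UNIV :: 'n set). {y :: real ^ 'n. 0 < y $ k})"
    by (intro open_INT ballI open_Collect_less continuous_intros) simp
  moreover have "positive_orthant = (\<Inter>k\<in>(UNIV :: 'n set). {y :: real ^ 'n. 0 < y $ k})"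
    by (auto simp: positive_orthant_def)
  ultimately show ?thesis by simp
qed

text \<open>A factor that pushes a positive \<open>y\<close> into the corner: the summand
  \<open>2 / y $ k\<close> alone raises coordinate \<open>k\<close> to 2.\<close>

definition corner_scale :: "real ^ 'n::finite \<Rightarrow> real" where
  "corner_scale y = (\<Sum>k\<in>UNIV. 2 / y $ k)"

lemma corner_scale:
  assumes "y \<in> positive_orthant"
  shows "0 < corner_scale y" "corner_scale y *\<^sub>R y \<in> unit_corner"
proof -
  have y: "0 < y $ k" for k using assms by (simp add: positive_orthant_def)
  have le: "2 / y $ k \<le> corner_scale y" for k
    unfolding corner_scale_def using y by (intro member_le_sum) (auto simp: less_imp_le)
  show pos: "0 < corner_scale y"
    unfolding corner_scale_def using y by (intro sum_pos) auto
  have "1 < corner_scale y * y $ k" for k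
  proof -
    have "2 / y $ k * y $ k \<le> corner_scale y * y $ k"
      using le y by (intro mult_right_mono) (auto simp: less_imp_le)
    then show ?thesis using y[of k] by simp
  qed
  then show "corner_scale y *\<^sub>R y \<in> unit_corner" by (simp add: unit_corner_def)
qed

lemma AE_simplex_lebesgue: "AE x in simplex_lebesgue r. x \<in> (std_simplex :: (real ^ 'n::finite) set)"
  unfolding simplex_lebesgue_def
  by (subst AE_density) (auto simp: indicator_def)

lemma space_simplex_lebesgue [simp]: "space (simplex_lebesgue r) = UNIV"
  using sets_eq_imp_space_eq[OF sets_simplex_lebesgue] by simp

context stationary_zigzag
begin

text \<open>The extension of \<open>cone_density\<close> from the corner to the open orthant by
  homogeneity of degree \<open>m + 2 - CARD('n)\<close>.\<close>

definition orthant_density :: "'n \<Rightarrow> real ^ 'n \<Rightarrow> real" where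
  "orthant_density i y = corner_scale y ^ CARD('n) / corner_scale y ^ (m + 2) * cone_density i (corner_scale y *\<^sub>R y)"

lemma measurable_orthant_density [measurable]: "orthant_density i \<in> borel_measurable borel"
proof -
  note [measurable] = borel_measurable_continuous_onI[OF cone_density_continuous]
  have [measurable]: "corner_scale \<in> borel_measurable (borel :: (real ^ 'n) measure)"
    unfolding corner_scale_def by measurable
  show ?thesis unfolding orthant_density_def by measurable
qed

lemma cone_density_rescale:
  assumes "0 < a" "a \<le> b" "a *\<^sub>R y \<in> unit_corner"
  shows "b ^ CARD('n) / b ^ (m + 2) * cone_density i (b *\<^sub>R y) = a ^ CARD('n) / a ^ (m + 2) * cone_density i (a *\<^sub>R y)"
proof -
  define c where "c = b / a"
  have c: "1 \<le> c" "0 < c" and b: "b = c * a" using assms(1,2) by (auto simp: c_def)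
  have "c ^ CARD('n) * cone_density i (c *\<^sub>R (a *\<^sub>R y)) = c ^ (m + 2) * cone_density i (a *\<^sub>R y)"
    by (rule cone_density_homogeneous[OF assms(3) c(1)])
  then have *: "c ^ CARD('n) * cone_density i (b *\<^sub>R y) = c ^ (m + 2) * cone_density i (a *\<^sub>R y)"
    by (simp add: b)
  have "b ^ CARD('n) / b ^ (m + 2) * cone_density i (b *\<^sub>R y)
      = a ^ CARD('n) / (c ^ (m + 2) * a ^ (m + 2)) * (c ^ CARD('n) * cone_density i (b *\<^sub>R y))"
    unfolding b by (simp only: power_mult_distrib) simp
  also have "\<dots> = a ^ CARD('n) / a ^ (m + 2) * cone_density i (a *\<^sub>R y)"
    unfolding * using c by simp
  finally show ?thesis .
qed

text \<open>Any admissible factor \<open>c\<close> gives the same value. Near a given point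
  \<open>c\<close> can therefore be kept constant, and \<open>corner_scale\<close> is never
  differentiated.\<close>

lemma orthant_density_eq:
  assumes "0 < c" "c *\<^sub>R y \<in> unit_corner"
  shows "orthant_density i y = c ^ CARD('n) / c ^ (m + 2) * cone_density i (c *\<^sub>R y)"
proof -
  have "0 < y $ k" for k
  proof -
    have "1 < c * y $ k" using assms(2) by (simp add: unit_corner_def)
    then have "0 < c * y $ k" by linarith
    then show ?thesis using assms(1) by (simp add: zero_less_mult_iff)
  qed
  then have y: "y \<in> positive_orthant" by (simp add: positive_orthant_def)
  show ?thesis
    unfolding orthant_density_def
    using cone_density_rescale[OF assms(1) _ assms(2), of "corner_scale y"]
      cone_density_rescale[OF corner_scale(1)[OF y] _ corner_scale(2)[OF y], of c]
    by (cases "c \<le> corner_scale y") auto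
qed

lemma orthant_density_nonneg: "y \<in> positive_orthant \<Longrightarrow> 0 \<le> orthant_density i y"
  unfolding orthant_density_def
  using corner_scale[of y] cone_density_nonneg by (auto intro!: mult_nonneg_nonneg divide_nonneg_nonneg)

text \<open>If \<open>c\<close> is admissible for \<open>y\<close>, then \<open>c / t\<close> is
  admissible for \<open>t *\<^sub>R y\<close> and leads to the same point of the corner.\<close>

lemma orthant_density_homogeneous:
  assumes y: "y \<in> positive_orthant" and t: "0 < t"
  shows "orthant_density i (t *\<^sub>R y) = t ^ (m + 2) / t ^ CARD('n) * orthant_density i y"
proof -
  define c where "c = corner_scale y"
  have c: "0 < c" "c *\<^sub>R y \<in> unit_corner" using corner_scale[OF y] by (auto simp: c_def)
  have "orthant_density i (t *\<^sub>R y) = (c / t) ^ CARD('n) / (c / t) ^ (m + 2) * cone_density i ((c / t) *\<^sub>R (t *\<^sub>R y))"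
    using c t by (intro orthant_density_eq) auto
  also have "\<dots> = t ^ (m + 2) / t ^ CARD('n) * (c ^ CARD('n) / c ^ (m + 2) * cone_density i (c *\<^sub>R y))"
    using t by (simp only: power_divide) simp
  finally show ?thesis
    unfolding orthant_density_eq[OF c, symmetric] .
qed

text \<open>The first two claims are transported from the corner by scaling with a fixed factor; the
  \<open>c\<close> of the chain rule cancels against the coordinate sum of
  \<open>c *\<^sub>R y\<close>. The third is obtained by differentiating along
  \<open>t *\<^sub>R y\<close> at \<open>t = 1\<close> in two ways.\<close>

lemma orthant_density_gradient:
  "\<exists>G. \<forall>i. \<forall>y\<in>positive_orthant. (orthant_density i has_derivative (\<lambda>h. G i y \<bullet> h)) (at y) \<and>
     G i y $ i = 1 / (\<Sum>k\<in>UNIV. y $ k) * (\<Sum>k\<in>UNIV. B k i * orthant_density k y) \<and>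
     G i y \<bullet> y = (real (m + 2) - real CARD('n)) * orthant_density i y"
proof -
  obtain g where g: "\<And>i. has_gradient (cone_density i) (g i)"
    "\<And>i y. y \<in> unit_corner \<Longrightarrow> g i y $ i = 1 / (\<Sum>k\<in>UNIV. y $ k) * (\<Sum>k\<in>UNIV. B k i * cone_density k y)"
    using cone_density_gradient by blast
  define s where "s y = corner_scale y ^ CARD('n) / corner_scale y ^ (m + 2)" for y :: "real ^ 'n"
  define G where "G i y = s y *\<^sub>R (corner_scale y *\<^sub>R g i (corner_scale y *\<^sub>R y))" for i y
  have "(orthant_density i has_derivative (\<lambda>h. G i y \<bullet> h)) (at y) \<and>
     G i y $ i = 1 / (\<Sum>k\<in>UNIV. y $ k) * (\<Sum>k\<in>UNIV. B k i * orthant_density k y) \<and>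
     G i y \<bullet> y = (real (m + 2) - real CARD('n)) * orthant_density i y"
    if y: "y \<in> positive_orthant" for i y
  proof (intro conjI)
    define c where "c = corner_scale y"
    have c: "0 < c" "c *\<^sub>R y \<in> unit_corner" using corner_scale[OF y] by (auto simp: c_def)
    have sc: "s y = c ^ CARD('n) / c ^ (m + 2)" by (simp add: s_def c_def)
    \<comment> \<open>The neighbourhood of \<open>y\<close> on which the factor \<open>c\<close>
      remains admissible.\<close>
    define V where "V = (\<lambda>z. c *\<^sub>R z) -` (unit_corner :: (real ^ 'n) set)"
    have V: "open V" "y \<in> V"
      unfolding V_def using c(2) by (auto intro!: open_vimage open_unit_corner continuous_intros)
    have "has_gradient (\<lambda>z. s y * cone_density i (c *\<^sub>R z + 0)) (\<lambda>z. s y *\<^sub>R (c *\<^sub>R g i (c *\<^sub>R z + 0)))"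
      by (intro has_gradient_cmult has_gradient_affine g)
    from has_gradientD(1)[OF this, of y]
    have "((\<lambda>z. s y * cone_density i (c *\<^sub>R z)) has_derivative (\<lambda>h. G i y \<bullet> h)) (at y)"
      by (simp add: G_def c_def)
    then show der: "(orthant_density i has_derivative (\<lambda>h. G i y \<bullet> h)) (at y)"
      by (rule has_derivative_transform_within_open[OF _ V])
         (use c(1) in \<open>simp add: V_def sc orthant_density_eq\<close>)
    have "G i y $ i = s y * (c * (1 / (\<Sum>k\<in>UNIV. (c *\<^sub>R y) $ k) * (\<Sum>k\<in>UNIV. B k i * cone_density k (c *\<^sub>R y))))"
      using g(2)[OF c(2), of i] by (simp add: G_def c_def[symmetric])
    also have "(\<Sum>k\<in>UNIV. (c *\<^sub>R y) $ k) = c * (\<Sum>k\<in>UNIV. y $ k)"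
      by (simp add: sum_distrib_left)
    also have "s y * (c * (1 / (c * (\<Sum>k\<in>UNIV. y $ k)) * (\<Sum>k\<in>UNIV. B k i * cone_density k (c *\<^sub>R y))))
        = 1 / (\<Sum>k\<in>UNIV. y $ k) * (s y * (\<Sum>k\<in>UNIV. B k i * cone_density k (c *\<^sub>R y)))"
      using c(1) by simp
    also have "s y * (\<Sum>k\<in>UNIV. B k i * cone_density k (c *\<^sub>R y)) = (\<Sum>k\<in>UNIV. B k i * (s y * cone_density k (c *\<^sub>R y)))"
      by (simp add: sum_distrib_left mult_ac)
    finally show "G i y $ i = 1 / (\<Sum>k\<in>UNIV. y $ k) * (\<Sum>k\<in>UNIV. B k i * orthant_density k y)"
      unfolding orthant_density_eq[OF c] sc .
    have "((\<lambda>t. t *\<^sub>R y) has_derivative (\<lambda>h. h *\<^sub>R y)) (at (1::real))"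
      by (auto intro!: derivative_eq_intros)
    from has_derivative_compose[OF this, of "orthant_density i" "\<lambda>h. G i y \<bullet> h"] der
    have 1: "((\<lambda>t. orthant_density i (t *\<^sub>R y)) has_real_derivative (G i y \<bullet> y)) (at 1)"
      unfolding has_field_derivative_def by (rule_tac has_derivative_eq_rhs) (auto simp: fun_eq_iff)
    have "((\<lambda>t::real. t ^ (m + 2) / t ^ CARD('n)) has_real_derivative (real (m + 2) - real CARD('n))) (at 1)"
      by (rule DERIV_cong[OF DERIV_divide[OF DERIV_pow DERIV_pow]]) auto
    from DERIV_cmult_right[OF this, of "orthant_density i y"]
    have "((\<lambda>t. orthant_density i (t *\<^sub>R y)) has_real_derivative (real (m + 2) - real CARD('n)) * orthant_density i y) (at 1)"
      by (rule DERIV_cong_ev[THEN iffD1, rotated -1])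
         (use eventually_nhds_in_open[of "{0<..}" "1::real"] orthant_density_homogeneous[OF y]
           in \<open>auto elim!: eventually_mono\<close>)
    from DERIV_unique[OF 1 this] show "G i y \<bullet> y = (real (m + 2) - real CARD('n)) * orthant_density i y" .
  qed
  then show ?thesis by blast
qed

section \<open>Identification of the stationary measures by their densities\<close>

text \<open>Over \<open>A\<close> a shell of weights between \<open>N\<close> and
  \<open>N + 1\<close> is put, which lies in the corner because \<open>real N * x $ k\<close>
  exceeds 1. Its cone integral is computed from the definition and, through the density, in polar
  coordinates. Both results contain the radial integral \<open>K\<close>, which is positive and
  finite and cancels.\<close>

lemma emeasure_mu_inner:
  assumes A[measurable]: "A \<in> sets borel" and N: "1 \<le> N" and AN: "A \<subseteq> {x. \<forall>k. 1 / real N < x $ k}"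
  shows "emeasure (\<mu> i) A = (\<integral>\<^sup>+x\<in>A. ennreal (orthant_density i x) \<partial>simplex_lebesgue r)"
proof -
  note [measurable] = borel_measurable_continuous_onI[OF cone_density_continuous]
  define S where "S y = (\<Sum>k\<in>UNIV. y $ k)" for y :: "real ^ 'n"
  have [measurable]: "S \<in> borel_measurable borel" unfolding S_def by measurable
  define I where "I = {real N..real N + 1}"
  define A' where "A' = {y. S y \<in> I \<and> (1 / S y) *\<^sub>R y \<in> A}"
  have A'm[measurable]: "A' \<in> sets borel" unfolding A'_def I_def by measurable
  let ?M = "\<integral>\<^sup>+x\<in>A. ennreal (orthant_density i x) \<partial>simplex_lebesgue r"
  let ?c = "\<lambda>s x. ennreal (cone_density i (s *\<^sub>R x)) * indicator A' (s *\<^sub>R x)"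
  let ?C = "\<lambda>s. \<integral>\<^sup>+x. ?c s x \<partial>simplex_lebesgue r"
  have Apos: "x \<in> positive_orthant" if "x \<in> A" for x
  proof -
    have "0 < 1 / real N" using N by simp
    moreover have "1 / real N < x $ k" for k using that AN by blast
    ultimately show ?thesis unfolding positive_orthant_def by (blast intro: less_trans)
  qed
  have A'D: "y \<in> unit_corner" "l1 y \<le> real N + 1" if y: "y \<in> A'" for y
  proof -
    have s: "real N \<le> S y" "S y \<le> real N + 1" and a: "(1 / S y) *\<^sub>R y \<in> A"
      using y by (auto simp: A'_def I_def)
    have s0: "0 < S y" using s N by linarith
    have *: "1 < y $ k" for k
    proof -
      have "1 / real N < ((1 / S y) *\<^sub>R y) $ k" using a AN by blast
      then have "S y * (1 / real N) < S y * (1 / S y * y $ k)" using s0 by (intro mult_strict_left_mono) auto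
      then have "S y / real N < y $ k" using s0 by simp
      moreover have "1 \<le> S y / real N" using s N by (simp add: field_simps)
      ultimately show ?thesis by linarith
    qed
    then show "y \<in> unit_corner" by (simp add: unit_corner_def)
    have "l1 y = S y" unfolding l1_def S_def
      by (intro sum.cong refl abs_of_nonneg) (use * in \<open>auto intro: less_imp_le less_trans[OF zero_less_one]\<close>)
    with s show "l1 y \<le> real N + 1" by simp
  qed
  have A'b: "bounded A'"
    unfolding bounded_iff
  proof (intro exI ballI)
    fix y assume "y \<in> A'"
    show "norm y \<le> real N + 1"
      using norm_le_l1_cart[of y] A'D(2)[OF \<open>y \<in> A'\<close>] by (simp add: l1_def)
  qed
  have A'U: "A' \<subseteq> unit_corner" using A'D by blast
  have A'x: "s *\<^sub>R x \<in> A' \<longleftrightarrow> s \<in> I \<and> x \<in> A" if x: "x \<in> std_simplex" for s x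
  proof -
    have "S (s *\<^sub>R x) = s"
      using std_simplexD(3)[OF x] by (simp add: S_def sum_distrib_left[symmetric])
    then show ?thesis using N by (auto simp: A'_def I_def)
  qed
  define K where "K = (\<integral>\<^sup>+\<sigma>. ennreal (\<sigma> ^ Suc m) * indicator I \<sigma> \<partial>lborel)"
  have eI: "emeasure lborel I = 1" unfolding I_def by simp
  have K1: "1 \<le> K"
  proof -
    have "1 = (\<integral>\<^sup>+\<sigma>. indicator I \<sigma> \<partial>lborel)" using eI by (simp add: I_def)
    also have "\<dots> \<le> K"
      unfolding K_def
    proof (rule nn_integral_mono)
      fix \<sigma> :: real
      have "1 \<le> \<sigma> ^ Suc m" if "\<sigma> \<in> I" using that N by (intro one_le_power) (auto simp: I_def)
      then show "indicator I \<sigma> \<le> ennreal (\<sigma> ^ Suc m) * indicator I \<sigma>"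
        by (auto split: split_indicator simp: ennreal_ge_1 simp del: power_Suc)
    qed
    finally show ?thesis .
  qed
  have K2: "K < \<infinity>"
  proof -
    have "K \<le> (\<integral>\<^sup>+\<sigma>. ennreal ((real N + 1) ^ Suc m) * indicator I \<sigma> \<partial>lborel)"
      unfolding K_def
    proof (rule nn_integral_mono)
      fix \<sigma> :: real
      have "\<sigma> ^ Suc m \<le> (real N + 1) ^ Suc m" if "\<sigma> \<in> I" using that by (intro power_mono) (auto simp: I_def)
      then show "ennreal (\<sigma> ^ Suc m) * indicator I \<sigma> \<le> ennreal ((real N + 1) ^ Suc m) * indicator I \<sigma>"
        by (auto split: split_indicator intro: ennreal_leI simp del: power_Suc)
    qed
    also have "\<dots> = ennreal ((real N + 1) ^ Suc m)"
      using eI by (subst nn_integral_cmult_indicator) (auto simp: I_def)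
    finally show ?thesis by (rule le_less_trans) simp
  qed
  have "cone_integral i (indicator A') = (\<integral>\<^sup>+\<sigma>. (ennreal (\<sigma> ^ Suc m) * indicator I \<sigma>) * emeasure (\<mu> i) A \<partial>lborel)"
    unfolding cone_integral_def
  proof (rule nn_integral_cong)
    fix \<sigma> :: real
    have "(\<integral>\<^sup>+x. indicator A' (\<sigma> *\<^sub>R x) \<partial>\<mu> i) = (\<integral>\<^sup>+x. indicator I \<sigma> * indicator A x \<partial>\<mu> i)"
      by (rule nn_integral_cong_AE) (use supp[of i] in \<open>auto elim!: eventually_mono simp: A'x split: split_indicator\<close>)
    also have "\<dots> = indicator I \<sigma> * emeasure (\<mu> i) A"
      by (subst nn_integral_cmult) auto
    finally show "ennreal (\<sigma> ^ Suc m) * indicator {1..} \<sigma> * (\<integral>\<^sup>+x. indicator A' (\<sigma> *\<^sub>R x) \<partial>\<mu> i)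
        = (ennreal (\<sigma> ^ Suc m) * indicator I \<sigma>) * emeasure (\<mu> i) A"
      using N by (auto simp: I_def mult.assoc split: split_indicator)
  qed
  also have "\<dots> = K * emeasure (\<mu> i) A"
    unfolding K_def I_def by (rule nn_integral_multc) measurable
  finally have L: "cone_integral i (indicator A') = K * emeasure (\<mu> i) A" .
  have "cone_integral i (indicator A') = (\<integral>\<^sup>+y\<in>orthant. ennreal (cone_density i y) * indicator A' y \<partial>lborel)"
    unfolding cone_integral_density[OF A'm A'b A'U]
  proof (rule nn_integral_cong)
    fix y
    have "0 < y $ k" if "y \<in> A'" for k
    proof -
      have "1 < y $ k" using A'D(1)[OF that] by (simp add: unit_corner_def)
      then show ?thesis by linarith
    qed
    then have "y \<in> orthant" if "y \<in> A'" using that by (auto simp: orthant_def less_imp_le)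
    then show "ennreal (cone_density i y) * indicator A' y = ennreal (cone_density i y) * indicator A' y * indicator orthant y"
      by (auto split: split_indicator)
  qed
  also have "\<dots> = (\<integral>\<^sup>+s\<in>{0..}. ennreal (s ^ (CARD('n) - 1)) * (?C s) \<partial>lborel)"
    by (rule nn_integral_orthant_polar) measurable
  also have "\<dots> = (\<integral>\<^sup>+s. (ennreal (s ^ Suc m) * indicator I s) * ?M \<partial>lborel)"
  proof (rule nn_integral_cong)
    fix s :: real
    show "ennreal (s ^ (CARD('n) - 1)) * (?C s) * indicator {0..} s
        = (ennreal (s ^ Suc m) * indicator I s) * ?M"
    proof (cases "s \<in> I")
      case True
      then have s: "1 \<le> s" using N by (auto simp: I_def)
      \<comment> \<open>The exponents \<open>CARD('n) - 1\<close>, \<open>m + 2\<close> and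
        \<open>- CARD('n)\<close> add up to \<open>m + 1\<close>, the exponent in
        \<open>K\<close>.\<close>
      have sD: "s ^ CARD('n) = s * s ^ (CARD('n) - 1)"
        by (metis One_nat_def Suc_pred power_Suc zero_less_card_finite)
      have "(?C s)
          = (\<integral>\<^sup>+x. ennreal (s ^ (m + 2) / s ^ CARD('n)) * (ennreal (orthant_density i x) * indicator A x) \<partial>simplex_lebesgue r)"
      proof (rule nn_integral_cong_AE)
        show "AE x in simplex_lebesgue r. ?c s x
            = ennreal (s ^ (m + 2) / s ^ CARD('n)) * (ennreal (orthant_density i x) * indicator A x)"
          using AE_simplex_lebesgue
        proof eventually_elim
          case (elim x)
          show ?case
          proof (cases "x \<in> A")
            case xA: True
            have sx: "s *\<^sub>R x \<in> A'" using A'x[OF elim] True xA by simp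
            then have "s *\<^sub>R x \<in> unit_corner" using A'U by blast
            then have "orthant_density i x = s ^ CARD('n) / s ^ (m + 2) * cone_density i (s *\<^sub>R x)"
              using s by (intro orthant_density_eq) auto
            then have "cone_density i (s *\<^sub>R x) = s ^ (m + 2) / s ^ CARD('n) * orthant_density i x"
              using s by (simp del: power_Suc power_add)
            then have "ennreal (cone_density i (s *\<^sub>R x)) = ennreal (s ^ (m + 2) / s ^ CARD('n)) * ennreal (orthant_density i x)"
              using s by (simp only:) (rule ennreal_mult', simp)
            then show ?thesis using sx xA by simp
          next
            case False
            then show ?thesis using A'x[OF elim] by simp
          qed
        qed
      qed
      also have "\<dots> = ennreal (s ^ (m + 2) / s ^ CARD('n)) * ?M"
        by (rule nn_integral_cmult) measurable
      finally have "ennreal (s ^ (CARD('n) - 1)) * (?C s)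
          = (ennreal (s ^ (CARD('n) - 1)) * ennreal (s ^ (m + 2) / s ^ CARD('n))) * ?M"
        by (simp only: mult.assoc)
      also have "ennreal (s ^ (CARD('n) - 1)) * ennreal (s ^ (m + 2) / s ^ CARD('n)) = ennreal (s ^ Suc m)"
        using s unfolding sD by (simp add: ennreal_mult[symmetric])
      finally show ?thesis using True s by simp
    next
      case False
      have "(?C s)
          = (\<integral>\<^sup>+x. 0 \<partial>simplex_lebesgue r)"
      proof (rule nn_integral_cong_AE)
        show "AE x in simplex_lebesgue r. ?c s x = 0"
          using AE_simplex_lebesgue[of r] by eventually_elim (simp add: A'x False)
      qed
      then show ?thesis using False by simp
    qed
  qed
  also have "\<dots> = K * ?M"
    unfolding K_def I_def by (rule nn_integral_multc) measurable
  finally have "K * emeasure (\<mu> i) A = K * ?M"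
    unfolding L .
  moreover have "K \<noteq> 0" "K \<noteq> \<infinity>" using K1 K2 by auto
  ultimately show ?thesis by (simp add: ennreal_mult_cancel_left)
qed

text \<open>The interior is exhausted by the sets where all coordinates exceed
  \<open>1 / real (Suc N)\<close>, on which the previous lemma applies; the rest of the simplex is
  null by assumption.\<close>

lemma mu_eq_density:
  assumes null: "\<And>k. emeasure (\<mu> i) {x. x $ k = 0} = 0"
  shows "\<mu> i = density (simplex_lebesgue r) (\<lambda>x. ennreal (if \<forall>k. 0 < x $ k then orthant_density i x else 0))"
    (is "_ = density _ ?f")
proof (rule measure_eqI)
  fix A assume "A \<in> sets (\<mu> i)"
  then have A[measurable]: "A \<in> sets borel" by simp
  define P where "P N = {x :: real ^ 'n. \<forall>k. 1 / real (Suc N) < x $ k}" for N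
  have [measurable]: "P N \<in> sets borel" for N unfolding P_def by measurable
  have f[measurable]: "?f \<in> borel_measurable borel" by measurable
  have PU: "(\<Union>N. P N) = positive_orthant"
  proof (intro equalityI subsetI)
    fix x :: "real ^ 'n" assume "x \<in> positive_orthant"
    then have x: "0 < x $ k" for k by (simp add: positive_orthant_def)
    define d where "d = Min (range (\<lambda>k. x $ k))"
    have "0 < d" unfolding d_def using x by (subst Min_gr_iff) auto
    then obtain N where "inverse (real (Suc N)) < d" using reals_Archimedean by blast
    moreover have "d \<le> x $ k" for k unfolding d_def by (intro Min_le) auto
    ultimately have "1 / real (Suc N) < x $ k" for k by (simp add: inverse_eq_divide) (meson less_le_trans)
    then show "x \<in> (\<Union>N. P N)" by (auto simp: P_def)
  next
    fix x :: "real ^ 'n" assume "x \<in> (\<Union>N. P N)"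
    then obtain N where "\<And>k. 1 / real (Suc N) < x $ k" by (auto simp: P_def)
    moreover have "0 < 1 / real (Suc N)" by simp
    ultimately show "x \<in> positive_orthant" unfolding positive_orthant_def by (blast intro: less_trans)
  qed
  have inc: "incseq (\<lambda>N. A \<inter> P N)"
  proof (rule incseq_SucI, rule subsetI)
    fix N x assume x: "x \<in> A \<inter> P N"
    have "1 / real (Suc (Suc N)) \<le> 1 / real (Suc N)" by (simp add: field_simps)
    with x show "x \<in> A \<inter> P (Suc N)" unfolding P_def by (auto intro: le_less_trans)
  qed
  have "AE x in \<mu> i. \<forall>k. x $ k \<noteq> 0"
  proof -
    have "AE x in \<mu> i. x $ k \<noteq> 0" for k
      using null[of k] by (intro AE_I[of _ _ "{x. x $ k = 0}"]) auto
    then have "AE x in \<mu> i. \<forall>k\<in>UNIV. x $ k \<noteq> 0" by (intro AE_finite_allI) auto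
    then show ?thesis by simp
  qed
  then have ae: "AE x in \<mu> i. x \<in> positive_orthant"
    using supp[of i]
  proof eventually_elim
    case (elim x)
    then show ?case using std_simplexD(1)[OF elim(2)] by (auto simp: positive_orthant_def less_le)
  qed
  have "emeasure (\<mu> i) A = emeasure (\<mu> i) (\<Union>N. A \<inter> P N)"
    unfolding Int_UN_distrib[symmetric] PU
  proof (rule emeasure_eq_AE)
    show "AE x in \<mu> i. x \<in> A \<longleftrightarrow> x \<in> A \<inter> positive_orthant"
      using ae by eventually_elim simp
    show "A \<in> sets (\<mu> i)" "A \<inter> positive_orthant \<in> sets (\<mu> i)"
      unfolding PU[symmetric] by measurable
  qed
  also have "\<dots> = (SUP N. emeasure (\<mu> i) (A \<inter> P N))"
    by (rule SUP_emeasure_incseq[symmetric]) (use inc in auto)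
  also have "\<dots> = (SUP N. emeasure (density (simplex_lebesgue r) ?f) (A \<inter> P N))"
  proof (rule SUP_cong[OF refl])
    fix N
    have "emeasure (\<mu> i) (A \<inter> P N) = (\<integral>\<^sup>+x\<in>A \<inter> P N. ennreal (orthant_density i x) \<partial>simplex_lebesgue r)"
      by (rule emeasure_mu_inner[of _ "Suc N"]) (auto simp: P_def)
    also have "\<dots> = (\<integral>\<^sup>+x\<in>A \<inter> P N. ?f x \<partial>simplex_lebesgue r)"
    proof (rule nn_integral_cong)
      fix x
      have "\<forall>k. 0 < x $ k" if "x \<in> P N" using that PU by (auto simp: positive_orthant_def)
      then show "ennreal (orthant_density i x) * indicator (A \<inter> P N) x = ?f x * indicator (A \<inter> P N) x"
        by (auto split: split_indicator)
    qed
    also have "\<dots> = emeasure (density (simplex_lebesgue r) ?f) (A \<inter> P N)"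
      by (rule emeasure_density[symmetric]) auto
    finally show "emeasure (\<mu> i) (A \<inter> P N) = emeasure (density (simplex_lebesgue r) ?f) (A \<inter> P N)" .
  qed
  also have "\<dots> = emeasure (density (simplex_lebesgue r) ?f) (\<Union>N. A \<inter> P N)"
    by (rule SUP_emeasure_incseq) (use inc in auto)
  also have "\<dots> = emeasure (density (simplex_lebesgue r) ?f) A"
  proof -
    have [measurable]: "positive_orthant \<in> sets (borel :: (real ^ 'n) measure)"
      unfolding PU[symmetric] by measurable
    have "(\<integral>\<^sup>+x\<in>A \<inter> positive_orthant. ?f x \<partial>simplex_lebesgue r) = (\<integral>\<^sup>+x\<in>A. ?f x \<partial>simplex_lebesgue r)"
      by (intro nn_integral_cong) (auto split: split_indicator simp: positive_orthant_def)
    then show ?thesis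
      unfolding Int_UN_distrib[symmetric] PU by (subst (1 2) emeasure_density) auto
  qed
  finally show "emeasure (\<mu> i) A = emeasure (density (simplex_lebesgue r) ?f) A" .
qed simp

text \<open>Duhamel's formula from \<open>s = 1\<close> to \<open>s = 2\<close>, applied to the indicator of a coordinate hyperplane.\<close>

lemma face_masses:
  defines "p \<equiv> \<lambda>k i. measure (\<mu> i) {x. x $ k = 0}"
  shows "p k k = 0" "i \<noteq> k \<Longrightarrow> (\<Sum>j\<in>UNIV. B j i * p k j) = real (Suc m) * p k i"
proof -
  define H where "H = {x :: real ^ 'n. x $ k = 0}"
  have [measurable]: "H \<in> sets borel" unfolding H_def by measurable
  have fin': "emeasure (\<mu> j) H = ennreal (p k j)" for j
  proof -
    interpret finite_measure "\<mu> j" by (rule fin)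
    show ?thesis by (simp add: emeasure_eq_measure p_def H_def)
  qed
  have p0: "0 \<le> p k j" for j by (simp add: p_def)
  have D: "ennreal (2 ^ Suc m) * (\<integral>\<^sup>+x. indicator H (2 *\<^sub>R x) \<partial>\<mu> i) =
     (\<integral>\<^sup>+x. indicator H (x + (2 - 1) *\<^sub>R axis i 1) \<partial>\<mu> i) +
     (\<integral>\<^sup>+s. (ennreal (s ^ m) * indicator {1..2} s) *
        (\<Sum>j\<in>UNIV. ennreal (B j i) * (\<integral>\<^sup>+x. indicator H (s *\<^sub>R x + (2 - s) *\<^sub>R axis i 1) \<partial>\<mu> j)) \<partial>lborel)" for i
    by (rule duhamel) auto
  have scale: "(\<integral>\<^sup>+x. indicator H (c *\<^sub>R x) \<partial>\<mu> i) = ennreal (p k i)" if "c \<noteq> 0" for c i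
  proof -
    have "(\<integral>\<^sup>+x. indicator H (c *\<^sub>R x) \<partial>\<mu> i) = (\<integral>\<^sup>+x. indicator H x \<partial>\<mu> i)"
      using that by (intro nn_integral_cong) (auto simp: H_def split: split_indicator)
    then show ?thesis using fin'[of i] by simp
  qed
  show "p k k = 0"
  proof -
    \<comment> \<open>Any stay in \<open>k\<close> makes the coordinate \<open>k\<close> positive.
      On the right of Duhamel's formula the stay \<open>2 - s\<close> vanishes only for
      \<open>s = 2\<close>.\<close>
    have z: "(\<integral>\<^sup>+x. indicator H (s *\<^sub>R x + t *\<^sub>R axis k 1) \<partial>\<mu> j) = 0" if "0 \<le> s" "0 < t" for s t j
    proof -
      have "(\<integral>\<^sup>+x. indicator H (s *\<^sub>R x + t *\<^sub>R axis k 1) \<partial>\<mu> j) = (\<integral>\<^sup>+x. 0 \<partial>\<mu> j)"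
      proof (rule nn_integral_cong_AE)
        show "AE x in \<mu> j. indicator H (s *\<^sub>R x + t *\<^sub>R axis k 1) = (0 :: ennreal)"
          using supp[of j]
        proof eventually_elim
          case (elim x)
          have "0 < s * x $ k + t"
            using mult_nonneg_nonneg[OF that(1) std_simplexD(1)[OF elim, of k]] that(2) by linarith
          then show ?case by (simp add: H_def axis_def)
        qed
      qed
      then show ?thesis by simp
    qed
    have "(\<integral>\<^sup>+s. (ennreal (s ^ m) * indicator {1..2} s) *
        (\<Sum>j\<in>UNIV. ennreal (B j k) * (\<integral>\<^sup>+x. indicator H (s *\<^sub>R x + (2 - s) *\<^sub>R axis k 1) \<partial>\<mu> j)) \<partial>lborel) = (\<integral>\<^sup>+s. 0 \<partial>(lborel :: real measure))"
    proof (rule nn_integral_cong_AE)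
      have "AE s in lborel. s \<noteq> (2::real)" by (rule AE_lborel_singleton)
      then show "AE s in lborel. (ennreal (s ^ m) * indicator {1..2} s) *
        (\<Sum>j\<in>UNIV. ennreal (B j k) * (\<integral>\<^sup>+x. indicator H (s *\<^sub>R x + (2 - s) *\<^sub>R axis k 1) \<partial>\<mu> j)) = 0"
      proof eventually_elim
        case (elim s)
        then show ?case by (auto split: split_indicator simp: z)
      qed
    qed
    then have "ennreal (2 ^ Suc m) * ennreal (p k k) = 0"
      using D[of k] z[of 1 1 k] by (simp add: scale)
    then have "(2::real) ^ m \<le> 0 \<or> p k k \<le> 0" by (simp add: ennreal_eq_0_iff)
    with p0[of k] zero_less_power[of "2::real" m] show ?thesis by linarith
  qed
  \<comment> \<open>A stay in another state \<open>i\<close> leaves the coordinate \<open>k\<close>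
    unchanged, so Duhamel's formula becomes a linear relation between the masses.\<close>
  assume ik: "i \<noteq> k"
  have "(\<integral>\<^sup>+x. indicator H (s *\<^sub>R x + t *\<^sub>R axis i 1) \<partial>\<mu> j) = (\<integral>\<^sup>+x. indicator H (s *\<^sub>R x) \<partial>\<mu> j)" for s t j
    using ik by (intro nn_integral_cong) (auto simp: H_def axis_def split: split_indicator)
  note shift = this this[where s = 1 and t = 1 and j = i, simplified]
  have "ennreal (2 ^ Suc m) * ennreal (p k i) = ennreal (p k i) +
     (\<integral>\<^sup>+s. (ennreal (s ^ m) * indicator {1..2} s) * (\<Sum>j\<in>UNIV. ennreal (B j i) * ennreal (p k j)) \<partial>lborel)"
  proof -
    have "(\<integral>\<^sup>+s. (ennreal (s ^ m) * indicator {1..2} s) *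
        (\<Sum>j\<in>UNIV. ennreal (B j i) * (\<integral>\<^sup>+x. indicator H (s *\<^sub>R x + (2 - s) *\<^sub>R axis i 1) \<partial>\<mu> j)) \<partial>lborel)
      = (\<integral>\<^sup>+s. (ennreal (s ^ m) * indicator {1..2} s) * (\<Sum>j\<in>UNIV. ennreal (B j i) * ennreal (p k j)) \<partial>lborel)"
      unfolding shift(1) by (intro nn_integral_cong) (auto split: split_indicator simp: scale)
    then show ?thesis using D[of i] scale[of 2 i] scale[of 1 i] shift(2) by simp
  qed
  also have "(\<Sum>j\<in>UNIV. ennreal (B j i) * ennreal (p k j)) = ennreal (\<Sum>j\<in>UNIV. B j i * p k j)"
    by (simp add: sum_ennreal[symmetric] ennreal_mult B_nonneg p0)
  also have "(\<integral>\<^sup>+s. (ennreal (s ^ m) * indicator {1..2} s) * ennreal (\<Sum>j\<in>UNIV. B j i * p k j) \<partial>lborel)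
      = (\<integral>\<^sup>+s. ennreal (s ^ m) * indicator {1..2} s \<partial>lborel) * ennreal (\<Sum>j\<in>UNIV. B j i * p k j)"
    by (rule nn_integral_multc) measurable
  also have "(\<integral>\<^sup>+s. ennreal (s ^ m) * indicator {1..2} s \<partial>lborel) = ennreal (2 ^ Suc m / real (Suc m) - 1 ^ Suc m / real (Suc m))"
    by (rule nn_integral_FTC_Icc) (auto intro!: derivative_eq_intros simp del: of_nat_Suc power_Suc simp: divide_simps)
  \<comment> \<open>The integral of \<open>s ^ m\<close> over \<open>{1..2}\<close> is
    \<open>(2 ^ Suc m - 1) / real (Suc m)\<close>. The difference of the two endpoint terms carries
    the same factor \<open>2 ^ Suc m - 1\<close>, which therefore cancels.\<close>
  finally have "2 ^ Suc m * p k i = p k i + (2 ^ Suc m / real (Suc m) - 1 ^ Suc m / real (Suc m)) * (\<Sum>j\<in>UNIV. B j i * p k j)"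
  proof -
    assume *: "ennreal (2 ^ Suc m) * ennreal (p k i) = ennreal (p k i) + ennreal (2 ^ Suc m / real (Suc m) - 1 ^ Suc m / real (Suc m)) * ennreal (\<Sum>j\<in>UNIV. B j i * p k j)"
    have s: "0 \<le> (\<Sum>j\<in>UNIV. B j i * p k j)" by (intro sum_nonneg mult_nonneg_nonneg B_nonneg p0)
    have c: "0 \<le> 2 ^ Suc m / real (Suc m) - 1 ^ Suc m / real (Suc m)"
      using one_le_power[of "2::real" "Suc m"] by (simp add: diff_divide_distrib[symmetric] del: of_nat_Suc power_Suc)
    have "ennreal (2 ^ Suc m * p k i) = ennreal (p k i + (2 ^ Suc m / real (Suc m) - 1 ^ Suc m / real (Suc m)) * (\<Sum>j\<in>UNIV. B j i * p k j))"
      using * p0 s c by (simp add: ennreal_mult ennreal_plus del: of_nat_Suc power_Suc)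
    then show ?thesis
      using p0 s c by (subst (asm) ennreal_inj) (auto intro!: add_nonneg_nonneg mult_nonneg_nonneg simp del: of_nat_Suc power_Suc)
  qed
  then have "(2 ^ Suc m - 1) * (real (Suc m) * p k i) = (2 ^ Suc m - 1) * (\<Sum>j\<in>UNIV. B j i * p k j)"
    by (simp add: field_simps del: of_nat_Suc power_Suc)
  moreover have "(2::real) ^ Suc m - 1 \<noteq> 0"
    using one_less_power[of "2::real" "Suc m"] by simp
  ultimately show "(\<Sum>j\<in>UNIV. B j i * p k j) = real (Suc m) * p k i"
    by (metis mult_left_cancel)
qed

end

section \<open>From the generator to the weak equation\<close>

lemma has_gradient_partial_deriv:
  fixes f :: "real ^ 'n::finite \<Rightarrow> real"
  assumes "(f has_derivative (\<lambda>h. v \<bullet> h)) (at x)"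
  shows "partial_deriv k f x = v $ k"
proof -
  have "((\<lambda>t. x + t *\<^sub>R axis k 1) has_derivative (\<lambda>t. t *\<^sub>R axis k 1)) (at (0::real))"
    by (auto intro!: derivative_eq_intros)
  from has_derivative_compose[OF this, of f "\<lambda>h. v \<bullet> h"] assms
  have "((\<lambda>t. f (x + t *\<^sub>R axis k 1)) has_derivative (\<lambda>t. v \<bullet> (t *\<^sub>R axis k 1))) (at 0)"
    by simp
  then have "((\<lambda>t. f (x + t *\<^sub>R axis k 1)) has_real_derivative v $ k) (at 0)"
    unfolding has_field_derivative_def
    by (rule has_derivative_eq_rhs) (auto simp: fun_eq_iff inner_axis mult.commute)
  then show ?thesis
    unfolding partial_deriv_def by (rule DERIV_imp_deriv)
qed

lemma has_gradient_C1:
  fixes f :: "real ^ 'n::finite \<Rightarrow> real"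
  assumes "has_gradient f g"
  shows "C1 f" "grad f = g"
proof -
  show "grad f = g"
    by (auto simp: fun_eq_iff grad_def vec_eq_iff has_gradient_partial_deriv[OF has_gradientD(1)[OF assms]])
  then show "C1 f"
    using has_gradientD[OF assms] unfolding C1_def by (auto simp: differentiable_def)
qed

lemma space_zz_space: "space (zz_space :: ((real ^ 'n) \<times> 'n::finite) measure) = std_simplex \<times> UNIV"
  by (simp add: zz_space_def space_restrict_space space_pair_measure)

lemma measurable_zz_space_fst [measurable]:
  "fst \<in> measurable (zz_space :: ((real ^ 'n) \<times> 'n::finite) measure) borel"
  unfolding zz_space_def by (intro measurable_restrict_space1) measurable

lemma measurable_zz_space_snd [measurable]:
  "snd \<in> measurable (zz_space :: ((real ^ 'n) \<times> 'n::finite) measure) (count_space UNIV)"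
  unfolding zz_space_def by (intro measurable_restrict_space1) measurable

lemma measurable_zz_space:
  fixes f :: "(real ^ 'n) \<times> 'n::finite \<Rightarrow> real"
  assumes "\<And>i. (\<lambda>x. f (x, i)) \<in> borel_measurable borel"
  shows "f \<in> borel_measurable zz_space"
proof -
  note [measurable] = assms
  have "f z = (\<Sum>i\<in>UNIV. if snd z = i then f (fst z, i) else 0)" for z
    by simp
  moreover have "(\<lambda>z. \<Sum>i\<in>UNIV. if snd z = i then f (fst z, i) else 0) \<in> borel_measurable zz_space"
    by measurable
  ultimately show ?thesis by (simp add: fun_eq_iff[symmetric])
qed

lemma C1_continuous:
  assumes "C1 f"
  shows "continuous_on UNIV f"
  using assms unfolding C1_def
  by (auto intro!: differentiable_imp_continuous_on simp: differentiable_on_def intro: differentiable_at_withinI)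

lemma bounded_zz_space:
  fixes f :: "(real ^ 'n) \<times> 'n::finite \<Rightarrow> real"
  assumes "\<And>i. continuous_on UNIV (\<lambda>x. f (x, i))"
  shows "\<exists>C. \<forall>z\<in>space zz_space. \<bar>f z\<bar> \<le> C"
proof -
  have "\<forall>i. \<exists>C\<ge>0. \<forall>x. norm x \<le> 1 \<longrightarrow> norm (f (x, i)) \<le> C"
    using continuous_on_bounded_cball[OF assms] by blast
  then obtain C where C: "\<And>i. C i \<ge> 0" "\<And>i x. norm x \<le> 1 \<Longrightarrow> norm (f (x, i)) \<le> C i"
    by metis
  have "\<bar>f z\<bar> \<le> (\<Sum>i\<in>UNIV. C i)" if "z \<in> space zz_space" for z
  proof -
    have "fst z \<in> std_simplex" using that by (auto simp: space_zz_space)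
    from C(2)[OF norm_std_simplex[OF this], of "snd z"] have "\<bar>f z\<bar> \<le> C (snd z)" by simp
    also have "\<dots> \<le> (\<Sum>i\<in>UNIV. C i)" using C(1) by (intro member_le_sum) auto
    finally show ?thesis .
  qed
  then show ?thesis by blast
qed

text \<open>Under \<pi> the difference quotients of the semigroup integrate to 0 for every positive
  \<open>t\<close>, by stationarity. They are uniformly close to the generator, and on a probability
  space this passes to the integrals.\<close>

lemma integral_zz_generator:
  fixes \<pi> :: "((real ^ 'n) \<times> 'n::finite) measure"
  assumes K: "exp_zigzag a q K" and st: "stationary_distribution zz_space K \<pi>"
    and f: "\<And>i. C1 (\<lambda>x. f (x, i))"
  shows "(\<integral>z. zz_generator a q f z \<partial>\<pi>) = 0"
proof -
  have \<pi>: "sets \<pi> = sets zz_space" "prob_space \<pi>"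
    using st by (auto simp: stationary_distribution_def space_prob_algebra)
  interpret prob_space \<pi> by fact
  have sp: "space \<pi> = space zz_space" using sets_eq_imp_space_eq[OF \<pi>(1)] .
  note [measurable_cong] = \<pi>(1)
  have fm[measurable]: "f \<in> borel_measurable zz_space"
    by (intro measurable_zz_space borel_measurable_continuous_onI C1_continuous f)
  obtain C where C: "\<And>z. z \<in> space zz_space \<Longrightarrow> \<bar>f z\<bar> \<le> C"
    using bounded_zz_space[OF C1_continuous[OF f]] by blast
  have Kt: "K t \<in> measurable zz_space (prob_algebra zz_space)" if "0 \<le> t" for t
    using K that by (auto simp: exp_zigzag_def markov_semigroup_def)
  have Kt': "K t \<in> measurable zz_space (subprob_algebra zz_space)" if "0 \<le> t" for t
    using measurable_prob_algebraD[OF Kt[OF that]] .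
  have Kp: "prob_space (K t z)" "sets (K t z) = sets zz_space" if "0 \<le> t" "z \<in> space zz_space" for t z
    using measurable_space[OF Kt[OF that(1)] that(2)] by (auto simp: space_prob_algebra)
  define u where "u t z = (\<integral>w. f w \<partial>K t z) - f z" for t z
  have um: "(\<lambda>z. \<integral>w. f w \<partial>K t z) \<in> borel_measurable zz_space" if "0 \<le> t" for t
    using measurable_compose[OF Kt'[OF that] integral_measurable_subprob_algebra[OF fm]] .
  have ub: "\<bar>\<integral>w. f w \<partial>K t z\<bar> \<le> C" if "0 \<le> t" "z \<in> space zz_space" for t z
  proof -
    interpret Kz: prob_space "K t z" by (rule Kp[OF that])
    have sK: "space (K t z) = space zz_space" using sets_eq_imp_space_eq[OF Kp(2)[OF that]] .
    have fK: "f \<in> borel_measurable (K t z)" using fm measurable_cong_sets[OF Kp(2)[OF that] refl] by blast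
    have "integrable (K t z) f"
      by (rule Kz.integrable_const_bound[of _ C]) (use C fK sK in auto)
    then have "\<bar>\<integral>w. f w \<partial>K t z\<bar> \<le> (\<integral>w. C \<partial>K t z)"
      by (intro order_trans[OF integral_abs_bound] integral_mono) (use C sK in auto)
    then show ?thesis using Kz.prob_space by simp
  qed
  have if': "integrable \<pi> f"
    by (rule integrable_const_bound[of _ C]) (use C sp in auto)
  have iu: "integrable \<pi> (\<lambda>z. \<integral>w. f w \<partial>K t z)" if "0 \<le> t" for t
    by (rule integrable_const_bound[of _ C]) (use ub[OF that] um[OF that] sp in auto)
  have iu0: "(\<integral>z. u t z \<partial>\<pi>) = 0" if "0 \<le> t" for t
  proof -
    have "\<pi> \<bind> K t = \<pi>" using st that by (auto simp: stationary_distribution_def)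
    moreover have "(\<integral>z. f z \<partial>(\<pi> \<bind> K t)) = (\<integral>z. (\<integral>w. f w \<partial>K t z) \<partial>\<pi>)"
    proof (rule integral_bind[where K = zz_space and B = C and B' = 1])
      show "K t \<in> measurable \<pi> (subprob_algebra zz_space)"
        using Kt'[OF that] measurable_cong_sets[OF \<pi>(1) refl] by blast
      show "AE x in \<pi>. emeasure (K t x) (space (K t x)) \<le> ennreal 1"
        using prob_space.emeasure_space_1[OF Kp(1)[OF that]] sp by (intro AE_I2) auto
    qed (use C fm finite_measure_axioms in auto)
    ultimately have "(\<integral>z. (\<integral>w. f w \<partial>K t z) \<partial>\<pi>) = (\<integral>z. f z \<partial>\<pi>)" by simp
    then show ?thesis unfolding u_def using iu[OF that] if' by simp
  qed
  \<comment> \<open>A sequence of times, so that the generator is measurable as a pointwise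
    limit.\<close>
  define tn where "tn n = 1 / real (Suc n)" for n
  have tn: "0 < tn n" for n by (simp add: tn_def)
  have "filterlim tn (at_right 0) sequentially"
    unfolding filterlim_at tn_def
    using lim_inverse_n' LIMSEQ_inverse_real_of_nat by (auto simp: inverse_eq_divide)
  moreover have "uniform_limit (space zz_space) (\<lambda>t z. u t z / t) (zz_generator a q f) (at_right 0)"
    using K f unfolding exp_zigzag_def u_def by blast
  ultimately have lim: "uniform_limit (space zz_space) (\<lambda>n z. u (tn n) z / tn n) (zz_generator a q f) sequentially"
    by (rule filterlim_compose[rotated])
  have vm: "(\<lambda>z. u (tn n) z / tn n) \<in> borel_measurable zz_space" for n
    using um[of "tn n"] tn[of n] fm unfolding u_def by simp
  have Lm: "zz_generator a q f \<in> borel_measurable zz_space"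
    by (rule borel_measurable_LIMSEQ_real[OF tendsto_uniform_limitI[OF lim] vm])
  have iv: "integrable \<pi> (\<lambda>z. u (tn n) z / tn n)" for n
    unfolding u_def using iu[of "tn n"] if' tn[of n] by (intro integrable_divide Bochner_Integration.integrable_diff) auto
  have close: "\<bar>\<integral>z. zz_generator a q f z \<partial>\<pi>\<bar> \<le> e" if e: "0 < e" for e
  proof -
    obtain n where n: "\<And>z. z \<in> space zz_space \<Longrightarrow> dist (u (tn n) z / tn n) (zz_generator a q f z) < e"
      using uniform_limitD[OF lim e] by (auto simp: eventually_sequentially)
    have n': "\<bar>zz_generator a q f z - u (tn n) z / tn n\<bar> \<le> e" if "z \<in> space \<pi>" for z
      using n[of z] that sp by (simp add: dist_real_def abs_minus_commute less_imp_le)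
    have "integrable \<pi> (\<lambda>z. zz_generator a q f z - u (tn n) z / tn n)"
    proof (rule integrable_const_bound[of _ e])
      show "AE z in \<pi>. norm (zz_generator a q f z - u (tn n) z / tn n) \<le> e"
        using n' by (intro AE_I2) simp
      show "(\<lambda>z. zz_generator a q f z - u (tn n) z / tn n) \<in> borel_measurable \<pi>"
        using Lm vm[of n] measurable_cong_sets[OF \<pi>(1) refl] by auto
    qed
    then have d: "\<bar>\<integral>z. zz_generator a q f z - u (tn n) z / tn n \<partial>\<pi>\<bar> \<le> (\<integral>z. e \<partial>\<pi>)"
      using n' by (intro order_trans[OF integral_abs_bound] integral_mono) auto
    have "(\<integral>z. zz_generator a q f z \<partial>\<pi>) = (\<integral>z. (zz_generator a q f z - u (tn n) z / tn n) + u (tn n) z / tn n \<partial>\<pi>)"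
      by simp
    also have "\<dots> = (\<integral>z. zz_generator a q f z - u (tn n) z / tn n \<partial>\<pi>) + (\<integral>z. u (tn n) z / tn n \<partial>\<pi>)"
      by (rule Bochner_Integration.integral_add) fact+
    also have "(\<integral>z. u (tn n) z / tn n \<partial>\<pi>) = 0"
      using iu0[of "tn n"] tn[of n] by simp
    finally show ?thesis using d prob_space by simp
  qed
  show ?thesis
  proof (rule ccontr)
    assume "(\<integral>z. zz_generator a q f z \<partial>\<pi>) \<noteq> 0"
    then show False using close[of "\<bar>\<integral>z. zz_generator a q f z \<partial>\<pi>\<bar> / 2"] by simp
  qed
qed

text \<open>The mass is not normalised; for the stationary distribution it will turn out to be
  \<open>\<nu> $ i\<close>.\<close>

definition state_marginal :: "((real ^ 'n) \<times> 'n) measure \<Rightarrow> 'n \<Rightarrow> (real ^ 'n::finite) measure" where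
  "state_marginal \<pi> i = distr (density \<pi> (\<lambda>z. ennreal (if snd z = i then 1 else 0))) borel fst"

lemma sets_state_marginal [simp, measurable_cong]: "sets (state_marginal \<pi> i) = sets borel"
  by (simp add: state_marginal_def)

lemma state_marginal_facts:
  fixes \<pi> :: "((real ^ 'n) \<times> 'n::finite) measure"
  assumes \<pi>: "sets \<pi> = sets zz_space"
  shows "A \<in> sets borel \<Longrightarrow> emeasure (state_marginal \<pi> i) A = emeasure \<pi> {z \<in> space \<pi>. fst z \<in> A \<and> snd z = i}"
    and "f \<in> borel_measurable borel \<Longrightarrow>
      (\<integral>x. f x \<partial>state_marginal \<pi> i) = (\<integral>z. (if snd z = i then f (fst z) else 0 :: real) \<partial>\<pi>)"
proof -
  note [measurable_cong] = \<pi>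
  have fst': "fst \<in> measurable (density \<pi> (\<lambda>z. ennreal (if snd z = i then 1 else 0))) (borel :: (real ^ 'n) measure)"
    by measurable
  {
    assume [measurable]: "A \<in> sets borel"
    have "emeasure (state_marginal \<pi> i) A = (\<integral>\<^sup>+z. ennreal (if snd z = i then 1 else 0) * indicator (fst -` A \<inter> space \<pi>) z \<partial>\<pi>)"
      unfolding state_marginal_def by (subst emeasure_distr[OF fst']) (auto simp: emeasure_density)
    also have "\<dots> = (\<integral>\<^sup>+z. indicator {z \<in> space \<pi>. fst z \<in> A \<and> snd z = i} z \<partial>\<pi>)"
      by (intro nn_integral_cong) (auto split: split_indicator)
    also have "\<dots> = emeasure \<pi> {z \<in> space \<pi>. fst z \<in> A \<and> snd z = i}"
    proof (rule nn_integral_indicator)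
      have "fst -` A \<inter> space \<pi> \<in> sets \<pi>" "snd -` {i} \<inter> space \<pi> \<in> sets \<pi>"
        using measurable_sets[OF measurable_zz_space_fst, of A] measurable_sets[OF measurable_zz_space_snd, of "{i}"]
          \<pi> sets_eq_imp_space_eq[OF \<pi>] by auto
      from sets.Int[OF this] show "{z \<in> space \<pi>. fst z \<in> A \<and> snd z = i} \<in> sets \<pi>"
        by (rule back_subst[of "\<lambda>S. S \<in> sets \<pi>"]) auto
    qed
    finally show "emeasure (state_marginal \<pi> i) A = emeasure \<pi> {z \<in> space \<pi>. fst z \<in> A \<and> snd z = i}" .
  }
  {
    assume f[measurable]: "f \<in> borel_measurable borel"
    have fm: "(\<lambda>z. f (fst z)) \<in> borel_measurable \<pi>"
      using measurable_compose[OF measurable_zz_space_fst f] measurable_cong_sets[OF \<pi> refl] by blast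
    have im: "(\<lambda>z. if snd z = i then 1 else 0 :: real) \<in> borel_measurable \<pi>"
      by measurable
    have "(\<integral>x. f x \<partial>state_marginal \<pi> i) = (\<integral>z. f (fst z) \<partial>density \<pi> (\<lambda>z. ennreal (if snd z = i then 1 else 0)))"
      unfolding state_marginal_def by (rule integral_distr[OF fst']) measurable
    also have "\<dots> = (\<integral>z. (if snd z = i then 1 else 0) *\<^sub>R f (fst z) \<partial>\<pi>)"
      by (rule integral_density[OF fm im]) auto
    also have "\<dots> = (\<integral>z. (if snd z = i then f (fst z) else 0) \<partial>\<pi>)"
      by (intro Bochner_Integration.integral_cong) auto
    finally show "(\<integral>x. f x \<partial>state_marginal \<pi> i) = (\<integral>z. (if snd z = i then f (fst z) else 0) \<partial>\<pi>)" .
  }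
qed

lemma state_marginal_support:
  fixes \<pi> :: "((real ^ 'n) \<times> 'n::finite) measure"
  assumes \<pi>: "sets \<pi> = sets zz_space" and "finite_measure \<pi>"
  shows "finite_measure (state_marginal \<pi> i)" "AE x in state_marginal \<pi> i. x \<in> std_simplex"
proof -
  interpret finite_measure \<pi> by fact
  note em = state_marginal_facts(1)[OF \<pi>, where i = i]
  show "finite_measure (state_marginal \<pi> i)"
  proof (rule finite_measureI)
    have "space (state_marginal \<pi> i) = UNIV" using sets_eq_imp_space_eq[OF sets_state_marginal] by simp
    then show "emeasure (state_marginal \<pi> i) (space (state_marginal \<pi> i)) \<noteq> \<infinity>" by (simp add: em)
  qed
  show "AE x in state_marginal \<pi> i. x \<in> std_simplex"
  proof (rule AE_I)
    show "{x \<in> space (state_marginal \<pi> i). x \<notin> std_simplex} \<subseteq> - std_simplex" by auto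
    show "- std_simplex \<in> sets (state_marginal \<pi> i)" by simp
    have e: "{z \<in> space \<pi>. fst z \<in> - std_simplex \<and> snd z = i} = {}"
      using sets_eq_imp_space_eq[OF \<pi>] by (auto simp: space_zz_space)
    have "emeasure (state_marginal \<pi> i) (- std_simplex) = emeasure \<pi> {z \<in> space \<pi>. fst z \<in> - std_simplex \<and> snd z = i}"
      by (rule em) simp
    then show "emeasure (state_marginal \<pi> i) (- std_simplex) = 0" unfolding e by simp
  qed
qed

text \<open>The generator is tested with \<open>f\<close> in state \<open>i\<close> and 0 elsewhere.
  From \<open>j \<noteq> i\<close> only the jump into \<open>i\<close> counts; from \<open>i\<close>
  every jump loses \<open>f\<close>, and the diagonal convention sums these losses to
  \<open>q $ i $ i\<close>.\<close>

lemma state_marginal_weak_equation: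
  fixes \<pi> :: "((real ^ 'n) \<times> 'n::finite) measure"
  assumes q_diag: "\<And>i. q $ i $ i = - (\<Sum>j\<in>UNIV - {i}. q $ i $ j)"
    and K: "exp_zigzag a q K" and st: "stationary_distribution zz_space K \<pi>"
    and f: "has_gradient f g"
  shows "(\<integral>x. (axis i 1 - x) \<bullet> g x \<partial>state_marginal \<pi> i)
    + a * (\<Sum>j\<in>UNIV. q $ j $ i * (\<integral>x. f x \<partial>state_marginal \<pi> j)) = 0"
proof -
  have \<pi>: "sets \<pi> = sets zz_space" "prob_space \<pi>"
    using st by (auto simp: stationary_distribution_def space_prob_algebra)
  interpret prob_space \<pi> by fact
  have sp: "space \<pi> = std_simplex \<times> UNIV"
    using sets_eq_imp_space_eq[OF \<pi>(1)] by (simp add: space_zz_space)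
  note int = state_marginal_facts(2)[OF \<pi>(1)]
  define F where "F z = (if snd z = i then f (fst z) else 0)" for z :: "(real ^ 'n) \<times> 'n"
  have FC: "has_gradient (\<lambda>x. F (x, j)) (\<lambda>x. if j = i then g x else 0)" for j
    using f has_gradient_const[of 0] by (cases "j = i") (auto simp: F_def)
  have gen: "zz_generator a q F z = (if snd z = i then (axis i 1 - fst z) \<bullet> g (fst z) else 0)
      + (\<Sum>j\<in>UNIV. a * q $ j $ i * (if snd z = j then f (fst z) else 0))" for z
  proof -
    obtain x j where z: "z = (x, j)" by (cases z)
    have "(\<Sum>l\<in>UNIV - {j}. a * q $ j $ l * (F (x, l) - F (x, j))) = a * q $ j $ i * f x"
    proof (cases "j = i")
      case True
      have "(\<Sum>l\<in>UNIV - {j}. a * q $ j $ l * (F (x, l) - F (x, j))) = (\<Sum>l\<in>UNIV - {i}. q $ i $ l * (- (a * f x)))"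
        by (intro sum.cong) (auto simp: F_def True)
      also have "\<dots> = a * q $ j $ i * f x"
        unfolding sum_distrib_right[symmetric] using q_diag[of i] True by simp
      finally show ?thesis .
    next
      case False
      have "(\<Sum>l\<in>UNIV - {j}. a * q $ j $ l * (F (x, l) - F (x, j))) = (\<Sum>l\<in>UNIV - {j}. if l = i then a * q $ j $ i * f x else 0)"
        by (intro sum.cong) (auto simp: F_def False)
      then show ?thesis using False by simp
    qed
    moreover have "(\<Sum>l\<in>UNIV. a * q $ l $ i * (if j = l then f x else 0)) = a * q $ j $ i * f x"
      by (simp add: if_distrib[of "\<lambda>c. _ * c"] cong: if_cong)
    ultimately show ?thesis
      unfolding z zz_generator_def fst_conv snd_conv prod.case has_gradient_C1(2)[OF FC] by simp
  qed
  have bm: "f \<in> borel_measurable borel" "(\<lambda>x. (axis i 1 - x) \<bullet> g x) \<in> borel_measurable borel"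
    using has_gradient_measurable[OF f] by auto
  have integrable: "integrable \<pi> (\<lambda>z. if snd z = j then h (fst z) else 0 :: real)"
    if h: "continuous_on UNIV h" for h :: "real ^ 'n \<Rightarrow> real" and j
  proof -
    have cont: "continuous_on UNIV (\<lambda>x. if snd (x, k) = j then h (fst (x, k)) else 0)" for k
      using h by (cases "k = j") auto
    obtain C where C: "\<forall>z\<in>space zz_space. \<bar>if snd z = j then h (fst z) else 0\<bar> \<le> C"
      using bounded_zz_space[of "\<lambda>z. if snd z = j then h (fst z) else 0", OF cont] by blast
    have hm: "(\<lambda>z. if snd z = j then h (fst z) else 0) \<in> borel_measurable zz_space"
      by (rule measurable_zz_space) (rule borel_measurable_continuous_onI[OF cont])
    show ?thesis
    proof (rule integrable_const_bound[of _ C])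
      show "AE z in \<pi>. norm (if snd z = j then h (fst z) else 0) \<le> C"
        by (rule AE_I2, unfold real_norm_def, rule C[rule_format]) (simp add: sp space_zz_space)
      show "(\<lambda>z. if snd z = j then h (fst z) else 0) \<in> borel_measurable \<pi>"
        using hm measurable_cong_sets[OF \<pi>(1) refl] by blast
    qed
  qed
  have ci: "continuous_on UNIV (\<lambda>x. (axis i 1 - x) \<bullet> g x)" "continuous_on UNIV f"
    using has_gradientD[OF f] by (auto intro!: continuous_intros)
  have "0 = (\<integral>z. zz_generator a q F z \<partial>\<pi>)"
    by (rule integral_zz_generator[OF K st has_gradient_C1(1)[OF FC], symmetric])
  also have "\<dots> = (\<integral>x. (axis i 1 - x) \<bullet> g x \<partial>state_marginal \<pi> i) + (\<Sum>j\<in>UNIV. a * q $ j $ i * (\<integral>x. f x \<partial>state_marginal \<pi> j))"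
    unfolding gen int[OF bm(1)] int[OF bm(2)]
    using integrable[OF ci(1), of i] integrable[OF ci(2)]
    by (simp add: Bochner_Integration.integral_sum)
  finally show ?thesis by (simp add: sum_distrib_left mult.assoc)
qed

section \<open>Null vectors of an irreducible rate matrix\<close>

text \<open>At a zero entry the equation is a vanishing sum of nonnegative terms, so every state
  with an edge into it has a zero entry too. Zeros thus spread backwards along paths. The summand
  \<open>mat 1\<close> affects only loops, which are treated separately.\<close>

lemma irreducible_null_vector_zero:
  fixes q :: "real ^ 'n::finite ^ 'n" and z :: "'n \<Rightarrow> real"
  assumes q: "\<And>i j. i \<noteq> j \<Longrightarrow> q $ i $ j \<ge> 0" and irr: "irreducible_matrix (mat 1 + q)"
    and z: "\<And>i. 0 \<le> z i" "\<And>i. (\<Sum>j\<in>UNIV. z j * q $ j $ i) = 0" and i: "z i = 0"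
  shows "z k = 0"
proof -
  have step: "z j = 0" if "z l = 0" "(j, l) \<in> {(k, l). (mat 1 + q) $ k $ l \<noteq> 0}" for j l
  proof (cases "j = l")
    case False
    then have qjl: "q $ j $ l \<noteq> 0" using that(2) by (simp add: mat_def)
    have "(\<Sum>j\<in>UNIV - {l}. z j * q $ j $ l) = 0"
      using z(2)[of l] that(1) by (subst (asm) sum.remove[of _ l]) auto
    then have "\<forall>j\<in>UNIV - {l}. z j * q $ j $ l = 0"
      by (subst (asm) sum_nonneg_eq_0_iff) (auto intro!: mult_nonneg_nonneg z q)
    then show ?thesis using False qjl by auto
  qed (use that in simp)
  have "(k, i) \<in> {(k, l). (mat 1 + q) $ k $ l \<noteq> 0}\<^sup>*"
    using irr by (auto simp: irreducible_matrix_def)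
  then show ?thesis
    by (induction rule: converse_rtrancl_induct) (use i step in auto)
qed

text \<open>The smallest ratio \<open>t\<close> of the entries makes \<open>z - t w\<close>
  nonnegative with a zero entry, so it vanishes by the previous lemma, and the normalisation gives
  \<open>t = 1\<close>.\<close>

lemma irreducible_null_vector_unique:
  fixes q :: "real ^ 'n::finite ^ 'n" and z w :: "'n \<Rightarrow> real"
  assumes q: "\<And>i j. i \<noteq> j \<Longrightarrow> q $ i $ j \<ge> 0" and irr: "irreducible_matrix (mat 1 + q)"
    and z: "\<And>i. 0 \<le> z i" "\<And>i. (\<Sum>j\<in>UNIV. z j * q $ j $ i) = 0" "(\<Sum>i\<in>UNIV. z i) = 1"
    and w: "\<And>i. 0 \<le> w i" "\<And>i. (\<Sum>j\<in>UNIV. w j * q $ j $ i) = 0" "(\<Sum>i\<in>UNIV. w i) = 1"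
  shows "0 < w i" "z i = w i"
proof -
  have wpos: "0 < w i" for i
  proof (rule ccontr)
    assume "\<not> 0 < w i"
    then have "w i = 0" using w(1)[of i] by simp
    then have "w k = 0" for k using irreducible_null_vector_zero[OF q irr w(1,2)] by blast
    with w(3) show False by simp
  qed
  then show "0 < w i" .
  define t where "t = Min (range (\<lambda>i. z i / w i))"
  have "t \<in> range (\<lambda>i. z i / w i)" unfolding t_def by (intro Min_in) auto
  then obtain i0 where i0: "t = z i0 / w i0" by blast
  have le: "t \<le> z i / w i" for i unfolding t_def by (intro Min_le) auto
  have d: "0 \<le> z i - t * w i" for i using le[of i] wpos[of i] by (simp add: field_simps)
  have n: "(\<Sum>j\<in>UNIV. (z j - t * w j) * q $ j $ i) = 0" for i
    using z(2)[of i] w(2)[of i]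
    by (simp add: left_diff_distrib sum_subtractf mult.assoc sum_distrib_left[symmetric])
  have "z i0 - t * w i0 = 0" using wpos[of i0] by (simp add: i0)
  then have all: "z k - t * w k = 0" for k
    using irreducible_null_vector_zero[OF q irr, of "\<lambda>i. z i - t * w i"] d n by blast
  then have "(\<Sum>k\<in>UNIV. z k) = t * (\<Sum>k\<in>UNIV. w k)" by (simp add: sum_distrib_left)
  then have "t = 1" using z(3) w(3) by simp
  then show "z i = w i" using all[of i] by simp
qed

section \<open>Conditional laws, their densities and the differential equation\<close>

theorem proposition3p4:
  fixes a :: real and q :: "real ^ 'n::finite ^ 'n" and \<nu> :: "real ^ 'n" and r :: 'n
    and K :: "real \<Rightarrow> (real ^ 'n) \<times> 'n \<Rightarrow> ((real ^ 'n) \<times> 'n) measure"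
    and \<pi> :: "((real ^ 'n) \<times> 'n) measure"
  assumes "a > 0"
    and "\<And>i j. i \<noteq> j \<Longrightarrow> q $ i $ j \<ge> 0"
    and "\<And>i. q $ i $ i = - (\<Sum>j\<in>UNIV - {i}. q $ i $ j)"
    and "irreducible_matrix (mat 1 + q)"
    and "\<And>i. \<nu> $ i \<ge> 0" and "(\<Sum>i\<in>UNIV. \<nu> $ i) = 1" and "\<nu> v* q = 0"
    and "exp_zigzag a q K"
    and "stationary_distribution zz_space K \<pi>"
  shows "\<exists>(\<pi>\<^sub>c :: 'n \<Rightarrow> (real ^ 'n) measure) (\<phi> :: (real ^ 'n) \<times> 'n \<Rightarrow> real).
    (\<forall>A\<in>sets zz_space. emeasure \<pi> A =
       (\<Sum>i\<in>UNIV. ennreal (\<nu> $ i) * emeasure (\<pi>\<^sub>c i \<Otimes>\<^sub>M return (count_space UNIV) i) A)) \<and>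
    (\<forall>i. prob_space (\<pi>\<^sub>c i)) \<and>
    (\<forall>i. (\<lambda>x. \<phi> (x, i)) \<in> borel_measurable borel) \<and>
    (\<forall>x i. \<phi> (x, i) \<ge> 0) \<and>
    (\<forall>i. \<pi>\<^sub>c i = density (simplex_lebesgue r) (\<lambda>x. ennreal (\<phi> (x, i)))) \<and>
    (\<forall>x\<in>std_simplex. \<forall>i. (\<forall>k. x $ k > 0) \<longrightarrow>
       (\<lambda>y. \<phi> (y, i)) differentiable (at x) \<and>
       (real CARD('n) - 1) * \<phi> (x, i)
       + (\<Sum>k\<in>UNIV. x $ k * partial_deriv k (\<lambda>y. \<phi> (y, i)) x)
       - partial_deriv i (\<lambda>y. \<phi> (y, i)) x
       + (\<Sum>j\<in>UNIV. \<nu> $ j / \<nu> $ i * a * q $ j $ i * \<phi> (x, j)) = 0)"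
proof -
  note q = assms(2)
  have \<pi>: "sets \<pi> = sets zz_space" "prob_space \<pi>"
    using assms(9) by (auto simp: stationary_distribution_def space_prob_algebra)
  interpret prob_space \<pi> by fact
  have sp: "space \<pi> = std_simplex \<times> UNIV"
    using sets_eq_imp_space_eq[OF \<pi>(1)] by (simp add: space_zz_space)
  note [measurable_cong] = \<pi>(1)
  define \<mu> where "\<mu> i = state_marginal \<pi> i" for i
  have sets_\<mu>: "sets (\<mu> i) = sets borel" for i by (simp add: \<mu>_def)
  have em: "emeasure (\<mu> i) A = emeasure \<pi> {z \<in> space \<pi>. fst z \<in> A \<and> snd z = i}" if "A \<in> sets borel" for A i
    unfolding \<mu>_def by (rule state_marginal_facts(1)[OF \<pi>(1) that])
  note fin = state_marginal_support(1)[OF \<pi>(1) finite_measure_axioms, folded \<mu>_def]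
  note supp = state_marginal_support(2)[OF \<pi>(1) finite_measure_axioms, folded \<mu>_def]
  \<comment> \<open>The sum of the moduli bounds every diagonal entry at once.\<close>
  obtain m :: nat where m: "a * (\<Sum>i\<in>UNIV. \<bar>q $ i $ i\<bar>) \<le> real m"
    using real_arch_simple by blast
  define B where "B j i = a * q $ j $ i + (if j = i then real (Suc m) else 0)" for j i
  have B_nonneg: "0 \<le> B k i" for k i
  proof (cases "k = i")
    case True
    have "a * \<bar>q $ i $ i\<bar> \<le> a * (\<Sum>i\<in>UNIV. \<bar>q $ i $ i\<bar>)"
      using assms(1) by (intro mult_left_mono member_le_sum) auto
    moreover have "a * (- \<bar>q $ i $ i\<bar>) \<le> a * q $ i $ i"
      using assms(1) by (intro mult_left_mono) auto
    ultimately have "- real m \<le> a * q $ i $ i" using m by (simp only: mult_minus_right)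
    then show ?thesis unfolding B_def True by simp
  next
    case False
    then show ?thesis using assms(1) q by (simp add: B_def)
  qed
  have row0: "(\<Sum>i\<in>UNIV. q $ j $ i) = 0" for j
    by (subst sum.remove[of _ j]) (auto simp: assms(3)[of j])
  have B_row: "(\<Sum>i\<in>UNIV. B j i) = real (Suc m)" for j
    by (simp add: B_def sum.distrib sum_distrib_left[symmetric] row0)
  have B_sum: "(\<Sum>j\<in>UNIV. B j i * c j) = a * (\<Sum>j\<in>UNIV. q $ j $ i * c j) + real (Suc m) * c i" for c i
  proof -
    have "B j i * c j = a * (q $ j $ i * c j) + (if j = i then real (Suc m) * c j else 0)" for j
      by (simp add: B_def distrib_right)
    then show ?thesis by (simp add: sum.distrib sum_distrib_left[symmetric])
  qed
  note weak0 = state_marginal_weak_equation[OF assms(3,8,9), folded \<mu>_def]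
  interpret zz: stationary_zigzag \<mu> B m
  proof (rule stationary_zigzag.intro)
    fix f :: "real ^ 'n \<Rightarrow> real" and g i assume "has_gradient f g"
    from weak0[OF this, of i]
    show "(\<integral>x. (axis i 1 - x) \<bullet> g x \<partial>\<mu> i) + (\<Sum>j\<in>UNIV. B j i * (\<integral>x. f x \<partial>\<mu> j)) = real (Suc m) * (\<integral>x. f x \<partial>\<mu> i)"
      unfolding B_sum[of i "\<lambda>j. \<integral>x. f x \<partial>\<mu> j"] by simp
  qed (rule sets_\<mu> fin supp B_nonneg B_row)+
  \<comment> \<open>The masses of the states form a probability vector, and the weak equation for
    the constant 1 makes it a null vector of \<open>q\<close>. Uniqueness identifies it with
    \<nu>.\<close>
  define z where "z i = measure (\<mu> i) UNIV" for i
  have z: "z i = measure \<pi> {z \<in> space \<pi>. snd z = i}" for i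
    unfolding z_def measure_def by (simp add: em)
  have z0: "0 \<le> z i" for i by (simp add: z_def)
  have zq: "(\<Sum>j\<in>UNIV. z j * q $ j $ i) = 0" for i
    using weak0[OF has_gradient_const[of 1], of i] assms(1) by (simp add: z_def mult.commute)
  have z1: "(\<Sum>i\<in>UNIV. z i) = 1"
  proof -
    have "(\<Sum>i\<in>UNIV. z i) = measure \<pi> (\<Union>i\<in>UNIV. {z \<in> space \<pi>. snd z = i})"
      unfolding z by (rule finite_measure_finite_Union[symmetric]) (auto simp: disjoint_family_on_def)
    also have "(\<Union>i\<in>UNIV. {z \<in> space \<pi>. snd z = i}) = space \<pi>" by auto
    finally show ?thesis using prob_space by simp
  qed
  have \<nu>q: "(\<Sum>j\<in>UNIV. \<nu> $ j * q $ j $ i) = 0" for i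
    using arg_cong[OF assms(7), of "\<lambda>v. v $ i"] by (simp add: vector_matrix_mult_def mult.commute)
  have \<nu>pos: "0 < \<nu> $ i" and z\<nu>: "z i = \<nu> $ i" for i
    using irreducible_null_vector_unique[OF q assms(4) z0 zq z1 assms(5) \<nu>q assms(6)] by auto
  have null: "emeasure (\<mu> i) {x. x $ k = 0} = 0" for i k
  proof -
    define p where "p i = measure (\<mu> i) {x. x $ k = 0}" for i
    have pk: "p k = 0" unfolding p_def by (rule zz.face_masses(1))
    have pq: "(\<Sum>j\<in>UNIV. p j * q $ j $ i) = 0" if "i \<noteq> k" for i
      using zz.face_masses(2)[OF that] assms(1) unfolding p_def[symmetric] B_sum by (simp add: mult.commute)
    \<comment> \<open>Duhamel's formula has given the equations for \<open>i \<noteq> k\<close>. The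
      one for \<open>k\<close> follows, because the row sums of \<open>q\<close> vanish and so the
      left sides of all equations add up to 0.\<close>
    have "(\<Sum>i\<in>UNIV. \<Sum>j\<in>UNIV. p j * q $ j $ i) = 0"
      by (subst sum.swap) (simp add: sum_distrib_left[symmetric] row0)
    then have "(\<Sum>j\<in>UNIV. p j * q $ j $ k) = 0"
      by (subst (asm) sum.remove[of _ k]) (auto simp: pq)
    with pq have "(\<Sum>j\<in>UNIV. p j * q $ j $ i) = 0" for i by (cases "i = k") auto
    then have "p i = 0"
      by (intro irreducible_null_vector_zero[where z = p and i = k, OF q assms(4) _ _ pk])
         (simp_all add: p_def)
    then show ?thesis
      using fin[of i] by (simp add: p_def finite_measure.emeasure_eq_measure)
  qed
  \<comment> \<open>Division by \<open>\<nu> $ i\<close> turns the density of \<open>\<mu> i\<close>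
    into that of the conditional law. Points with a coordinate that is not positive get the value
    0.\<close>
  define \<phi> where "\<phi> = (\<lambda>(x, i). (if \<forall>k. 0 < x $ k then zz.orthant_density i x else 0) / \<nu> $ i)"
  define \<pi>c where "\<pi>c i = density (simplex_lebesgue r) (\<lambda>x. ennreal (\<phi> (x, i)))" for i
  have \<phi>m[measurable]: "(\<lambda>x. \<phi> (x, i)) \<in> borel_measurable borel" for i
    unfolding \<phi>_def by simp
  have \<phi>0: "0 \<le> \<phi> (x, i)" for x i
    unfolding \<phi>_def using \<nu>pos[of i] zz.orthant_density_nonneg[of x i]
    by (auto simp: positive_orthant_def)
  have \<mu>c: "emeasure (\<mu> i) A = ennreal (\<nu> $ i) * emeasure (\<pi>c i) A" if [measurable]: "A \<in> sets borel" for A i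
  proof -
    have "emeasure (\<mu> i) A = (\<integral>\<^sup>+x\<in>A. ennreal (if \<forall>k. 0 < x $ k then zz.orthant_density i x else 0) \<partial>simplex_lebesgue r)"
      by (subst zz.mu_eq_density[OF null, where r = r], subst emeasure_density) auto
    also have "\<dots> = (\<integral>\<^sup>+x. ennreal (\<nu> $ i) * (ennreal (\<phi> (x, i)) * indicator A x) \<partial>simplex_lebesgue r)"
    proof (rule nn_integral_cong)
      fix x
      have "(if \<forall>k. 0 < x $ k then zz.orthant_density i x else 0) = \<nu> $ i * \<phi> (x, i)"
        using \<nu>pos[of i] by (simp add: \<phi>_def)
      then show "ennreal (if \<forall>k. 0 < x $ k then zz.orthant_density i x else 0) * indicator A x
          = ennreal (\<nu> $ i) * (ennreal (\<phi> (x, i)) * indicator A x)"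
        using \<nu>pos[of i] \<phi>0 by (simp only:) (simp add: ennreal_mult mult.assoc)
    qed
    also have "\<dots> = ennreal (\<nu> $ i) * emeasure (\<pi>c i) A"
      unfolding \<pi>c_def by (subst nn_integral_cmult) (auto simp: emeasure_density)
    finally show ?thesis .
  qed
  have sets_\<pi>c: "sets (\<pi>c i) = sets borel" for i by (simp add: \<pi>c_def)
  have prob: "prob_space (\<pi>c i)" for i
  proof (rule prob_spaceI)
    have "ennreal (\<nu> $ i) * emeasure (\<pi>c i) UNIV = ennreal (\<nu> $ i) * 1"
      using \<mu>c[of UNIV i] z\<nu>[of i] fin[of i] by (simp add: z_def finite_measure.emeasure_eq_measure)
    then have "emeasure (\<pi>c i) UNIV = 1"
      using \<nu>pos[of i] by (subst (asm) ennreal_mult_cancel_left) auto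
    then show "emeasure (\<pi>c i) (space (\<pi>c i)) = 1"
      using sets_eq_imp_space_eq[OF sets_\<pi>c] by simp
  qed
  have decomp: "emeasure \<pi> A = (\<Sum>i\<in>UNIV. ennreal (\<nu> $ i) * emeasure (\<pi>c i \<Otimes>\<^sub>M return (count_space UNIV) i) A)"
    if A: "A \<in> sets zz_space" for A
  proof -
    have "std_simplex \<times> UNIV \<in> sets (borel \<Otimes>\<^sub>M count_space UNIV :: ((real ^ 'n) \<times> 'n) measure)"
      by (intro pair_measureI) auto
    then have A': "A \<in> sets (borel \<Otimes>\<^sub>M count_space UNIV)" and A_sub: "A \<subseteq> space \<pi>"
      using A by (auto simp: zz_space_def sets_restrict_space_iff sp)
    have sec: "(\<lambda>x. (x, i)) -` A \<in> sets borel" for i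
      using measurable_sets[OF measurable_Pair2'[of i "count_space UNIV" borel] A'] by simp
    have "emeasure \<pi> A = (\<Sum>i\<in>UNIV. emeasure \<pi> {z \<in> space \<pi>. z \<in> A \<and> snd z = i})"
    proof -
      have "A \<in> sets \<pi>" using A \<pi>(1) by simp
      then have [measurable]: "{z \<in> space \<pi>. z \<in> A \<and> snd z = i} \<in> sets \<pi>" for i by measurable
      have "(\<Sum>i\<in>UNIV. emeasure \<pi> {z \<in> space \<pi>. z \<in> A \<and> snd z = i}) = emeasure \<pi> (\<Union>i\<in>UNIV. {z \<in> space \<pi>. z \<in> A \<and> snd z = i})"
        by (rule sum_emeasure) (auto simp: disjoint_family_on_def)
      also have "(\<Union>i\<in>UNIV. {z \<in> space \<pi>. z \<in> A \<and> snd z = i}) = A" using A_sub by auto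
      finally show ?thesis ..
    qed
    also have "\<dots> = (\<Sum>i\<in>UNIV. ennreal (\<nu> $ i) * emeasure (\<pi>c i \<Otimes>\<^sub>M return (count_space UNIV) i) A)"
    proof (rule sum.cong[OF refl])
      fix i :: 'n
      interpret R: prob_space "return (count_space UNIV) i" by (rule prob_space_return) simp
      have "sets (\<pi>c i \<Otimes>\<^sub>M return (count_space UNIV) i) = sets (borel \<Otimes>\<^sub>M count_space UNIV)"
        by (intro sets_pair_measure_cong) (auto simp: sets_\<pi>c)
      with A' have "A \<in> sets (\<pi>c i \<Otimes>\<^sub>M return (count_space UNIV) i)" by simp
      then have "emeasure (\<pi>c i \<Otimes>\<^sub>M return (count_space UNIV) i) A
          = (\<integral>\<^sup>+x. emeasure (return (count_space UNIV) i) (Pair x -` A) \<partial>\<pi>c i)"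
        by (rule R.emeasure_pair_measure_alt)
      also have "\<dots> = (\<integral>\<^sup>+x. indicator ((\<lambda>x. (x, i)) -` A) x \<partial>\<pi>c i)"
        by (intro nn_integral_cong) (auto split: split_indicator)
      also have "\<dots> = emeasure (\<pi>c i) ((\<lambda>x. (x, i)) -` A)"
        using sec by (simp add: sets_\<pi>c)
      finally have "ennreal (\<nu> $ i) * emeasure (\<pi>c i \<Otimes>\<^sub>M return (count_space UNIV) i) A = emeasure (\<mu> i) ((\<lambda>x. (x, i)) -` A)"
        using \<mu>c[OF sec] by simp
      also have "\<dots> = emeasure \<pi> {z \<in> space \<pi>. z \<in> A \<and> snd z = i}"
        unfolding em[OF sec] by (rule arg_cong[of _ _ "emeasure \<pi>"]) auto
      finally show "emeasure \<pi> {z \<in> space \<pi>. z \<in> A \<and> snd z = i}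
          = ennreal (\<nu> $ i) * emeasure (\<pi>c i \<Otimes>\<^sub>M return (count_space UNIV) i) A" ..
    qed
    finally show ?thesis .
  qed
  obtain G where G: "\<And>i y. y \<in> positive_orthant \<Longrightarrow> (zz.orthant_density i has_derivative (\<lambda>h. G i y \<bullet> h)) (at y)"
    "\<And>i y. y \<in> positive_orthant \<Longrightarrow> G i y $ i = 1 / (\<Sum>k\<in>UNIV. y $ k) * (\<Sum>k\<in>UNIV. B k i * zz.orthant_density k y)"
    "\<And>i y. y \<in> positive_orthant \<Longrightarrow> G i y \<bullet> y = (real (m + 2) - real CARD('n)) * zz.orthant_density i y"
    using zz.orthant_density_gradient by blast
  have pde: "(\<lambda>y. \<phi> (y, i)) differentiable (at x) \<and>
       (real CARD('n) - 1) * \<phi> (x, i)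
       + (\<Sum>k\<in>UNIV. x $ k * partial_deriv k (\<lambda>y. \<phi> (y, i)) x)
       - partial_deriv i (\<lambda>y. \<phi> (y, i)) x
       + (\<Sum>j\<in>UNIV. \<nu> $ j / \<nu> $ i * a * q $ j $ i * \<phi> (x, j)) = 0"
    if x: "x \<in> std_simplex" and pos: "\<forall>k. x $ k > 0" for x i
  proof -
    have xp: "x \<in> positive_orthant" using pos by (simp add: positive_orthant_def)
    define \<rho> where "\<rho> j = zz.orthant_density j x" for j
    have \<phi>x: "\<phi> (x, j) = \<rho> j / \<nu> $ j" for j using pos by (simp add: \<phi>_def \<rho>_def)
    have "((\<lambda>y. zz.orthant_density i y / \<nu> $ i) has_derivative (\<lambda>h. (G i x /\<^sub>R \<nu> $ i) \<bullet> h)) (at x)"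
      using has_derivative_mult_left[OF G(1)[OF xp, of i], of "inverse (\<nu> $ i)"]
      by (simp add: divide_inverse mult.commute)
    then have der: "((\<lambda>y. \<phi> (y, i)) has_derivative (\<lambda>h. (G i x /\<^sub>R \<nu> $ i) \<bullet> h)) (at x)"
      by (rule has_derivative_transform_within_open[OF _ open_positive_orthant xp])
         (simp add: \<phi>_def positive_orthant_def)
    have pd: "partial_deriv k (\<lambda>y. \<phi> (y, i)) x = G i x $ k / \<nu> $ i" for k
      using has_gradient_partial_deriv[OF der, of k] by (simp add: divide_inverse mult.commute)
    have Gx: "(\<Sum>k\<in>UNIV. x $ k * (G i x $ k / \<nu> $ i)) = (real (m + 2) - real CARD('n)) * \<rho> i / \<nu> $ i"
      using G(3)[OF xp, of i] by (simp add: inner_vec_def \<rho>_def mult.commute sum_divide_distrib[symmetric])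
    have Gi: "G i x $ i = a * (\<Sum>j\<in>UNIV. q $ j $ i * \<rho> j) + real (Suc m) * \<rho> i"
      using G(2)[OF xp, of i] B_sum[of i \<rho>] std_simplexD(3)[OF x] by (simp add: \<rho>_def)
    have last: "(\<Sum>j\<in>UNIV. \<nu> $ j / \<nu> $ i * a * q $ j $ i * \<phi> (x, j)) = a * (\<Sum>j\<in>UNIV. q $ j $ i * \<rho> j) / \<nu> $ i"
    proof -
      have *: "\<nu> $ j / \<nu> $ i * a * q $ j $ i * \<phi> (x, j) = a * (q $ j $ i * \<rho> j) / \<nu> $ i" for j
        using \<nu>pos[of j] by (simp add: \<phi>x)
      show ?thesis unfolding * sum_distrib_left sum_divide_distrib ..
    qed
    show ?thesis
    proof
      show "(\<lambda>y. \<phi> (y, i)) differentiable (at x)" using der by (auto simp: differentiable_def)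
      \<comment> \<open>The coefficients of \<open>\<rho> i\<close> cancel:
        \<open>CARD('n) - 1\<close> from the first term, \<open>m + 2 - CARD('n)\<close> from
        Euler's identity and \<open>- (m + 1)\<close> from the shift of the diagonal in
        \<open>B\<close>.\<close>
      show "(real CARD('n) - 1) * \<phi> (x, i)
       + (\<Sum>k\<in>UNIV. x $ k * partial_deriv k (\<lambda>y. \<phi> (y, i)) x)
       - partial_deriv i (\<lambda>y. \<phi> (y, i)) x
       + (\<Sum>j\<in>UNIV. \<nu> $ j / \<nu> $ i * a * q $ j $ i * \<phi> (x, j)) = 0"
        unfolding last pd Gx unfolding Gi \<phi>x
        by (simp add: diff_divide_distrib[symmetric] add_divide_distrib[symmetric] algebra_simps)
    qed
  qed
  show ?thesis
    by (rule exI[of _ \<pi>c], rule exI[of _ \<phi>])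
       (use decomp prob \<phi>m \<phi>0 pde in \<open>auto simp: \<pi>c_def\<close>)
qed

end
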